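(* Fix $0<\epsilon<1/12$. Let $\sigma\in\mathbb{C}^{d\times d}$ be a density matrix and let $\sigma^*$ be obtained from $\sigma$ by the mass-removal scheme described in the context (zeroing out at most $12\epsilon$ of eigenvalue mass). Then any algorithm that $\epsilon$-certifies $\sigma$ must use at least $\tilde\Omega(\|\sigma^*\|_{1/2}/\epsilon^2)$ copies of the unknown state, i.e., there are absolute constants $c,C>0$ such that at least $c\,\|\sigma^*\|_{1/2}/(\epsilon^2\log^C(d/\epsilon))$ copies are needed (for $d/\epsilon$ bounded away from $1$).
   Context: Task ($\epsilon$-certification of $\sigma$): a density matrix $\sigma$ is given by explicit description; the algorithm receives $n$ copies of an unknown density matrix $\rho$, promised that either $\rho=\sigma$ or $\|\rho-\sigma\|_1\ge\epsilon$ (trace norm), and must decide which holds with probability at least $2/3$ using arbitrary measurements, possibly entangled across all copies. For $p>0$, $\|X\|_p=(\sum_i s_i(X)^p)^{1/p}$ is the Schatten-$p$ (quasi)norm; so $\|\sigma^*\|_{1/2}=(\operatorname{tr}\sqrt{\sigma^*})^2$. Mass-removal scheme: write $\sigma=\mathrm{diag}(\lambda_1,\dots,\lambda_d)$ in an eigenbasis, considering only its nonzero eigenvalues (the argument is restricted to the support of $\sigma$). For $j\in\mathbb{Z}_{\ge0}$ let bucket $S_j=\{i:\lambda_i\in(2^{-j-1},2^{-j}]\}$, $d_j=|S_j|$, and $j(i)$ the bucket containing $i$. Sort indices in increasing order of $\hat\lambda_i=\lambda_i/d_{j(i)}$ (ties broken arbitrarily), relabeling so that $\hat\lambda_1\le\dots\le\hat\lambda_d$.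 Let $d'<d$ be the largest index with $\sum_{i=1}^{d'}\lambda_i\le 12\epsilon$ ($d'=0$ if none), and let $\sigma^*$ be the diagonal matrix obtained by zeroing out the entries $\lambda_1,\dots,\lambda_{d'}$ of $\sigma$.
   Formalization: The dimension is assumed to satisfy d ≥ 2: for d = 1 there is only one density matrix, no state is ε-far from σ, and zero copies suffice, so the stated bound fails. *)

theory Defs
  imports "Jordan_Normal_Form.Schur_Decomposition"
begin

definition mtrace :: "complex mat \<Rightarrow> complex" where
  "mtrace A = (\<Sum>i<dim_row A. A $$ (i, i))"

definition psd_mat :: "nat \<Rightarrow> complex mat \<Rightarrow> bool" where
  "psd_mat n A \<longleftrightarrow> A \<in> carrier_mat n n \<and> mat_adjoint A = A \<and>
     (\<forall>v \<in> carrier_vec n. Re ((A *\<^sub>v v) \<bullet>c v) \<ge> 0)"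

definition density_mat :: "nat \<Rightarrow> complex mat \<Rightarrow> bool" where
  "density_mat n \<rho> \<longleftrightarrow> psd_mat n \<rho> \<and> mtrace \<rho> = 1"

(* n-fold tensor power of a d x d matrix, as a d^n x d^n matrix
   (index i \<leftrightarrow> base-d digits of i). *)
definition tensor_pow :: "nat \<Rightarrow> nat \<Rightarrow> complex mat \<Rightarrow> complex mat" where
  "tensor_pow d n \<rho> = mat (d ^ n) (d ^ n)
     (\<lambda>(i, j). \<Prod>l<n. \<rho> $$ (i div d ^ l mod d, j div d ^ l mod d))"

definition eigenvalue_list :: "complex mat \<Rightarrow> complex list \<Rightarrow> bool" where
  "eigenvalue_list A es \<longleftrightarrow> char_poly A = (\<Prod>a\<leftarrow>es. [:- a, 1:])"

definition singular_values :: "complex mat \<Rightarrow> real list" where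
  "singular_values A = map (\<lambda>e. sqrt (Re e))
      (SOME es. eigenvalue_list (mat_adjoint A * A) es)"

definition schatten_norm :: "real \<Rightarrow> complex mat \<Rightarrow> real" where
  "schatten_norm p A = (\<Sum>s\<leftarrow>singular_values A. s powr p) powr (1 / p)"

definition trace_norm :: "complex mat \<Rightarrow> real" where
  "trace_norm A = schatten_norm 1 A"

(* A two-outcome measurement (POVM {M, I - M}) on k copies of a d-dim state
   that eps-certifies sigma with success probability >= 2/3:
   outcome M = "rho = sigma". *)
definition certifies :: "nat \<Rightarrow> complex mat \<Rightarrow> real \<Rightarrow> nat \<Rightarrow> bool" where
  "certifies d \<sigma> \<epsilon> k \<longleftrightarrow>
     (\<exists>M. psd_mat (d ^ k) M \<and> psd_mat (d ^ k) (1\<^sub>m (d ^ k) - M) \<and>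
        Re (mtrace (M * tensor_pow d k \<sigma>)) \<ge> 2 / 3 \<and>
        (\<forall>\<rho>. density_mat d \<rho> \<and> trace_norm (\<rho> - \<sigma>) \<ge> \<epsilon> \<longrightarrow>
           Re (mtrace (M * tensor_pow d k \<rho>)) \<le> 1 / 3))"

definition nonzero_spectrum :: "complex mat \<Rightarrow> real list \<Rightarrow> bool" where
  "nonzero_spectrum \<sigma> ls \<longleftrightarrow> (\<exists>es. eigenvalue_list \<sigma> es \<and>
     mset (map complex_of_real ls) = filter_mset (\<lambda>e. e \<noteq> 0) (mset es))"

definition bucket :: "real \<Rightarrow> nat" where
  "bucket x = (THE j::nat. 2 powr (- real j - 1) < x \<and> x \<le> 2 powr (- real j))"

definition hat_lambda :: "real list \<Rightarrow> real \<Rightarrow> real" where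
  "hat_lambda ls x = x / real (length (filter (\<lambda>y. bucket y = bucket x) ls))"

definition removed_count :: "real \<Rightarrow> real list \<Rightarrow> nat" where
  "removed_count \<epsilon> ls = (GREATEST k. k < length ls \<and> sum_list (take k ls) \<le> 12 * \<epsilon>)"

(* || sigma^* ||_{1/2} = (tr sqrt sigma^* )^2, with ls sorted by hat_lambda *)
definition sigma_star_half_norm :: "real \<Rightarrow> real list \<Rightarrow> real" where
  "sigma_star_half_norm \<epsilon> ls = (\<Sum>x\<leftarrow>drop (removed_count \<epsilon> ls) ls. sqrt x) ^ 2"

end

theory Submission
  imports Defs "HOL-Analysis.Convex" "HOL-Combinatorics.Permutations" "HOL-Library.FuncSet"
begin

text \<open>After diagonalizing \<open>\<sigma>\<close>, the hard alternatives are \<open>\<sigma> + \<Delta>\<close>, where \<open>\<Delta>\<close> has one off-diagonal entry of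
  random sign for each pair of a random perfect matching inside every dyadic bucket of eigenvalues.
  All these alternatives have the same trace distance from \<open>\<sigma>\<close>, the sum of the sizes of all entries.
  A second-moment bound reduces indistinguishability to the exponential moment
  of \<open>k \<cdot> tr(\<sigma>\<^sup>-\<^sup>1\<^sup>/\<^sup>2 \<Delta> \<sigma>\<^sup>-\<^sup>1\<^sup>/\<^sup>2 \<Delta>')\<close>, a signed count of the pairs common to two independent
  matchings. Since that count is essentially Poisson, each bucket contributes a bounded factor as long
  as \<open>k\<close> times the squared entry is at most the eigenvalue scale of the bucket, up to logarithms.

  For an eigenvalue \<open>\<lambda>\<close> surviving the mass removal, in a bucket of size \<open>D\<close>, the buckets of smaller \<open>\<lambda> / D\<close> carry
  mass at least \<open>12 \<epsilon>\<close>, and distributing an entry mass \<open>\<epsilon>\<close> over them yields \<open>D\<^sup>2 \<lambda> \<le> k \<epsilon>\<^sup>2\<close> up to logarithms.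
  Summing \<open>sqrt \<lambda> \<le> sqrt (k \<epsilon>\<^sup>2) / D\<close> over the survivors costs one factor per relevant bucket, hence
  only another logarithm.\<close>

section \<open>Adjoints, positivity and the spectral theorem\<close>

text \<open>Random signs on one fixed matching would not suffice: all of the roughly
  \<open>D / 2\<close> pairs of a bucket would then enter the exponent, and the bound would lose a
  factor \<open>sqrt D\<close>. Two random matchings share about one pair per bucket, whatever
  \<open>D\<close> is, and this turns an entry of size \<open>\<epsilon> / D\<close> into the full
  \<open>D\<^sup>2 * \<lambda>\<close>. The obstacle is buckets with a single element, which contain
  no pair. A single eigenvalue of size at least \<open>2 * \<epsilon>\<close> is played against an
  arbitrary second index: by a signed pair if the two eigenvalues are comparable, otherwise by a
  rotation. Smaller singletons are given up, at a cost of at most \<open>8 * \<epsilon>\<close> of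
  mass. Together with \<open>\<epsilon>\<close> for the tail of tiny eigenvalues, this leaves
  \<open>3 * \<epsilon>\<close> of the removed \<open>12 * \<epsilon>\<close>. The remaining factor
  3 is the price of pairing: a matching may cover only two thirds of a bucket, and an entry may be
  limited to half of the dyadic upper end.\<close>

lemma mat_adjoint_carrier [simp]:
  "A \<in> carrier_mat n m \<Longrightarrow> mat_adjoint A \<in> carrier_mat m n"
  by (auto simp: mat_adjoint_def)

lemma mat_adjoint_dim [simp]:
  "dim_row (mat_adjoint A) = dim_col A" "dim_col (mat_adjoint A) = dim_row A"
  by (auto simp: mat_adjoint_def)

lemma mat_adjoint_index:
  fixes A :: "complex mat"
  assumes "A \<in> carrier_mat n m" "i < m" "j < n"
  shows "mat_adjoint A $$ (i, j) = cnj (A $$ (j, i))"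
  using assms by (simp add: mat_adjoint_def mat_of_rows_index)

lemma mat_mult_index:
  assumes "A \<in> carrier_mat n m" "B \<in> carrier_mat m l" "i < n" "j < l"
  shows "(A * B) $$ (i, j) = (\<Sum>t<m. A $$ (i, t) * B $$ (t, j))"
  using assms by (simp add: scalar_prod_def atLeast0LessThan)

lemma mat_adjoint_mult:
  fixes A B :: "complex mat"
  assumes "A \<in> carrier_mat n m" "B \<in> carrier_mat m l"
  shows "mat_adjoint (A * B) = mat_adjoint B * mat_adjoint A"
proof (rule eq_matI)
  have AB: "A * B \<in> carrier_mat n l" using assms by simp
  fix i j assume "i < dim_row (mat_adjoint B * mat_adjoint A)" "j < dim_col (mat_adjoint B * mat_adjoint A)"
  then have i: "i < l" and j: "j < n" using assms by (auto simp: mat_adjoint_def)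
  show "mat_adjoint (A * B) $$ (i, j) = (mat_adjoint B * mat_adjoint A) $$ (i, j)"
    unfolding mat_adjoint_index[OF AB i j] mat_mult_index[OF assms j i]
      mat_mult_index[OF mat_adjoint_carrier[OF assms(2)] mat_adjoint_carrier[OF assms(1)] i j]
    using assms i j by (simp add: mat_adjoint_index mult.commute)
qed (use assms in \<open>auto simp: mat_adjoint_def\<close>)

lemma mat_adjoint_adjoint:
  fixes A :: "complex mat"
  assumes "A \<in> carrier_mat n m"
  shows "mat_adjoint (mat_adjoint A) = A"
  using assms mat_adjoint_carrier[OF assms] mat_adjoint_carrier[OF mat_adjoint_carrier[OF assms]]
  by (intro eq_matI) (auto simp: mat_adjoint_index simp del: mat_adjoint_carrier)

lemma mtrace_comm:
  assumes "A \<in> carrier_mat n m" "B \<in> carrier_mat m n"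
  shows "mtrace (A * B) = mtrace (B * A)"
proof -
  have "mtrace (A * B) = (\<Sum>i<n. \<Sum>j<m. A $$ (i, j) * B $$ (j, i))"
    using assms by (simp add: mtrace_def mat_mult_index del: index_mult_mat(1))
  also have "\<dots> = (\<Sum>j<m. \<Sum>i<n. B $$ (j, i) * A $$ (i, j))"
    by (subst sum.swap) (simp add: mult.commute)
  also have "\<dots> = mtrace (B * A)"
    using assms by (simp add: mtrace_def mat_mult_index del: index_mult_mat(1))
  finally show ?thesis .
qed

lemma quadratic_form_vec:
  fixes A :: "complex mat"
  assumes "A \<in> carrier_mat n n" "v \<in> carrier_vec n"
  shows "(A *\<^sub>v v) \<bullet>c v = (\<Sum>i<n. cnj (v $ i) * (\<Sum>j<n. A $$ (i, j) * v $ j))"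
  using assms by (simp add: scalar_prod_def atLeast0LessThan mult.commute)

text \<open>Entrywise form, so that test vectors can be plain functions and positivity becomes an
  inequality between double sums.\<close>

lemma psd_mat_iff:
  assumes "A \<in> carrier_mat n n"
  shows "psd_mat n A \<longleftrightarrow> (\<forall>i<n. \<forall>j<n. cnj (A $$ (j, i)) = A $$ (i, j)) \<and>
    (\<forall>x. 0 \<le> Re (\<Sum>i<n. cnj (x i) * (\<Sum>j<n. A $$ (i, j) * x j)))"
proof -
  have "mat_adjoint A = A \<longleftrightarrow> (\<forall>i<n. \<forall>j<n. cnj (A $$ (j, i)) = A $$ (i, j))"
  proof
    assume h: "mat_adjoint A = A"
    show "\<forall>i<n. \<forall>j<n. cnj (A $$ (j, i)) = A $$ (i, j)"
      using mat_adjoint_index[OF assms] unfolding h by metis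
  next
    show "\<forall>i<n. \<forall>j<n. cnj (A $$ (j, i)) = A $$ (i, j) \<Longrightarrow> mat_adjoint A = A"
      using assms mat_adjoint_carrier[OF assms]
      by (intro eq_matI) (auto simp: mat_adjoint_index simp del: mat_adjoint_carrier)
  qed
  moreover have "(\<forall>v\<in>carrier_vec n. 0 \<le> Re ((A *\<^sub>v v) \<bullet>c v)) \<longleftrightarrow>
    (\<forall>x. 0 \<le> Re (\<Sum>i<n. cnj (x i) * (\<Sum>j<n. A $$ (i, j) * x j)))" (is "?L \<longleftrightarrow> ?R")
  proof
    assume L: ?L
    show ?R
    proof
      fix x :: "nat \<Rightarrow> complex"
      have "(A *\<^sub>v vec n x) \<bullet>c vec n x = (\<Sum>i<n. cnj (x i) * (\<Sum>j<n. A $$ (i, j) * x j))"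
        by (subst quadratic_form_vec[OF assms]) auto
      then show "0 \<le> Re (\<Sum>i<n. cnj (x i) * (\<Sum>j<n. A $$ (i, j) * x j))"
        using L[rule_format, of "vec n x"] by simp
    qed
  next
    assume ?R
    then show ?L by (auto simp: quadratic_form_vec[OF assms] simp del: Re_sum)
  qed
  ultimately show ?thesis unfolding psd_mat_def using assms by blast
qed

lemma psd_mat_congruence:
  assumes "psd_mat n A" "V \<in> carrier_mat n n"
  shows "psd_mat n (mat_adjoint V * A * V)"
proof -
  have A: "A \<in> carrier_mat n n" and h: "mat_adjoint A = A" using assms by (auto simp: psd_mat_def)
  let ?V = "mat_adjoint V"
  have V: "?V \<in> carrier_mat n n" using assms by simp
  have "mat_adjoint (?V * A * V) = ?V * A * V"
    using A V assms(2) h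
    by (simp add: mat_adjoint_mult[of _ n n _ n] mat_adjoint_adjoint[of _ n n] assoc_mult_mat[of _ n n _ n _ n])
  moreover have "Re ((?V * A * V *\<^sub>v v) \<bullet>c v) \<ge> 0" if v: "v \<in> carrier_vec n" for v
  proof -
    have w: "V *\<^sub>v v \<in> carrier_vec n" using assms(2) v by simp
    have Aw: "A *\<^sub>v (V *\<^sub>v v) \<in> carrier_vec n" using A w by simp
    have "?V * A * V *\<^sub>v v = ?V *\<^sub>v (A *\<^sub>v (V *\<^sub>v v))"
      using A V assms(2) v by (simp add: assoc_mult_mat_vec[OF mult_carrier_mat[OF V A] assms(2) v] assoc_mult_mat_vec[OF V A w])
    moreover have "(?V *\<^sub>v y) \<bullet>c v = y \<bullet>c (V *\<^sub>v v)" if y: "y \<in> carrier_vec n" for y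
    proof -
      have "(?V *\<^sub>v y) \<bullet>c v = (\<Sum>i<n. \<Sum>j<n. cnj (V $$ (j, i)) * y $ j * cnj (v $ i))"
        using V v y assms(2)
        by (simp add: scalar_prod_def atLeast0LessThan mat_adjoint_index sum_distrib_right)
      also have "\<dots> = (\<Sum>j<n. \<Sum>i<n. y $ j * cnj (V $$ (j, i) * v $ i))"
        by (subst sum.swap) (simp add: mult_ac)
      also have "\<dots> = y \<bullet>c (V *\<^sub>v v)"
        using v y assms(2)
        by (simp add: scalar_prod_def atLeast0LessThan sum_distrib_left)
      finally show ?thesis .
    qed
    ultimately have "(?V * A * V *\<^sub>v v) \<bullet>c v = (A *\<^sub>v (V *\<^sub>v v)) \<bullet>c (V *\<^sub>v v)"
      using Aw by simp
    then show ?thesis using assms(1) w by (simp add: psd_mat_def)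
  qed
  moreover have "?V * A * V \<in> carrier_mat n n"
    by (rule mult_carrier_mat[OF mult_carrier_mat[OF V A] assms(2)])
  ultimately show ?thesis unfolding psd_mat_def by blast
qed

definition unitary_mat :: "nat \<Rightarrow> complex mat \<Rightarrow> bool" where
  "unitary_mat n U \<longleftrightarrow> U \<in> carrier_mat n n \<and> mat_adjoint U * U = 1\<^sub>m n \<and> U * mat_adjoint U = 1\<^sub>m n"

lemma unitary_matI:
  assumes "U \<in> carrier_mat n n" "mat_adjoint U * U = 1\<^sub>m n"
  shows "unitary_mat n U"
  using assms mat_mult_left_right_inverse[OF mat_adjoint_carrier[OF assms(1)] assms(1)]
  by (simp add: unitary_mat_def)

lemma unitary_mat_mult:
  assumes "unitary_mat n U" "unitary_mat n V"
  shows "unitary_mat n (U * V)"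
proof -
  have U: "U \<in> carrier_mat n n" "mat_adjoint U \<in> carrier_mat n n" "mat_adjoint U * U = 1\<^sub>m n"
    and V: "V \<in> carrier_mat n n" "mat_adjoint V \<in> carrier_mat n n" "mat_adjoint V * V = 1\<^sub>m n"
    using assms by (auto simp: unitary_mat_def)
  have "mat_adjoint (U * V) * (U * V) = mat_adjoint V * ((mat_adjoint U * U) * V)"
    using U(1,2) V(1,2) by (simp add: mat_adjoint_mult[of _ n n _ n] assoc_mult_mat[of _ n n _ n _ n])
  then show ?thesis using U V by (intro unitary_matI) auto
qed

text \<open>Gram-Schmidt on a basis completing \<open>v\<close> keeps its first vector but does not
  normalize, hence the division by \<open>sqrt (f j)\<close> in \<open>W\<close> and the unspecified
  scalar \<open>c\<close>. Deflation needs only the line spanned by \<open>v\<close>.\<close>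

lemma exists_unitary_first_col:
  fixes v :: "complex vec"
  assumes v: "v \<in> carrier_vec n" and v0: "v \<noteq> 0\<^sub>v n"
  obtains W c where "unitary_mat n W" "col W 0 = c \<cdot>\<^sub>v v"
proof -
  have n: "n \<noteq> 0" using v v0 by (metis carrier_vec_dim_vec vec_of_dim_0 carrier_vecD)
  interpret cof_vec_space n "TYPE(complex)" .
  define b where "b = basis_completion v"
  define ws where "ws = gram_schmidt n b"
  have b: "distinct b" "\<not> lin_dep (set b)" "set b \<subseteq> carrier_vec n" "hd b = v" "length b = n"
    using basis_completion[OF v v0, folded b_def] by auto
  then obtain vs where bv: "b = v # vs" using n by (cases b) auto
  have ws: "set ws \<subseteq> carrier_vec n" "corthogonal ws" "length ws = n"
    using gram_schmidt_result[OF b(3,1,2) refl, folded ws_def] b(5) by auto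
  have hd: "ws ! 0 = v"
    using gram_schmidt_hd[OF v, of vs, folded bv] ws(3) n unfolding ws_def
    by (metis hd_conv_nth length_0_conv)
  have car: "ws ! i \<in> carrier_vec n" if "i < n" for i using ws that by auto
  define f where "f i = (\<Sum>t<n. (cmod (ws ! i $ t))\<^sup>2)" for i
  have prod: "ws ! j \<bullet>c ws ! i = (\<Sum>t<n. cnj (ws ! i $ t) * ws ! j $ t)" if "i < n" "j < n" for i j
    using car[OF that(1)] car[OF that(2)] by (simp add: scalar_prod_def atLeast0LessThan mult.commute)
  have sq: "ws ! i \<bullet>c ws ! i = complex_of_real (f i)" if "i < n" for i
    unfolding prod[OF that that] f_def of_real_sum
    by (intro sum.cong refl) (metis complex_norm_square mult.commute of_real_power)
  have fpos: "f i > 0" if "i < n" for i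
  proof -
    have "f i \<noteq> 0" using sq[OF that] corthogonalD[OF ws(2), of i i] that ws(3) by auto
    moreover have "f i \<ge> 0" by (auto simp: f_def intro: sum_nonneg)
    ultimately show ?thesis by simp
  qed
  define W where "W = mat n n (\<lambda>(i, j). ws ! j $ i / complex_of_real (sqrt (f j)))"
  have W: "W \<in> carrier_mat n n" by (simp add: W_def)
  have "mat_adjoint W * W = 1\<^sub>m n"
  proof (rule eq_matI)
    fix i j assume "i < dim_row (1\<^sub>m n :: complex mat)" "j < dim_col (1\<^sub>m n :: complex mat)"
    then have i: "i < n" and j: "j < n" by auto
    have "(mat_adjoint W * W) $$ (i, j) = (\<Sum>t<n. cnj (W $$ (t, i)) * W $$ (t, j))"
      using W i j by (simp add: mat_mult_index[OF mat_adjoint_carrier[OF W] W] mat_adjoint_index[OF W] del: index_mult_mat)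
    also have "\<dots> = (\<Sum>t<n. cnj (ws ! i $ t) * ws ! j $ t) / complex_of_real (sqrt (f i) * sqrt (f j))"
      using i j by (simp add: W_def sum_divide_distrib)
    also have "\<dots> = (ws ! j \<bullet>c ws ! i) / complex_of_real (sqrt (f i) * sqrt (f j))"
      using prod[OF i j] by simp
    also have "\<dots> = (if i = j then 1 else 0)"
    proof (cases "i = j")
      case True
      have "sqrt (f j) * sqrt (f j) = f j" using fpos[OF j] by simp
      then show ?thesis using True sq[OF j] fpos[OF j] by (simp del: of_real_mult)
    next
      case False
      then have "ws ! j \<bullet>c ws ! i = 0" using corthogonalD[OF ws(2), of j i] i j ws(3) by auto
      then show ?thesis using False by simp
    qed
    finally show "(mat_adjoint W * W) $$ (i, j) = 1\<^sub>m n $$ (i, j)" using i j by simp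
  qed (use W in auto)
  then have "unitary_mat n W" using W by (rule unitary_matI[rotated])
  moreover have "col W 0 = (1 / complex_of_real (sqrt (f 0))) \<cdot>\<^sub>v v"
    using n W v hd by (intro eq_vecI) (auto simp: W_def)
  ultimately show thesis by (rule that)
qed

text \<open>Deflation: in an orthonormal basis starting with an eigenvector the first column is a
  multiple of the first unit vector, by self-adjointness so is the first row, and the remaining
  block is again self-adjoint and one size smaller.\<close>

theorem hermitian_unitary_diagonalization:
  fixes A :: "complex mat"
  assumes "A \<in> carrier_mat n n" "mat_adjoint A = A"
  shows "\<exists>U D. unitary_mat n U \<and> D \<in> carrier_mat n n \<and> diagonal_mat D \<and> A = U * D * mat_adjoint U"
  using assms
proof (induction n arbitrary: A)
  case 0
  have "unitary_mat 0 (1\<^sub>m 0)" by (auto simp: unitary_mat_def intro!: eq_matI)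
  moreover have "A = 1\<^sub>m 0 * A * mat_adjoint (1\<^sub>m 0)" "diagonal_mat A"
    using 0 by (auto simp: diagonal_mat_def intro!: eq_matI)
  ultimately show ?case using 0 by blast
next
  case (Suc n A)
  let ?N = "Suc n"
  have A: "A \<in> carrier_mat ?N ?N" and h: "mat_adjoint A = A" using Suc.prems by auto
  obtain as where as: "char_poly A = (\<Prod>a\<leftarrow>as. [:- a, 1:])" "length as = ?N"
    using char_poly_factorized[OF A] by auto
  then obtain e es where "as = e # es" by (cases as) auto
  then have "poly (char_poly A) e = 0" using as by simp
  then have "eigenvalue A e" using eigenvalue_root_char_poly[OF A] by simp
  then obtain v where v: "v \<in> carrier_vec ?N" "v \<noteq> 0\<^sub>v ?N" "A *\<^sub>v v = e \<cdot>\<^sub>v v"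
    using A by (auto simp: eigenvalue_def eigenvector_def)
  obtain W c where uW: "unitary_mat ?N W" and c: "col W 0 = c \<cdot>\<^sub>v v"
    using exists_unitary_first_col[OF v(1,2)] by metis
  have W: "W \<in> carrier_mat ?N ?N" "mat_adjoint W \<in> carrier_mat ?N ?N"
    and WW: "mat_adjoint W * W = 1\<^sub>m ?N" "W * mat_adjoint W = 1\<^sub>m ?N"
    using uW by (auto simp: unitary_mat_def)
  define A' where "A' = mat_adjoint W * A * W"
  have A': "A' \<in> carrier_mat ?N ?N" unfolding A'_def
    by (rule mult_carrier_mat[OF mult_carrier_mat[OF W(2) A] W(1)])
  have AW: "A * W \<in> carrier_mat ?N ?N" using A W by simp
  have h': "mat_adjoint A' = A'"
  proof -
    have "mat_adjoint A' = mat_adjoint W * (mat_adjoint A * mat_adjoint (mat_adjoint W))"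
      unfolding A'_def mat_adjoint_mult[OF mult_carrier_mat[OF W(2) A] W(1)] mat_adjoint_mult[OF W(2) A] ..
    also have "\<dots> = A'" unfolding A'_def h mat_adjoint_adjoint[OF W(1)]
      using assoc_mult_mat[OF W(2) A W(1)] by simp
    finally show ?thesis .
  qed
  have col0: "A' $$ (i, 0) = (if i = 0 then e else 0)" if i: "i < ?N" for i
  proof -
    have colAW: "(A * W) $$ (t, 0) = e * W $$ (t, 0)" if t: "t < ?N" for t
    proof -
      have "col (A * W) 0 = A *\<^sub>v col W 0" by (rule col_mult2[OF A W(1)]) simp
      also have "\<dots> = e \<cdot>\<^sub>v col W 0" unfolding c using A v
        by (simp add: mult_mat_vec smult_smult_assoc mult.commute)
      finally have "col (A * W) 0 $ t = (e \<cdot>\<^sub>v col W 0) $ t" by simp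
      then show ?thesis using t A W by simp
    qed
    have "A' $$ (i, 0) = (mat_adjoint W * (A * W)) $$ (i, 0)"
      unfolding A'_def using assoc_mult_mat[OF W(2) A W(1)] by simp
    also have "\<dots> = (\<Sum>t<?N. mat_adjoint W $$ (i, t) * (A * W) $$ (t, 0))"
      by (rule mat_mult_index[OF W(2) AW i]) simp
    also have "\<dots> = e * (\<Sum>t<?N. mat_adjoint W $$ (i, t) * W $$ (t, 0))"
      unfolding sum_distrib_left by (rule sum.cong) (simp_all only: lessThan_iff colAW mult_ac)
    also have "(\<Sum>t<?N. mat_adjoint W $$ (i, t) * W $$ (t, 0)) = (mat_adjoint W * W) $$ (i, 0)"
      by (rule mat_mult_index[OF W(2,1) i, symmetric]) simp
    finally show ?thesis unfolding WW using i by simp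
  qed
  have herm: "A' $$ (i, j) = cnj (A' $$ (j, i))" if "i < ?N" "j < ?N" for i j
    using mat_adjoint_index[OF A' that] unfolding h' .
  define A3 where "A3 = mat n n (\<lambda>(i, j). A' $$ (Suc i, Suc j))"
  have A3: "A3 \<in> carrier_mat n n" by (simp add: A3_def)
  have "mat_adjoint A3 = A3"
  proof (rule eq_matI)
    fix i j assume "i < dim_row A3" "j < dim_col A3"
    then have ij: "i < n" "j < n" using A3 by auto
    then show "mat_adjoint A3 $$ (i, j) = A3 $$ (i, j)"
      using mat_adjoint_index[OF A3 ij] herm[of "Suc i" "Suc j"] by (simp add: A3_def)
  qed (use A3 in auto)
  from Suc.IH[OF A3 this] obtain U D where U: "unitary_mat n U" and D: "D \<in> carrier_mat n n" "diagonal_mat D"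
    and AD: "A3 = U * D * mat_adjoint U" by auto
  have Uc: "U \<in> carrier_mat n n" "mat_adjoint U \<in> carrier_mat n n" "mat_adjoint U * U = 1\<^sub>m n"
    using U by (auto simp: unitary_mat_def)
  define V where "V = four_block_mat (1\<^sub>m 1) (0\<^sub>m 1 n) (0\<^sub>m n 1) U"
  define E where "E = four_block_mat (e \<cdot>\<^sub>m 1\<^sub>m 1) (0\<^sub>m 1 n) (0\<^sub>m n 1) D"
  have V: "V \<in> carrier_mat ?N ?N" and E: "E \<in> carrier_mat ?N ?N"
    using Uc D by (auto simp: V_def E_def)
  have Vadj: "mat_adjoint V = four_block_mat (1\<^sub>m 1) (0\<^sub>m 1 n) (0\<^sub>m n 1) (mat_adjoint U)"
  proof (rule eq_matI)
    fix i j assume "i < dim_row (four_block_mat (1\<^sub>m 1) (0\<^sub>m 1 n) (0\<^sub>m n 1) (mat_adjoint U))"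
      "j < dim_col (four_block_mat (1\<^sub>m 1) (0\<^sub>m 1 n) (0\<^sub>m n 1) (mat_adjoint U))"
    then have ij: "i < ?N" "j < ?N" using Uc by auto
    show "mat_adjoint V $$ (i, j) = four_block_mat (1\<^sub>m 1) (0\<^sub>m 1 n) (0\<^sub>m n 1) (mat_adjoint U) $$ (i, j)"
      unfolding mat_adjoint_index[OF V ij] using ij Uc(1)
      by (auto simp: V_def mat_adjoint_index[OF Uc(1)])
  qed (use V Uc in auto)
  have A'_blocks: "A' = four_block_mat (e \<cdot>\<^sub>m 1\<^sub>m 1) (0\<^sub>m 1 n) (0\<^sub>m n 1) A3"
  proof (rule eq_matI)
    fix i j assume "i < dim_row (four_block_mat (e \<cdot>\<^sub>m 1\<^sub>m 1) (0\<^sub>m 1 n) (0\<^sub>m n 1) A3)"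
      "j < dim_col (four_block_mat (e \<cdot>\<^sub>m 1\<^sub>m 1) (0\<^sub>m 1 n) (0\<^sub>m n 1) A3)"
    then have ij: "i < ?N" "j < ?N" using A3 by auto
    have "j \<noteq> 0 \<Longrightarrow> A' $$ (0, j) = 0" using herm[of 0 j] col0[of j] ij by simp
    then show "A' $$ (i, j) = four_block_mat (e \<cdot>\<^sub>m 1\<^sub>m 1) (0\<^sub>m 1 n) (0\<^sub>m n 1) A3 $$ (i, j)"
      using ij col0[OF ij(1)] A3 by (auto simp: A3_def)
  qed (use A' A3 in auto)
  have UD: "U * D \<in> carrier_mat n n" using Uc D by simp
  have "V * E = four_block_mat (e \<cdot>\<^sub>m 1\<^sub>m 1) (0\<^sub>m 1 n) (0\<^sub>m n 1) (U * D)"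
    unfolding V_def E_def using Uc D
    by (subst mult_four_block_mat[where ?nr1.0=1 and ?nr2.0=n and ?n1.0=1 and ?n2.0=n and ?nc1.0=1 and ?nc2.0=n]) auto
  then have "V * E * mat_adjoint V = four_block_mat (e \<cdot>\<^sub>m 1\<^sub>m 1) (0\<^sub>m 1 n) (0\<^sub>m n 1) (U * D * mat_adjoint U)"
    unfolding Vadj using Uc UD
    by (simp only:, subst mult_four_block_mat[where ?nr1.0=1 and ?nr2.0=n and ?n1.0=1 and ?n2.0=n and ?nc1.0=1 and ?nc2.0=n]) auto
  then have A'V: "A' = V * E * mat_adjoint V" unfolding A'_blocks AD by simp
  have "mat_adjoint V * V = 1\<^sub>m ?N"
    unfolding Vadj unfolding V_def using Uc
    by (subst mult_four_block_mat[where ?nr1.0=1 and ?nr2.0=n and ?n1.0=1 and ?n2.0=n and ?nc1.0=1 and ?nc2.0=n]) auto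
  then have uV: "unitary_mat ?N V" using V by (rule unitary_matI[rotated])
  have Va: "mat_adjoint V \<in> carrier_mat ?N ?N" using V by simp
  have "W * A' = W * (mat_adjoint W * (A * W))"
    unfolding A'_def using assoc_mult_mat[OF W(2) A W(1)] by simp
  also have "\<dots> = A * W"
    using assoc_mult_mat[OF W AW] left_mult_one_mat[OF AW] unfolding WW by simp
  finally have "W * A' * mat_adjoint W = A"
    using assoc_mult_mat[OF A W] right_mult_one_mat[OF A] unfolding WW by simp
  then have "A = W * A' * mat_adjoint W" by simp
  also have "W * A' = W * V * E * mat_adjoint V"
    unfolding A'V
    using assoc_mult_mat[OF W(1) mult_carrier_mat[OF V E] Va] assoc_mult_mat[OF W(1) V E] by simp
  also have "\<dots> * mat_adjoint W = W * V * E * (mat_adjoint V * mat_adjoint W)"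
    by (rule assoc_mult_mat[OF mult_carrier_mat[OF mult_carrier_mat[OF W(1) V] E] Va W(2)])
  also have "mat_adjoint V * mat_adjoint W = mat_adjoint (W * V)"
    using mat_adjoint_mult[OF W(1) V] by simp
  finally have "A = (W * V) * E * mat_adjoint (W * V)" .
  moreover have "diagonal_mat E" unfolding diagonal_mat_def
    using D by (auto simp: E_def diagonal_mat_def)
  ultimately show ?case using unitary_mat_mult[OF uW uV] E by blast
qed

section \<open>Real matrices and the trace norm\<close>

lemma order_prod_list_linear:
  fixes as :: "'a::idom list"
  shows "order x (\<Prod>a\<leftarrow>as. [:- a, 1:]) = count (mset as) x"
proof (induction as)
  case (Cons a as)
  have nz: "(\<Prod>a\<leftarrow>a # as. [:- a, 1:]) \<noteq> (0 :: 'a poly)"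
    by (simp only: prod_list_zero_iff) auto
  have "order x (\<Prod>a\<leftarrow>a # as. [:- a, 1:]) = order x [:- a, 1:] + order x (\<Prod>a\<leftarrow>as. [:- a, 1:])"
    using nz by (simp add: order_mult del: mult_pCons_left)
  also have "order x [:- a, 1:] = (if x = a then 1 else 0)"
    by (simp add: order_linear order_0I)
  finally show ?case using Cons.IH by simp
qed (simp add: order_0I)
lemma eigenvalue_list_unique:
  assumes "eigenvalue_list A es" "eigenvalue_list A es'"
  shows "mset es = mset es'"
  using assms unfolding eigenvalue_list_def
  by (intro multiset_eqI) (metis order_prod_list_linear)

text \<open>\<open>singular_values\<close> takes an arbitrary list through \<open>SOME\<close>. Root
  multiplicities of the characteristic polynomial determine that list up to order, so symmetric sums
  may be computed from any explicit factorization.\<close>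

lemma sum_singular_values:
  assumes "eigenvalue_list (mat_adjoint A * A) es"
  shows "(\<Sum>s\<leftarrow>singular_values A. f s) = (\<Sum>e\<leftarrow>es. f (sqrt (Re e)) :: real)"
proof -
  define es' where "es' = (SOME es. eigenvalue_list (mat_adjoint A * A) es)"
  have "eigenvalue_list (mat_adjoint A * A) es'"
    unfolding es'_def by (rule someI[of "eigenvalue_list (mat_adjoint A * A)", OF assms])
  then have "mset es' = mset es" using assms by (rule eigenvalue_list_unique)
  then have "mset (map (\<lambda>e. f (sqrt (Re e))) es') = mset (map (\<lambda>e. f (sqrt (Re e))) es)" by simp
  then have "sum_list (map (\<lambda>e. f (sqrt (Re e))) es') = sum_list (map (\<lambda>e. f (sqrt (Re e))) es)"
    by (metis sum_mset_sum_list)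
  then show ?thesis by (simp add: singular_values_def es'_def o_def)
qed

text \<open>In an eigenbasis of \<open>\<sigma>\<close> the states, the perturbations and their
  square roots are all real; only the measurement and the diagonalizing unitary stay
  complex.\<close>

definition rmat :: "nat \<Rightarrow> (nat \<Rightarrow> nat \<Rightarrow> real) \<Rightarrow> complex mat" where
  "rmat n f = mat n n (\<lambda>(i, j). complex_of_real (f i j))"

abbreviation dmat :: "nat \<Rightarrow> (nat \<Rightarrow> real) \<Rightarrow> complex mat" where
  "dmat n l \<equiv> rmat n (\<lambda>i j. if i = j then l i else 0)"

lemma rmat_carrier [simp]: "rmat n f \<in> carrier_mat n n"
  by (simp add: rmat_def)

lemma rmat_index [simp]: "i < n \<Longrightarrow> j < n \<Longrightarrow> rmat n f $$ (i, j) = complex_of_real (f i j)"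
  by (simp add: rmat_def)

lemma rmat_dim [simp]: "dim_row (rmat n f) = n" "dim_col (rmat n f) = n"
  by (simp_all add: rmat_def)

lemma rmat_cong:
  "(\<And>i j. i < n \<Longrightarrow> j < n \<Longrightarrow> f i j = g i j) \<Longrightarrow> rmat n f = rmat n g"
  by (auto intro!: eq_matI)

lemma rmat_minus: "rmat n f - rmat n g = rmat n (\<lambda>i j. f i j - g i j)"
  by (auto intro!: eq_matI)

lemma rmat_mult: "rmat n f * rmat n g = rmat n (\<lambda>i j. \<Sum>t<n. f i t * g t j)"
  by (rule eq_matI) (auto simp: mat_mult_index[OF rmat_carrier rmat_carrier] simp del: index_mult_mat(1))

lemma rmat_adjoint: "mat_adjoint (rmat n f) = rmat n (\<lambda>i j. f j i)"
  by (rule eq_matI) (auto simp: mat_adjoint_index[OF rmat_carrier])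

lemma mtrace_rmat: "mtrace (rmat n f) = complex_of_real (\<Sum>i<n. f i i)"
  by (simp add: mtrace_def)

lemma eigenvalue_list_dmat:
  "eigenvalue_list (dmat n l) (map (\<lambda>i. complex_of_real (l i)) [0..<n])"
proof -
  have "upper_triangular (dmat n l)" by (auto simp: upper_triangular_def)
  then have "char_poly (dmat n l) = (\<Prod>a\<leftarrow>diag_mat (dmat n l). [:- a, 1:])"
    by (rule char_poly_upper_triangular[OF rmat_carrier])
  moreover have "diag_mat (dmat n l) = map (\<lambda>i. complex_of_real (l i)) [0..<n]"
    by (simp add: diag_mat_def)
  ultimately show ?thesis by (simp add: eigenvalue_list_def)
qed

text \<open>If the square of a symmetric matrix is diagonal, the singular values can be read off
  that diagonal. Both kinds of perturbation used below, signed matchings and the difference made by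
  a plane rotation, have this shape.\<close>

lemma trace_norm_rmat:
  assumes sym: "\<And>i j. i < n \<Longrightarrow> j < n \<Longrightarrow> f i j = f j i"
    and sq: "\<And>i j. i < n \<Longrightarrow> j < n \<Longrightarrow> (\<Sum>t<n. f i t * f t j) = (if i = j then (g i)\<^sup>2 else 0)"
    and nn: "\<And>i. i < n \<Longrightarrow> g i \<ge> 0"
  shows "trace_norm (rmat n f) = (\<Sum>i<n. g i)"
proof -
  have "mat_adjoint (rmat n f) * rmat n f = dmat n (\<lambda>i. (g i)\<^sup>2)"
    unfolding rmat_adjoint rmat_mult
  proof (rule rmat_cong)
    fix i j assume "i < n" "j < n"
    moreover from this have "(\<Sum>t<n. f t i * f t j) = (\<Sum>t<n. f i t * f t j)"
      by (intro sum.cong refl) (simp add: sym)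
    ultimately show "(\<Sum>t<n. f t i * f t j) = (if i = j then (g i)\<^sup>2 else 0)" by (simp add: sq)
  qed
  then have "eigenvalue_list (mat_adjoint (rmat n f) * rmat n f) (map (\<lambda>i. complex_of_real ((g i)\<^sup>2)) [0..<n])"
    using eigenvalue_list_dmat[of n "\<lambda>i. (g i)\<^sup>2"] by simp
  from sum_singular_values[OF this, of "\<lambda>s. s powr 1"]
  have "(\<Sum>s\<leftarrow>singular_values (rmat n f). s powr 1) = (\<Sum>i<n. sqrt ((g i)\<^sup>2) powr 1)"
    by (simp add: o_def sum_list_distinct_conv_sum_set atLeast0LessThan)
  also have "\<dots> = (\<Sum>i<n. g i)" by (rule sum.cong) (auto simp: nn)
  finally have "(\<Sum>s\<leftarrow>singular_values (rmat n f). s powr 1) = (\<Sum>i<n. g i)" .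
  moreover have "0 \<le> (\<Sum>i<n. g i)" by (intro sum_nonneg) (simp add: nn)
  ultimately show ?thesis by (simp add: trace_norm_def schatten_norm_def)
qed

text \<open>The product of adjoint and matrix is conjugated by the same unitary, so its
  characteristic polynomial, on which alone \<open>singular_values\<close> depends, does not
  change.\<close>

lemma trace_norm_unitary:
  assumes U: "unitary_mat n U" and A: "A \<in> carrier_mat n n"
  shows "trace_norm (U * A * mat_adjoint U) = trace_norm A"
proof -
  let ?V = "mat_adjoint U" let ?B = "U * A * ?V"
  have Uc: "U \<in> carrier_mat n n" "?V \<in> carrier_mat n n" "?V * U = 1\<^sub>m n" "U * ?V = 1\<^sub>m n"
    using U by (auto simp: unitary_mat_def)
  have Aa: "mat_adjoint A \<in> carrier_mat n n" using A by (rule mat_adjoint_carrier)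
  have UA: "U * A \<in> carrier_mat n n" and AV: "A * ?V \<in> carrier_mat n n" and AA: "mat_adjoint A * A \<in> carrier_mat n n"
    and AaV: "mat_adjoint A * ?V \<in> carrier_mat n n" and UAa: "U * mat_adjoint A \<in> carrier_mat n n"
    using A Aa Uc mult_carrier_mat by metis+
  have "mat_adjoint ?B = mat_adjoint ?V * mat_adjoint (U * A)" by (rule mat_adjoint_mult[OF UA Uc(2)])
  also have "\<dots> = U * (mat_adjoint A * ?V)"
    unfolding mat_adjoint_mult[OF Uc(1) A] mat_adjoint_adjoint[OF Uc(1)] ..
  finally have Ba: "mat_adjoint ?B = U * mat_adjoint A * ?V" using assoc_mult_mat[OF Uc(1) Aa Uc(2)] by simp
  have "?V * ?B = A * ?V"
    using assoc_mult_mat[OF Uc(1) A Uc(2)] assoc_mult_mat[OF Uc(2,1) AV] left_mult_one_mat[OF AV]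
    unfolding Uc by simp
  then have "mat_adjoint ?B * ?B = U * mat_adjoint A * (A * ?V)"
    unfolding Ba using assoc_mult_mat[OF UAa Uc(2) mult_carrier_mat[OF UA Uc(2)]] by simp
  also have "\<dots> = U * (mat_adjoint A * A) * ?V"
    using assoc_mult_mat[OF UAa A Uc(2)] assoc_mult_mat[OF Uc(1) Aa A] by simp
  finally have eq: "mat_adjoint ?B * ?B = U * (mat_adjoint A * A) * ?V" .
  have "similar_mat (mat_adjoint ?B * ?B) (mat_adjoint A * A)"
    by (rule similar_matI[OF _ Uc(4) Uc(3) eq])
      (use AA Uc mult_carrier_mat[OF mult_carrier_mat[OF Uc(1) AA] Uc(2)] eq in auto)
  then have "char_poly (mat_adjoint ?B * ?B) = char_poly (mat_adjoint A * A)"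
    by (rule char_poly_similar)
  then show ?thesis unfolding trace_norm_def schatten_norm_def singular_values_def eigenvalue_list_def by simp
qed

section \<open>Tensor powers\<close>

text \<open>The base-\<open>d\<close> digits of the numbers below \<open>d ^ n\<close> run
  independently through all \<open>n\<close>-tuples. Every computation with tensor powers (products,
  norms, overlaps) reduces to this factorization.\<close>

lemma digit_sum_prod:
  fixes f :: "nat \<Rightarrow> nat \<Rightarrow> 'a::comm_semiring_1"
  shows "(\<Sum>j<d ^ n. \<Prod>l<n. f l (j div d ^ l mod d)) = (\<Prod>l<n. \<Sum>x<d. f l x)"
proof (induction n)
  case (Suc n)
  show ?case
  proof (cases "d = 0")
    case False
    \<comment> \<open>Splits off the most significant digit \<open>q\<close>; the lower digits of
      \<open>r + d ^ n * q\<close> are those of \<open>r\<close>.\<close>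
    define g where "g = (\<lambda>(r, q). r + d ^ n * q :: nat)"
    have inj: "inj_on g ({..<d ^ n} \<times> {..<d})"
    proof (rule inj_onI, clarsimp simp: g_def)
      fix r q r' q' assume a: "r < d ^ n" "r' < d ^ n" "r + d ^ n * q = r' + d ^ n * q'"
      have "(r + d ^ n * q) div d ^ n = q" "(r' + d ^ n * q') div d ^ n = q'"
        using a(1,2) False by simp_all
      then have "q = q'" using a(3) by metis
      then show "r = r' \<and> q = q'" using a by simp
    qed
    have im: "g ` ({..<d ^ n} \<times> {..<d}) = {..<d ^ Suc n}"
    proof (intro equalityI subsetI)
      fix j assume "j \<in> g ` ({..<d ^ n} \<times> {..<d})"
      then obtain r q where rq: "j = r + d ^ n * q" "r < d ^ n" "q < d" by (auto simp: g_def)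
      then have "j < d ^ n * (q + 1)" by simp
      also have "\<dots> \<le> d ^ n * d" using rq by (intro mult_left_mono) auto
      finally show "j \<in> {..<d ^ Suc n}" by (simp add: mult.commute)
    next
      fix j assume j: "j \<in> {..<d ^ Suc n}"
      have "j = g (j mod d ^ n, j div d ^ n)" by (simp add: g_def)
      moreover have "j div d ^ n < d" using j False by (simp add: div_less_iff_less_mult mult.commute)
      ultimately show "j \<in> g ` ({..<d ^ n} \<times> {..<d})" using False by auto
    qed
    have digit: "(r + d ^ n * q) div d ^ l mod d = r div d ^ l mod d" if "l < n" for r q l
    proof -
      have "d ^ n = d ^ l * (d * d ^ (n - Suc l))" using that
        by (metis Suc_leI power_Suc power_add le_add_diff_inverse add_Suc_right add_Suc mult.assoc mult.commute)
      then have eq: "r + d ^ n * q = r + d ^ l * (d * (d ^ (n - Suc l) * q))" by (simp add: mult_ac)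
      have "(r + d ^ n * q) div d ^ l = d * (d ^ (n - Suc l) * q) + r div d ^ l"
        unfolding eq using False by simp
      then show ?thesis by simp
    qed
    have "(\<Sum>j<d ^ Suc n. \<Prod>l<Suc n. f l (j div d ^ l mod d))
        = (\<Sum>x\<in>{..<d ^ n} \<times> {..<d}. \<Prod>l<Suc n. f l (g x div d ^ l mod d))"
      unfolding im[symmetric] by (simp add: sum.reindex[OF inj])
    also have "\<dots> = (\<Sum>x\<in>{..<d ^ n} \<times> {..<d}. (\<Prod>l<n. f l (fst x div d ^ l mod d)) * f n (snd x))"
    proof (rule sum.cong)
      fix x assume "x \<in> {..<d ^ n} \<times> {..<d}"
      then obtain r q where "x = (r, q)" "r < d ^ n" "q < d" by auto
      then show "(\<Prod>l<Suc n. f l (g x div d ^ l mod d)) = (\<Prod>l<n. f l (fst x div d ^ l mod d)) * f n (snd x)"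
        using False by (simp add: g_def digit)
    qed simp
    also have "\<dots> = (\<Sum>r<d ^ n. \<Prod>l<n. f l (r div d ^ l mod d)) * (\<Sum>q<d. f n q)"
      by (simp add: sum_product sum.cartesian_product case_prod_beta)
    finally show ?thesis using Suc by simp
  qed simp
qed simp

text \<open>The tensor power at the level of entry functions, generic in the scalars: the same
  identities then serve complex matrix entries and real kernels, including kernels divided by
  weights.\<close>

definition tpow :: "nat \<Rightarrow> nat \<Rightarrow> (nat \<Rightarrow> nat \<Rightarrow> 'a::comm_semiring_1) \<Rightarrow> nat \<Rightarrow> nat \<Rightarrow> 'a" where
  "tpow d n f i j = (\<Prod>l<n. f (i div d ^ l mod d) (j div d ^ l mod d))"

lemma tpow_sum1: "(\<Sum>j<d ^ n. tpow d n f i j * tpow d n g j t) = tpow d n (\<lambda>x y. \<Sum>z<d. f x z * g z y) i t"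
  unfolding tpow_def prod.distrib[symmetric]
  by (rule digit_sum_prod[of "\<lambda>l z. f (i div d ^ l mod d) z * g z (t div d ^ l mod d)"])

lemma tpow_sum2: "(\<Sum>i<d ^ n. \<Sum>j<d ^ n. tpow d n f i j) = (\<Sum>x<d. \<Sum>y<d. f x y) ^ n"
proof -
  have "(\<Sum>i<d ^ n. \<Sum>j<d ^ n. tpow d n f i j) = (\<Sum>i<d ^ n. \<Prod>l<n. \<Sum>y<d. f (i div d ^ l mod d) y)"
    unfolding tpow_def by (rule sum.cong[OF refl]) (rule digit_sum_prod)
  also have "\<dots> = (\<Prod>l<n. \<Sum>x<d. \<Sum>y<d. f x y)"
    by (rule digit_sum_prod[of "\<lambda>l x. \<Sum>y<d. f x y"])
  finally show ?thesis by simp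
qed

lemma tensor_pow_carrier [simp]: "tensor_pow d n A \<in> carrier_mat (d ^ n) (d ^ n)"
  by (simp add: tensor_pow_def)

lemma tensor_pow_dim [simp]: "dim_row (tensor_pow d n A) = d ^ n" "dim_col (tensor_pow d n A) = d ^ n"
  by (simp_all add: tensor_pow_def)

lemma tensor_pow_index:
  "i < d ^ n \<Longrightarrow> j < d ^ n \<Longrightarrow> tensor_pow d n A $$ (i, j) = tpow d n (\<lambda>x y. A $$ (x, y)) i j"
  by (simp add: tensor_pow_def tpow_def)

lemma digit_less:
  assumes "i < d ^ n" "l < n"
  shows "i div d ^ l mod d < (d::nat)"
  using assms by (cases "d = 0") (auto simp: power_0_left)

lemma tpow_cong:
  assumes "i < d ^ n" "j < d ^ n" "\<And>x y. x < d \<Longrightarrow> y < d \<Longrightarrow> f x y = g x y"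
  shows "tpow d n f i j = tpow d n g i j"
  unfolding tpow_def using digit_less[OF assms(1)] digit_less[OF assms(2)]
  by (intro prod.cong refl assms(3)) auto

lemma tensor_pow_mult:
  assumes "A \<in> carrier_mat d d" "B \<in> carrier_mat d d"
  shows "tensor_pow d n (A * B) = tensor_pow d n A * tensor_pow d n B"
proof (rule eq_matI)
  fix i j assume "i < dim_row (tensor_pow d n A * tensor_pow d n B)" "j < dim_col (tensor_pow d n A * tensor_pow d n B)"
  then have ij: "i < d ^ n" "j < d ^ n" by auto
  have "(tensor_pow d n A * tensor_pow d n B) $$ (i, j)
      = (\<Sum>t<d ^ n. tensor_pow d n A $$ (i, t) * tensor_pow d n B $$ (t, j))"
    by (rule mat_mult_index[OF tensor_pow_carrier tensor_pow_carrier ij])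
  also have "\<dots> = (\<Sum>t<d ^ n. tpow d n (\<lambda>x y. A $$ (x, y)) i t * tpow d n (\<lambda>x y. B $$ (x, y)) t j)"
    using ij by (simp add: tensor_pow_index)
  also have "\<dots> = tpow d n (\<lambda>x y. \<Sum>z<d. A $$ (x, z) * B $$ (z, y)) i j" by (rule tpow_sum1)
  also have "\<dots> = tpow d n (\<lambda>x y. (A * B) $$ (x, y)) i j"
    using mat_mult_index[OF assms] by (intro tpow_cong ij) (simp del: index_mult_mat)
  finally show "tensor_pow d n (A * B) $$ (i, j) = (tensor_pow d n A * tensor_pow d n B) $$ (i, j)"
    using ij by (simp add: tensor_pow_index del: index_mult_mat)
qed auto

lemma tensor_pow_adjoint:
  assumes "A \<in> carrier_mat d d"
  shows "tensor_pow d n (mat_adjoint A) = mat_adjoint (tensor_pow d n A)"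
proof (rule eq_matI)
  fix i j assume "i < dim_row (mat_adjoint (tensor_pow d n A))" "j < dim_col (mat_adjoint (tensor_pow d n A))"
  then have ij: "i < d ^ n" "j < d ^ n" by auto
  have "mat_adjoint (tensor_pow d n A) $$ (i, j) = cnj (tensor_pow d n A $$ (j, i))"
    by (rule mat_adjoint_index[OF tensor_pow_carrier ij])
  also have "\<dots> = tpow d n (\<lambda>x y. cnj (A $$ (y, x))) i j"
    using ij by (simp add: tensor_pow_index tpow_def)
  also have "\<dots> = tpow d n (\<lambda>x y. mat_adjoint A $$ (x, y)) i j"
    by (intro tpow_cong ij) (simp add: mat_adjoint_index[OF assms])
  finally show "tensor_pow d n (mat_adjoint A) $$ (i, j) = mat_adjoint (tensor_pow d n A) $$ (i, j)"
    using ij by (simp add: tensor_pow_index)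
qed auto

lemma digits_eqI:
  assumes "i < d ^ n" "j < d ^ n" "\<And>l. l < n \<Longrightarrow> i div d ^ l mod d = j div d ^ l mod (d::nat)"
  shows "i = j"
  using assms
proof (induction n arbitrary: i j)
  case (Suc n)
  have "i div d = j div d"
  proof (rule Suc.IH)
    show "i div d < d ^ n" "j div d < d ^ n" using Suc.prems(1,2)
      by (auto simp: less_mult_imp_div_less mult.commute)
    fix l assume "l < n"
    then show "i div d div d ^ l mod d = j div d div d ^ l mod d"
      using Suc.prems(3)[of "Suc l"] by (simp add: div_mult2_eq)
  qed
  moreover have "i mod d = j mod d" using Suc.prems(3)[of 0] by simp
  ultimately show ?case by (metis div_mult_mod_eq)
qed simp

lemma tensor_pow_one: "tensor_pow d n (1\<^sub>m d) = 1\<^sub>m (d ^ n)"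
proof (rule eq_matI)
  fix i j assume "i < dim_row (1\<^sub>m (d ^ n))" "j < dim_col (1\<^sub>m (d ^ n))"
  then have ij: "i < d ^ n" "j < d ^ n" by auto
  have e: "(1\<^sub>m d :: complex mat) $$ (i div d ^ l mod d, j div d ^ l mod d) = (if i div d ^ l mod d = j div d ^ l mod d then 1 else 0)"
    if "l < n" for l
    using digit_less[OF ij(1) that] digit_less[OF ij(2) that] by simp
  show "tensor_pow d n (1\<^sub>m d) $$ (i, j) = 1\<^sub>m (d ^ n) $$ (i, j)"
  proof (cases "i = j")
    case True
    then have "tpow d n (\<lambda>x y. 1\<^sub>m d $$ (x, y)) i j = (1::complex)"
      using e unfolding True tpow_def by (intro prod.neutral ballI) (simp del: index_one_mat)
    then show ?thesis using ij True by (simp add: tensor_pow_index)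
  next
    case False
    then obtain l where "l < n" "i div d ^ l mod d \<noteq> j div d ^ l mod d" using digits_eqI[OF ij] by blast
    then have "tpow d n (\<lambda>x y. 1\<^sub>m d $$ (x, y)) i j = (0::complex)"
      unfolding tpow_def by (intro prod_zero) (auto intro!: bexI[of _ l] simp: e simp del: index_one_mat)
    then show ?thesis using False ij by (simp add: tensor_pow_index)
  qed
qed auto

lemma unitary_tensor_pow:
  assumes "unitary_mat d U"
  shows "unitary_mat (d ^ n) (tensor_pow d n U)"
proof (rule unitary_matI)
  have U: "U \<in> carrier_mat d d" "mat_adjoint U \<in> carrier_mat d d" "mat_adjoint U * U = 1\<^sub>m d"
    using assms by (auto simp: unitary_mat_def)
  show "mat_adjoint (tensor_pow d n U) * tensor_pow d n U = 1\<^sub>m (d ^ n)"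
    unfolding tensor_pow_adjoint[OF U(1), symmetric] tensor_pow_mult[OF U(2,1), symmetric] U(3)
    by (rule tensor_pow_one)
qed simp

lemma tensor_pow_rmat: "tensor_pow d n (rmat d f) = rmat (d ^ n) (tpow d n f)"
proof (rule eq_matI)
  fix i j assume "i < dim_row (rmat (d ^ n) (tpow d n f))" "j < dim_col (rmat (d ^ n) (tpow d n f))"
  then have ij: "i < d ^ n" "j < d ^ n" by auto
  have "tpow d n (\<lambda>x y. rmat d f $$ (x, y)) i j = tpow d n (\<lambda>x y. complex_of_real (f x y)) i j"
    by (intro tpow_cong ij) simp
  then show "tensor_pow d n (rmat d f) $$ (i, j) = rmat (d ^ n) (tpow d n f) $$ (i, j)"
    using ij by (simp add: tensor_pow_index tpow_def)
qed auto

section \<open>Distinguishability under a measurement\<close>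

lemma psd_mat_carrier: "psd_mat n A \<Longrightarrow> A \<in> carrier_mat n n"
  by (simp add: psd_mat_def)

lemma psd_mat_hermitian:
  assumes "psd_mat n A" "i < n" "j < n"
  shows "cnj (A $$ (j, i)) = A $$ (i, j)"
  using assms psd_mat_iff[OF psd_mat_carrier[OF assms(1)]] by auto

text \<open>With \<open>y = M x\<close>, positivity of \<open>M\<close> at \<open>x - y\<close> and
  \<open>M \<le> 1\<close> at \<open>y\<close> give that the squared norm of \<open>y\<close> is at
  most the quadratic form of \<open>M\<close> at \<open>x\<close>, which is at most the squared norm
  of \<open>x\<close>.\<close>

lemma measurement_contraction:
  assumes M: "psd_mat n M" and M': "psd_mat n (1\<^sub>m n - M)"
  shows "(\<Sum>i<n. (cmod (\<Sum>j<n. M $$ (i, j) * x j))\<^sup>2) \<le> (\<Sum>i<n. (cmod (x i))\<^sup>2)"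
proof -
  have Mc: "M \<in> carrier_mat n n" by (rule psd_mat_carrier[OF M])
  define y where "y i = (\<Sum>j<n. M $$ (i, j) * x j)" for i
  define q where "q a b = (\<Sum>i<n. cnj (a i) * (\<Sum>j<n. M $$ (i, j) * b j))" for a b :: "nat \<Rightarrow> complex"
  have pos: "0 \<le> Re (q a a)" for a
    using M unfolding psd_mat_iff[OF Mc] q_def by blast
  have le1: "Re (q a a) \<le> (\<Sum>i<n. (cmod (a i))\<^sup>2)" for a
  proof -
    have idx: "(\<Sum>j<n. (1\<^sub>m n - M) $$ (i, j) * a j) = a i - (\<Sum>j<n. M $$ (i, j) * a j)" if "i < n" for i
    proof -
      have "(\<Sum>j<n. (1\<^sub>m n - M) $$ (i, j) * a j) = (\<Sum>j<n. (if j = i then a j else 0) - M $$ (i, j) * a j)"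
        using that Mc by (intro sum.cong) (auto simp: left_diff_distrib)
      then show ?thesis using that by (simp add: sum_subtractf)
    qed
    have "0 \<le> Re (\<Sum>i<n. cnj (a i) * (\<Sum>j<n. (1\<^sub>m n - M) $$ (i, j) * a j))"
      using M' psd_mat_iff[OF psd_mat_carrier[OF M']] by blast
    also have "(\<Sum>i<n. cnj (a i) * (\<Sum>j<n. (1\<^sub>m n - M) $$ (i, j) * a j))
        = (\<Sum>i<n. cnj (a i) * a i) - q a a"
      unfolding q_def sum_subtractf[symmetric] by (intro sum.cong refl) (simp add: idx right_diff_distrib)
    also have "(\<Sum>i<n. cnj (a i) * a i) = complex_of_real (\<Sum>i<n. (cmod (a i))\<^sup>2)"
      unfolding of_real_sum by (intro sum.cong refl) (metis complex_norm_square mult.commute of_real_power)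
    finally show ?thesis by simp
  qed
  have yx: "q y x = complex_of_real (\<Sum>i<n. (cmod (y i))\<^sup>2)"
    unfolding q_def y_def[symmetric] of_real_sum
    by (intro sum.cong refl) (metis complex_norm_square mult.commute of_real_power)
  have xy: "q x y = cnj (q y x)"
  proof -
    have "cnj (q y x) = (\<Sum>i<n. \<Sum>j<n. cnj (x j) * (M $$ (j, i) * y i))"
      unfolding q_def cnj_sum complex_cnj_mult complex_cnj_cnj sum_distrib_left
      by (intro sum.cong refl) (simp add: psd_mat_hermitian[OF M] mult_ac)
    also have "\<dots> = q x y" unfolding q_def sum_distrib_left by (rule sum.swap)
    finally show ?thesis by simp
  qed
  have "q (\<lambda>i. x i - y i) (\<lambda>i. x i - y i) = q x x - q y x - q x y + q y y"
    unfolding q_def by (simp add: algebra_simps sum_subtractf sum.distrib sum_distrib_left)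
  then have "0 \<le> Re (q x x) - Re (q y x) - Re (q x y) + Re (q y y)"
    using pos[of "\<lambda>i. x i - y i"] by simp
  then have "(\<Sum>i<n. (cmod (y i))\<^sup>2) \<le> Re (q x x)"
    using le1[of y] unfolding xy yx by simp
  also have "\<dots> \<le> (\<Sum>i<n. (cmod (x i))\<^sup>2)" by (rule le1)
  finally show ?thesis by (simp add: y_def)
qed

lemma Re_mtrace_mult_rmat:
  assumes "M \<in> carrier_mat n n"
  shows "Re (mtrace (M * rmat n X)) = (\<Sum>a<n. \<Sum>b<n. Re (M $$ (a, b)) * X b a)"
  using assms by (simp add: mtrace_def mat_mult_index[OF assms rmat_carrier] del: index_mult_mat(1))

lemma Cauchy_Schwarz_double_sum:
  fixes f g :: "'a \<Rightarrow> 'b \<Rightarrow> real"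
  shows "(\<Sum>a\<in>A. \<Sum>b\<in>B. f a b * g a b)\<^sup>2 \<le> (\<Sum>a\<in>A. \<Sum>b\<in>B. (f a b)\<^sup>2) * (\<Sum>a\<in>A. \<Sum>b\<in>B. (g a b)\<^sup>2)"
  unfolding sum.cartesian_product case_prod_beta by (rule Cauchy_Schwarz_ineq_sum)

text \<open>The hypothesis on \<open>X\<close> makes the convention \<open>x / 0 = 0\<close> harmless.\<close>

lemma measurement_chi_square:
  assumes M: "psd_mat n M" and M': "psd_mat n (1\<^sub>m n - M)"
    and u: "\<And>a. a < n \<Longrightarrow> 0 \<le> u a" "(\<Sum>a<n. (u a)\<^sup>2) \<le> 1"
    and X: "\<And>a b. a < n \<Longrightarrow> b < n \<Longrightarrow> u a * u b = 0 \<Longrightarrow> X b a = 0"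
  shows "(Re (mtrace (M * rmat n X)))\<^sup>2 \<le> (\<Sum>a<n. \<Sum>b<n. (X a b)\<^sup>2 / (u a * u b))"
proof -
  define m where "m a b = cmod (M $$ (a, b))" for a b
  have sym: "m a b = m b a" if "a < n" "b < n" for a b
    unfolding m_def using psd_mat_hermitian[OF M that] by (metis complex_mod_cnj)
  \<comment> \<open>Contraction applied to the unit vector of index \<open>b\<close>.\<close>
  have row: "(\<Sum>a<n. (m a b)\<^sup>2) \<le> 1" if "b < n" for b
  proof -
    have "(\<Sum>a<n. (m a b)\<^sup>2) = (\<Sum>a<n. (cmod (\<Sum>j<n. M $$ (a, j) * (if j = b then 1 else 0)))\<^sup>2)"
      using that by (simp add: m_def if_distrib cong: if_cong)
    also have "\<dots> \<le> (\<Sum>a<n. (cmod (if a = b then 1 else 0))\<^sup>2)"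
      by (rule measurement_contraction[OF M M'])
    also have "\<dots> = (\<Sum>a<n. if a = b then 1 else 0)" by (intro sum.cong) auto
    also have "\<dots> = 1" using that by simp
    finally show ?thesis .
  qed
  have col: "(\<Sum>b<n. (m a b)\<^sup>2) \<le> 1" if "a < n" for a
    using row[OF that] sym that by simp
  \<comment> \<open>The first Cauchy-Schwarz factor. AM-GM replaces the product weight by
    \<open>(u a)\<^sup>2\<close> and \<open>(u b)\<^sup>2\<close>, each of which meets a row or
    column of squared entries with sum at most 1.\<close>
  have "(\<Sum>a<n. \<Sum>b<n. (Re (M $$ (a, b)) * sqrt (u a * u b))\<^sup>2)
      \<le> (\<Sum>a<n. \<Sum>b<n. (m a b)\<^sup>2 * (u a)\<^sup>2 / 2 + (m a b)\<^sup>2 * (u b)\<^sup>2 / 2)"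
  proof (intro sum_mono)
    fix a b assume "a \<in> {..<n}" "b \<in> {..<n}"
    then have ua: "0 \<le> u a" and ub: "0 \<le> u b" using u by auto
    have "(Re (M $$ (a, b)) * sqrt (u a * u b))\<^sup>2 = (Re (M $$ (a, b)))\<^sup>2 * (u a * u b)"
      using ua ub by (simp add: power_mult_distrib)
    also have "\<dots> \<le> (m a b)\<^sup>2 * (u a * u b)"
      using ua ub by (intro mult_right_mono) (auto simp: m_def abs_Re_le_cmod abs_le_square_iff[symmetric])
    also have "u a * u b \<le> ((u a)\<^sup>2 + (u b)\<^sup>2) / 2"
      using sum_squares_bound[of "u a" "u b"] by simp
    then have "(m a b)\<^sup>2 * (u a * u b) \<le> (m a b)\<^sup>2 * (((u a)\<^sup>2 + (u b)\<^sup>2) / 2)"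
      by (intro mult_left_mono) auto
    finally show "(Re (M $$ (a, b)) * sqrt (u a * u b))\<^sup>2 \<le> (m a b)\<^sup>2 * (u a)\<^sup>2 / 2 + (m a b)\<^sup>2 * (u b)\<^sup>2 / 2"
      by (simp add: algebra_simps add_divide_distrib)
  qed
  also have "\<dots> = (\<Sum>a<n. (u a)\<^sup>2 * (\<Sum>b<n. (m a b)\<^sup>2)) / 2 + (\<Sum>a<n. \<Sum>b<n. (m a b)\<^sup>2 * (u b)\<^sup>2) / 2"
    by (simp add: sum.distrib sum_distrib_left sum_divide_distrib mult_ac)
  also have "(\<Sum>a<n. \<Sum>b<n. (m a b)\<^sup>2 * (u b)\<^sup>2) = (\<Sum>b<n. (u b)\<^sup>2 * (\<Sum>a<n. (m a b)\<^sup>2))"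
    by (subst sum.swap) (simp add: sum_distrib_left mult_ac)
  also have "(\<Sum>a<n. (u a)\<^sup>2 * (\<Sum>b<n. (m a b)\<^sup>2)) \<le> (\<Sum>a<n. (u a)\<^sup>2 * 1)"
    using col by (intro sum_mono mult_left_mono) auto
  also have "(\<Sum>b<n. (u b)\<^sup>2 * (\<Sum>a<n. (m a b)\<^sup>2)) \<le> (\<Sum>b<n. (u b)\<^sup>2 * 1)"
    using row by (intro sum_mono mult_left_mono) auto
  finally have le1: "(\<Sum>a<n. \<Sum>b<n. (Re (M $$ (a, b)) * sqrt (u a * u b))\<^sup>2) \<le> 1"
    using u(2) by simp
  have eq: "Re (mtrace (M * rmat n X)) = (\<Sum>a<n. \<Sum>b<n. (Re (M $$ (a, b)) * sqrt (u a * u b)) * (X b a / sqrt (u a * u b)))"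
    unfolding Re_mtrace_mult_rmat[OF psd_mat_carrier[OF M]]
    using X by (intro sum.cong refl) auto
  have "(Re (mtrace (M * rmat n X)))\<^sup>2 \<le> (\<Sum>a<n. \<Sum>b<n. (Re (M $$ (a, b)) * sqrt (u a * u b))\<^sup>2)
      * (\<Sum>a<n. \<Sum>b<n. (X b a / sqrt (u a * u b))\<^sup>2)"
    unfolding eq by (rule Cauchy_Schwarz_double_sum)
  also have "\<dots> \<le> 1 * (\<Sum>a<n. \<Sum>b<n. (X b a / sqrt (u a * u b))\<^sup>2)"
    using le1 by (intro mult_right_mono sum_nonneg) auto
  also have "\<dots> = (\<Sum>a<n. \<Sum>b<n. (X b a)\<^sup>2 / (u b * u a))"
    using u by (simp add: power_divide mult.commute)
  also have "\<dots> = (\<Sum>a<n. \<Sum>b<n. (X a b)\<^sup>2 / (u a * u b))" by (rule sum.swap)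
  finally show ?thesis .
qed

text \<open>Polarization writes the difference as the inner product of \<open>R - S\<close> with
  \<open>M\<close> applied to \<open>R + S\<close>. Their squared norms are \<open>2 - 2 * F\<close>
  and \<open>2 + 2 * F\<close>, where \<open>F\<close> is the overlap, and \<open>M\<close>
  contracts; Cauchy-Schwarz then gives \<open>4 * (1 - F\<^sup>2)\<close>. It is a Fuchs-van de
  Graaf bound, up to the factor 4, for a given pair of purifications.\<close>

lemma measurement_fidelity:
  assumes M: "psd_mat n M" and M': "psd_mat n (1\<^sub>m n - M)"
    and R: "(\<Sum>a<n. \<Sum>c<n. (R a c)\<^sup>2) = 1" and S: "(\<Sum>a<n. \<Sum>c<n. (S a c)\<^sup>2) = 1"
  shows "(Re (mtrace (M * rmat n (\<lambda>a b. \<Sum>c<n. R a c * R b c)))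
      - Re (mtrace (M * rmat n (\<lambda>a b. \<Sum>c<n. S a c * S b c))))\<^sup>2
    \<le> 4 * (1 - (\<Sum>a<n. \<Sum>c<n. R a c * S a c)\<^sup>2)"
proof -
  define F where "F = (\<Sum>a<n. \<Sum>c<n. R a c * S a c)"
  define m where "m a b = Re (M $$ (a, b))" for a b
  have sym: "m a b = m b a" if "a < n" "b < n" for a b
    using psd_mat_hermitian[OF M that, THEN arg_cong[where f = Re]] by (simp add: m_def)
  define Q where "Q a c = R a c - S a c" for a c
  define P where "P a c = R a c + S a c" for a c
  define y where "y a c = (\<Sum>b<n. m a b * P b c)" for a c
  define T where "T = (\<Sum>a<n. \<Sum>b<n. m a b * (\<Sum>c<n. P b c * Q a c))"
  \<comment> \<open>The real part of a self-adjoint matrix is symmetric, so the two mixed terms of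
    the polarization agree.\<close>
  have T: "T = (\<Sum>a<n. \<Sum>b<n. m a b * (\<Sum>c<n. Q b c * P a c))"
    unfolding T_def by (subst sum.swap) (intro sum.cong refl, simp add: sym mult.commute)
  have "Re (mtrace (M * rmat n (\<lambda>a b. \<Sum>c<n. R a c * R b c)))
      - Re (mtrace (M * rmat n (\<lambda>a b. \<Sum>c<n. S a c * S b c)))
      = (\<Sum>a<n. \<Sum>b<n. m a b * (\<Sum>c<n. R b c * R a c - S b c * S a c))"
    unfolding Re_mtrace_mult_rmat[OF psd_mat_carrier[OF M]] m_def[symmetric]
    by (simp add: sum_subtractf right_diff_distrib)
  also have "\<dots> = (\<Sum>a<n. \<Sum>b<n. m a b * (\<Sum>c<n. P b c * Q a c / 2 + Q b c * P a c / 2))"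
    unfolding P_def Q_def by (intro sum.cong refl arg_cong2[of _ _ _ _ "(*)"]) (simp add: field_simps)
  also have "\<dots> = T / 2 + (\<Sum>a<n. \<Sum>b<n. m a b * (\<Sum>c<n. Q b c * P a c)) / 2"
    unfolding T_def by (simp add: sum.distrib distrib_left sum_divide_distrib sum_distrib_left)
  also have "\<dots> = T" using T by simp
  also have "T = (\<Sum>a<n. \<Sum>c<n. Q a c * y a c)"
  proof -
    have "(\<Sum>b<n. m a b * (\<Sum>c<n. P b c * Q a c)) = (\<Sum>c<n. Q a c * y a c)" for a
      unfolding y_def sum_distrib_left by (subst sum.swap) (simp add: mult_ac)
    then show ?thesis by (simp add: T_def)
  qed
  finally have diff: "Re (mtrace (M * rmat n (\<lambda>a b. \<Sum>c<n. R a c * R b c)))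
      - Re (mtrace (M * rmat n (\<lambda>a b. \<Sum>c<n. S a c * S b c))) = (\<Sum>a<n. \<Sum>c<n. Q a c * y a c)" .
  have yle: "(\<Sum>a<n. (y a c)\<^sup>2) \<le> (\<Sum>a<n. (P a c)\<^sup>2)" for c
  proof -
    have "(\<Sum>a<n. (y a c)\<^sup>2) \<le> (\<Sum>a<n. (cmod (\<Sum>b<n. M $$ (a, b) * complex_of_real (P b c)))\<^sup>2)"
    proof (rule sum_mono)
      fix a
      have "y a c = Re (\<Sum>b<n. M $$ (a, b) * complex_of_real (P b c))" by (simp add: y_def m_def)
      then show "(y a c)\<^sup>2 \<le> (cmod (\<Sum>b<n. M $$ (a, b) * complex_of_real (P b c)))\<^sup>2"
        using abs_Re_le_cmod by (metis abs_le_square_iff abs_norm_cancel)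
    qed
    also have "\<dots> \<le> (\<Sum>a<n. (cmod (complex_of_real (P a c)))\<^sup>2)"
      by (rule measurement_contraction[OF M M'])
    finally show ?thesis by simp
  qed
  have PP: "(\<Sum>a<n. \<Sum>c<n. (P a c)\<^sup>2) = 2 + 2 * F"
    using R S by (simp add: P_def F_def power2_sum sum.distrib sum_distrib_left mult.assoc)
  have QQ: "(\<Sum>a<n. \<Sum>c<n. (Q a c)\<^sup>2) = 2 - 2 * F"
    using R S by (simp add: Q_def F_def power2_diff sum.distrib sum_subtractf sum_distrib_left mult.assoc)
  have yy: "(\<Sum>a<n. \<Sum>c<n. (y a c)\<^sup>2) \<le> 2 + 2 * F"
  proof -
    have "(\<Sum>a<n. \<Sum>c<n. (y a c)\<^sup>2) = (\<Sum>c<n. \<Sum>a<n. (y a c)\<^sup>2)" by (rule sum.swap)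
    also have "\<dots> \<le> (\<Sum>c<n. \<Sum>a<n. (P a c)\<^sup>2)" by (intro sum_mono yle)
    also have "\<dots> = (\<Sum>a<n. \<Sum>c<n. (P a c)\<^sup>2)" by (rule sum.swap)
    finally show ?thesis using PP by simp
  qed
  have "(\<Sum>a<n. \<Sum>c<n. Q a c * y a c)\<^sup>2 \<le> (\<Sum>a<n. \<Sum>c<n. (Q a c)\<^sup>2) * (\<Sum>a<n. \<Sum>c<n. (y a c)\<^sup>2)"
    by (rule Cauchy_Schwarz_double_sum)
  also have "\<dots> \<le> (\<Sum>a<n. \<Sum>c<n. (Q a c)\<^sup>2) * (2 + 2 * F)"
    using yy by (intro mult_left_mono sum_nonneg) auto
  also have "\<dots> = 4 * (1 - F\<^sup>2)" unfolding QQ by (simp add: power2_eq_square algebra_simps)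
  finally show ?thesis unfolding diff F_def .
qed

section \<open>Reduction to diagonal states\<close>

lemma mtrace_unitary:
  assumes U: "unitary_mat n U" and A: "A \<in> carrier_mat n n"
  shows "mtrace (U * A * mat_adjoint U) = mtrace A"
proof -
  have Uc: "U \<in> carrier_mat n n" "mat_adjoint U \<in> carrier_mat n n" "mat_adjoint U * U = 1\<^sub>m n"
    using U by (auto simp: unitary_mat_def)
  have "mtrace (U * A * mat_adjoint U) = mtrace (mat_adjoint U * (U * A))"
    by (rule mtrace_comm[OF mult_carrier_mat[OF Uc(1) A] Uc(2)])
  also have "mat_adjoint U * (U * A) = A"
    using assoc_mult_mat[OF Uc(2,1) A] left_mult_one_mat[OF A] unfolding Uc(3) by simp
  finally show ?thesis .
qed

lemma density_mat_unitary:
  assumes "unitary_mat n U" "density_mat n \<rho>"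
  shows "density_mat n (U * \<rho> * mat_adjoint U)"
proof -
  have U: "U \<in> carrier_mat n n" and \<rho>: "psd_mat n \<rho>" "\<rho> \<in> carrier_mat n n" "mtrace \<rho> = 1"
    using assms by (auto simp: unitary_mat_def density_mat_def psd_mat_def)
  have "psd_mat n (mat_adjoint (mat_adjoint U) * \<rho> * mat_adjoint U)"
    by (rule psd_mat_congruence[OF \<rho>(1) mat_adjoint_carrier[OF U]])
  then show ?thesis
    using mtrace_unitary[OF assms(1) \<rho>(2)] \<rho>(3) mat_adjoint_adjoint[OF U] by (simp add: density_mat_def)
qed

text \<open>Conjugate the measurement by the tensor power of \<open>U\<close>: acceptance
  probabilities are preserved by cyclicity of the trace, and the set of alternatives is mapped to
  itself because the trace norm is unitarily invariant. From here on \<open>\<sigma>\<close> may be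
  taken diagonal.\<close>

lemma certifies_unitary:
  assumes U: "unitary_mat d U" and L: "\<Lambda> \<in> carrier_mat d d"
    and cert: "certifies d (U * \<Lambda> * mat_adjoint U) \<epsilon> k"
  shows "certifies d \<Lambda> \<epsilon> k"
proof -
  let ?N = "d ^ k"
  let ?W = "tensor_pow d k U"
  have Uc: "U \<in> carrier_mat d d" "mat_adjoint U \<in> carrier_mat d d"
    using U by (auto simp: unitary_mat_def)
  have W: "unitary_mat ?N ?W" by (rule unitary_tensor_pow[OF U])
  then have Wc: "?W \<in> carrier_mat ?N ?N" "mat_adjoint ?W \<in> carrier_mat ?N ?N" "mat_adjoint ?W * ?W = 1\<^sub>m ?N"
    by (auto simp: unitary_mat_def)
  obtain M where M: "psd_mat ?N M" "psd_mat ?N (1\<^sub>m ?N - M)"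
    and acc: "Re (mtrace (M * tensor_pow d k (U * \<Lambda> * mat_adjoint U))) \<ge> 2 / 3"
    and rej: "\<And>\<rho>. density_mat d \<rho> \<Longrightarrow> trace_norm (\<rho> - U * \<Lambda> * mat_adjoint U) \<ge> \<epsilon> \<Longrightarrow>
      Re (mtrace (M * tensor_pow d k \<rho>)) \<le> 1 / 3"
    using cert unfolding certifies_def by blast
  have Mc: "M \<in> carrier_mat ?N ?N" using M by (simp add: psd_mat_def)
  define M' where "M' = mat_adjoint ?W * M * ?W"
  have tr: "mtrace (M * tensor_pow d k (U * A * mat_adjoint U)) = mtrace (M' * tensor_pow d k A)"
    if A: "A \<in> carrier_mat d d" for A
  proof -
    let ?T = "tensor_pow d k A"
    have T: "?T \<in> carrier_mat ?N ?N" by simp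
    have "tensor_pow d k (U * A * mat_adjoint U) = ?W * ?T * mat_adjoint ?W"
      by (simp add: tensor_pow_mult[OF mult_carrier_mat[OF Uc(1) A] Uc(2)] tensor_pow_mult[OF Uc(1) A] tensor_pow_adjoint[OF Uc(1)])
    then have "mtrace (M * tensor_pow d k (U * A * mat_adjoint U)) = mtrace (M * (?W * ?T * mat_adjoint ?W))" by simp
    also have "M * (?W * ?T * mat_adjoint ?W) = M * ?W * ?T * mat_adjoint ?W"
      using assoc_mult_mat[OF Mc mult_carrier_mat[OF Wc(1) T] Wc(2)] assoc_mult_mat[OF Mc Wc(1) T] by simp
    also have "mtrace \<dots> = mtrace (mat_adjoint ?W * (M * ?W * ?T))"
      by (rule mtrace_comm[OF mult_carrier_mat[OF mult_carrier_mat[OF Mc Wc(1)] T] Wc(2)])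
    also have "mat_adjoint ?W * (M * ?W * ?T) = M' * ?T"
      unfolding M'_def
      using assoc_mult_mat[OF Wc(2) mult_carrier_mat[OF Mc Wc(1)] T] assoc_mult_mat[OF Wc(2) Mc Wc(1)] by simp
    finally show ?thesis .
  qed
  have "psd_mat ?N M'" unfolding M'_def by (rule psd_mat_congruence[OF M(1) Wc(1)])
  moreover have "psd_mat ?N (1\<^sub>m ?N - M')"
  proof -
    have WM: "mat_adjoint ?W * M \<in> carrier_mat ?N ?N" using Wc(2) Mc by (rule mult_carrier_mat)
    have "mat_adjoint ?W * (1\<^sub>m ?N - M) = mat_adjoint ?W - mat_adjoint ?W * M"
      using mult_minus_distrib_mat[OF Wc(2) one_carrier_mat Mc] right_mult_one_mat[OF Wc(2)] by simp
    then have "mat_adjoint ?W * (1\<^sub>m ?N - M) * ?W = 1\<^sub>m ?N - M'"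
      unfolding M'_def using minus_mult_distrib_mat[OF Wc(2) WM Wc(1)] Wc(3) by simp
    then show ?thesis using psd_mat_congruence[OF M(2) Wc(1)] by simp
  qed
  moreover have "Re (mtrace (M' * tensor_pow d k \<Lambda>)) \<ge> 2 / 3" using acc tr[OF L] by simp
  moreover have "Re (mtrace (M' * tensor_pow d k \<rho>)) \<le> 1 / 3"
    if "density_mat d \<rho>" "trace_norm (\<rho> - \<Lambda>) \<ge> \<epsilon>" for \<rho>
  proof -
    have \<rho>: "\<rho> \<in> carrier_mat d d" using that by (simp add: density_mat_def psd_mat_def)
    have "U * (\<rho> - \<Lambda>) * mat_adjoint U = U * \<rho> * mat_adjoint U - U * \<Lambda> * mat_adjoint U"
      using mult_minus_distrib_mat[OF Uc(1) \<rho> L]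
        minus_mult_distrib_mat[OF mult_carrier_mat[OF Uc(1) \<rho>] mult_carrier_mat[OF Uc(1) L] Uc(2)] by simp
    moreover have "\<rho> - \<Lambda> \<in> carrier_mat d d" using L by (rule minus_carrier_mat)
    ultimately have "trace_norm (U * \<rho> * mat_adjoint U - U * \<Lambda> * mat_adjoint U) = trace_norm (\<rho> - \<Lambda>)"
      using trace_norm_unitary[OF U] by metis
    then show ?thesis using rej[OF density_mat_unitary[OF U that(1)]] that(2) tr[OF \<rho>] by simp
  qed
  ultimately show ?thesis unfolding certifies_def by blast
qed

lemma density_mat_diagonalization:
  assumes "density_mat d \<sigma>"
  obtains U l where "unitary_mat d U" "\<And>i. i < d \<Longrightarrow> 0 \<le> l i" "(\<Sum>i<d. l i) = 1"
    "\<sigma> = U * dmat d l * mat_adjoint U"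
proof -
  have \<sigma>: "\<sigma> \<in> carrier_mat d d" "mat_adjoint \<sigma> = \<sigma>" "psd_mat d \<sigma>" "mtrace \<sigma> = 1"
    using assms by (auto simp: density_mat_def psd_mat_def)
  obtain U D where U: "unitary_mat d U" and D: "D \<in> carrier_mat d d" "diagonal_mat D"
    and \<sigma>D: "\<sigma> = U * D * mat_adjoint U"
    using hermitian_unitary_diagonalization[OF \<sigma>(1,2)] by blast
  have Uc: "U \<in> carrier_mat d d" "mat_adjoint U \<in> carrier_mat d d" "mat_adjoint U * U = 1\<^sub>m d"
    using U by (auto simp: unitary_mat_def)
  have UD: "U * D \<in> carrier_mat d d" using Uc(1) D(1) by (rule mult_carrier_mat)
  have "mat_adjoint U * \<sigma> * U = D"
  proof -
    have "mat_adjoint U * \<sigma> = mat_adjoint U * (U * D) * mat_adjoint U"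
      unfolding \<sigma>D by (rule assoc_mult_mat[OF Uc(2) UD Uc(2), symmetric])
    also have "mat_adjoint U * (U * D) = D"
      using assoc_mult_mat[OF Uc(2,1) D(1)] left_mult_one_mat[OF D(1)] unfolding Uc(3) by simp
    finally show ?thesis
      using assoc_mult_mat[OF D(1) Uc(2,1)] right_mult_one_mat[OF D(1)] unfolding Uc(3) by simp
  qed
  then have psdD: "psd_mat d D" using psd_mat_congruence[OF \<sigma>(3) Uc(1)] by simp
  have herm: "cnj (D $$ (i, i)) = D $$ (i, i)" if "i < d" for i
    using psdD that unfolding psd_mat_iff[OF D(1)] by blast
  have nn: "0 \<le> Re (D $$ (i, i))" if "i < d" for i
  proof -
    have "0 \<le> Re (\<Sum>a<d. cnj (if a = i then 1 else 0) * (\<Sum>b<d. D $$ (a, b) * (if b = i then 1 else 0)))"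
      using psdD unfolding psd_mat_iff[OF D(1)] by (elim conjE allE[of _ "\<lambda>a. if a = i then 1 else 0"])
    also have "(\<Sum>a<d. cnj (if a = i then 1 else 0) * (\<Sum>b<d. D $$ (a, b) * (if b = i then 1 else 0))) = D $$ (i, i)"
    proof -
      have "(\<Sum>b<d. D $$ (a, b) * (if b = i then 1 else 0)) = (\<Sum>b<d. if b = i then D $$ (a, b) else 0)" for a
        by (intro sum.cong refl) auto
      then have inner: "(\<Sum>b<d. D $$ (a, b) * (if b = i then 1 else 0)) = D $$ (a, i)" for a
        using that by simp
      have "(\<Sum>a<d. cnj (if a = i then 1 else 0) * D $$ (a, i)) = (\<Sum>a<d. if a = i then D $$ (a, i) else 0)"
        by (intro sum.cong refl) auto
      then show ?thesis unfolding inner using that by simp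
    qed
    finally show ?thesis .
  qed
  define l where "l i = Re (D $$ (i, i))" for i
  have "D = dmat d l"
  proof (rule eq_matI)
    fix i j assume "i < dim_row (dmat d l)" "j < dim_col (dmat d l)"
    then show "D $$ (i, j) = dmat d l $$ (i, j)"
      using D herm[of i] by (auto simp: diagonal_mat_def l_def complex_eq_iff)
  qed (use D in auto)
  moreover have "(\<Sum>i<d. l i) = 1"
  proof -
    have "mtrace (dmat d l) = 1" using mtrace_unitary[OF U D(1)] \<sigma>(4) unfolding \<sigma>D \<open>D = dmat d l\<close> by simp
    then have "complex_of_real (\<Sum>i<d. l i) = 1" by (simp add: mtrace_rmat)
    then show ?thesis by (simp only: of_real_eq_1_iff)
  qed
  ultimately show thesis using that[OF U, of l] nn \<sigma>D unfolding l_def by metis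
qed

text \<open>For a real kernel the real part of the quadratic form at a complex vector is the sum of
  the forms at its real and imaginary parts, so real test vectors decide positivity.\<close>

lemma psd_rmatI:
  assumes sym: "\<And>i j. i < n \<Longrightarrow> j < n \<Longrightarrow> f i j = f j i"
    and pos: "\<And>x :: nat \<Rightarrow> real. 0 \<le> (\<Sum>i<n. \<Sum>j<n. x i * f i j * x j)"
  shows "psd_mat n (rmat n f)"
proof -
  have "0 \<le> Re (\<Sum>i<n. cnj (x i) * (\<Sum>j<n. rmat n f $$ (i, j) * x j))" for x :: "nat \<Rightarrow> complex"
  proof -
    have "Re (\<Sum>i<n. cnj (x i) * (\<Sum>j<n. rmat n f $$ (i, j) * x j))
      = (\<Sum>i<n. \<Sum>j<n. Re (x i) * f i j * Re (x j)) + (\<Sum>i<n. \<Sum>j<n. Im (x i) * f i j * Im (x j))"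
      by (simp add: sum.distrib sum_distrib_left mult_ac)
    then show ?thesis using pos[of "\<lambda>i. Re (x i)"] pos[of "\<lambda>i. Im (x i)"] by simp
  qed
  then show ?thesis using sym by (subst psd_mat_iff[OF rmat_carrier]) auto
qed

text \<open>AM-GM charges each off-diagonal product half to the square of \<open>x i\<close> and
  half to that of \<open>x j\<close>; by symmetry the total charge at \<open>i\<close> is its
  absolute row sum.\<close>

lemma psd_rmat_diagonally_dominant:
  assumes sym: "\<And>i j. i < n \<Longrightarrow> j < n \<Longrightarrow> f i j = f j i"
    and dom: "\<And>i. i < n \<Longrightarrow> (\<Sum>j<n. \<bar>f i j\<bar>) \<le> l i"
  shows "psd_mat n (rmat n (\<lambda>i j. (if i = j then l i else 0) + f i j))"
proof (rule psd_rmatI)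
  fix x :: "nat \<Rightarrow> real"
  have off: "- (\<bar>f i j\<bar> * (x i)\<^sup>2 / 2 + \<bar>f i j\<bar> * (x j)\<^sup>2 / 2) \<le> x i * f i j * x j" for i j
  proof -
    have "\<bar>x i * f i j * x j\<bar> = \<bar>f i j\<bar> * (\<bar>x i\<bar> * \<bar>x j\<bar>)" by (simp add: abs_mult)
    also have "\<bar>x i\<bar> * \<bar>x j\<bar> \<le> ((x i)\<^sup>2 + (x j)\<^sup>2) / 2"
      using sum_squares_bound[of "\<bar>x i\<bar>" "\<bar>x j\<bar>"] by simp
    then have "\<bar>f i j\<bar> * (\<bar>x i\<bar> * \<bar>x j\<bar>) \<le> \<bar>f i j\<bar> * (((x i)\<^sup>2 + (x j)\<^sup>2) / 2)"
      by (intro mult_left_mono) auto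
    finally show ?thesis by (simp add: algebra_simps add_divide_distrib)
  qed
  have A: "(\<Sum>i<n. \<Sum>j<n. \<bar>f i j\<bar> * (x i)\<^sup>2) \<le> (\<Sum>i<n. l i * (x i)\<^sup>2)"
    unfolding sum_distrib_right[symmetric] using dom by (intro sum_mono mult_right_mono) auto
  have B: "(\<Sum>i<n. \<Sum>j<n. \<bar>f i j\<bar> * (x j)\<^sup>2) = (\<Sum>i<n. \<Sum>j<n. \<bar>f i j\<bar> * (x i)\<^sup>2)"
    by (subst sum.swap) (simp add: sym)
  have "- ((\<Sum>i<n. \<Sum>j<n. \<bar>f i j\<bar> * (x i)\<^sup>2) / 2 + (\<Sum>i<n. \<Sum>j<n. \<bar>f i j\<bar> * (x j)\<^sup>2) / 2)
      = (\<Sum>i<n. \<Sum>j<n. - (\<bar>f i j\<bar> * (x i)\<^sup>2 / 2 + \<bar>f i j\<bar> * (x j)\<^sup>2 / 2))"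
    by (simp add: sum.distrib sum_negf sum_divide_distrib sum_subtractf)
  also have "\<dots> \<le> (\<Sum>i<n. \<Sum>j<n. x i * f i j * x j)" by (intro sum_mono off)
  finally have "- (\<Sum>i<n. l i * (x i)\<^sup>2) \<le> (\<Sum>i<n. \<Sum>j<n. x i * f i j * x j)" using A B by linarith
  moreover have "(\<Sum>i<n. \<Sum>j<n. x i * ((if i = j then l i else 0) + f i j) * x j)
      = (\<Sum>i<n. l i * (x i)\<^sup>2) + (\<Sum>i<n. \<Sum>j<n. x i * f i j * x j)"
  proof -
    have "(\<Sum>j<n. x i * ((if i = j then l i else 0) + f i j) * x j) = l i * (x i)\<^sup>2 + (\<Sum>j<n. x i * f i j * x j)"
      if "i < n" for i
    proof -
      have "(\<Sum>j<n. x i * ((if i = j then l i else 0) + f i j) * x j)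
        = (\<Sum>j<n. (if i = j then l i * (x i)\<^sup>2 else 0) + x i * f i j * x j)"
        by (intro sum.cong refl) (auto simp: algebra_simps power2_eq_square)
      then show ?thesis using that by (simp add: sum.distrib)
    qed
    then show ?thesis by (simp add: sum.distrib)
  qed
  ultimately show "0 \<le> (\<Sum>i<n. \<Sum>j<n. x i * ((if i = j then l i else 0) + f i j) * x j)" by simp
qed (simp add: sym)

lemma psd_rmat_gram: "psd_mat n (rmat n (\<lambda>i j. \<Sum>c<m. R i c * R j c))"
proof (rule psd_rmatI)
  fix x :: "nat \<Rightarrow> real"
  have "(\<Sum>i<n. \<Sum>j<n. x i * (\<Sum>c<m. R i c * R j c) * x j) = (\<Sum>i<n. \<Sum>j<n. \<Sum>c<m. (x i * R i c) * (x j * R j c))"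
    by (simp add: sum_distrib_left sum_distrib_right mult_ac)
  also have "\<dots> = (\<Sum>i<n. \<Sum>c<m. \<Sum>j<n. (x i * R i c) * (x j * R j c))"
    by (intro sum.cong refl sum.swap)
  also have "\<dots> = (\<Sum>c<m. \<Sum>i<n. \<Sum>j<n. (x i * R i c) * (x j * R j c))" by (rule sum.swap)
  also have "\<dots> = (\<Sum>c<m. (\<Sum>i<n. x i * R i c)\<^sup>2)" by (simp add: power2_eq_square sum_product)
  finally show "0 \<le> (\<Sum>i<n. \<Sum>j<n. x i * (\<Sum>c<m. R i c * R j c) * x j)" by (simp add: sum_nonneg)
qed (simp add: mult.commute)

section \<open>Exponential moments of random signed matchings\<close>

text \<open>The linear terms cancel. This is the gain from random signs: an overlap of size
  \<open>t\<close> enters the exponential moment only as \<open>t\<^sup>2\<close>.\<close>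

lemma exp_plus_exp_uminus_le:
  fixes x :: real
  assumes "\<bar>x\<bar> \<le> 1"
  shows "exp x + exp (- x) \<le> 2 * (1 + x\<^sup>2)"
proof -
  have pos: "exp x + exp (- x) \<le> 2 * (1 + x\<^sup>2)" if "0 \<le> x" "x \<le> 1" for x :: real
  proof -
    have "exp (- x) \<le> 1 / (1 + x)"
      using exp_ge_add_one_self[of x] that by (simp add: exp_minus field_simps)
    also have "\<dots> \<le> 1 - x + x\<^sup>2"
    proof -
      have "1 \<le> (1 - x + x\<^sup>2) * (1 + x)" using that by (simp add: algebra_simps power2_eq_square)
      then show ?thesis using that by (simp add: divide_le_eq)
    qed
    finally show ?thesis using exp_bound[OF that] by simp
  qed
  show ?thesis using pos[of x] pos[of "- x"] assms by (cases "0 \<le> x") auto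
qed

definition sign_vectors :: "'a set \<Rightarrow> ('a \<Rightarrow> real) set" where
  "sign_vectors A = PiE A (\<lambda>_. {- 1, 1})"

lemma finite_sign_vectors [simp]: "finite A \<Longrightarrow> finite (sign_vectors A)"
  unfolding sign_vectors_def by (intro finite_PiE) auto

lemma card_sign_vectors: "finite A \<Longrightarrow> card (sign_vectors A) = 2 ^ card A"
  unfolding sign_vectors_def by (simp add: card_PiE numeral_2_eq_2)

lemma sum_sign_vectors_exp_le:
  assumes "finite A" "\<And>x. x \<in> A \<Longrightarrow> \<bar>c x\<bar> \<le> 1"
  shows "(\<Sum>s\<in>sign_vectors A. exp (\<Sum>x\<in>A. s x * c x)) \<le> 2 ^ card A * (\<Prod>x\<in>A. 1 + (c x)\<^sup>2)"
proof -
  have "(\<Sum>s\<in>sign_vectors A. exp (\<Sum>x\<in>A. s x * c x)) = (\<Sum>s\<in>sign_vectors A. \<Prod>x\<in>A. exp (s x * c x))"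
    using assms by (simp add: exp_sum)
  also have "\<dots> = (\<Prod>x\<in>A. \<Sum>y\<in>{- 1, 1}. exp (y * c x))"
    unfolding sign_vectors_def using assms by (intro prod_sum_PiE[symmetric]) auto
  also have "\<dots> \<le> (\<Prod>x\<in>A. 2 * (1 + (c x)\<^sup>2))"
    using exp_plus_exp_uminus_le[OF assms(2)] by (intro prod_mono) (auto simp: add_nonneg_nonneg add.commute)
  also have "\<dots> = 2 ^ card A * (\<Prod>x\<in>A. 1 + (c x)\<^sup>2)"
    by (simp only: prod.distrib prod_constant)
  finally show ?thesis .
qed

text \<open>Composing with the inverse of \<open>q\<close> turns agreement with \<open>q\<close> on
  \<open>S\<close> into fixing \<open>S\<close> pointwise, which embeds these permutations into
  those of \<open>A - S\<close>.\<close>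

lemma card_permutes_agree_le:
  assumes "finite A" "q permutes A" "S \<subseteq> A"
  shows "card {p. p permutes A \<and> (\<forall>x\<in>S. p x = q x)} \<le> fact (card A - card S)"
proof -
  have "inj_on (\<lambda>p. inv_into UNIV q \<circ> p) {p. p permutes A \<and> (\<forall>x\<in>S. p x = q x)}"
  proof (rule inj_onI)
    fix p p' assume "inv_into UNIV q \<circ> p = inv_into UNIV q \<circ> p'"
    then have "q \<circ> (inv_into UNIV q \<circ> p) = q \<circ> (inv_into UNIV q \<circ> p')" by simp
    then show "p = p'" unfolding comp_assoc[symmetric] permutes_inv_o[OF assms(2)] by simp
  qed
  moreover have "(\<lambda>p. inv_into UNIV q \<circ> p) ` {p. p permutes A \<and> (\<forall>x\<in>S. p x = q x)} \<subseteq> {r. r permutes (A - S)}"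
  proof clarify
    fix p assume p: "p permutes A" "\<forall>x\<in>S. p x = q x"
    have "inv_into UNIV q \<circ> p permutes A" using permutes_compose[OF p(1) permutes_inv[OF assms(2)]] .
    moreover have "(inv_into UNIV q \<circ> p) x = x" if "x \<in> S" for x
      using p(2) that permutes_inverses(2)[OF assms(2)] by simp
    ultimately show "inv_into UNIV q \<circ> p permutes (A - S)"
      by (rule permutes_superset) blast
  qed
  ultimately have "card {p. p permutes A \<and> (\<forall>x\<in>S. p x = q x)} \<le> card {r. r permutes (A - S)}"
    by (rule card_inj_on_le) (simp add: finite_permutations assms(1))
  also have "\<dots> = fact (card A - card S)"
    using assms by (intro card_permutations) (auto simp: card_Diff_subset finite_subset)
  finally show ?thesis .
qed

lemma sum_Pow_card:
  assumes "finite A"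
  shows "(\<Sum>S\<in>Pow A. f (card S)) = (\<Sum>k\<le>card A. of_nat (card A choose k) * (f k :: 'b::comm_semiring_1))"
proof -
  have "(\<Sum>S\<in>Pow A. f (card S)) = (\<Sum>k\<le>card A. \<Sum>S\<in>{S \<in> Pow A. card S = k}. f (card S))"
    using assms by (intro sum.group[symmetric]) (auto intro: card_mono)
  also have "\<dots> = (\<Sum>k\<le>card A. of_nat (card {S \<in> Pow A. card S = k}) * f k)"
    by (intro sum.cong refl) simp
  also have "\<dots> = (\<Sum>k\<le>card A. of_nat (card A choose k) * f k)"
    using n_subsets[OF assms] by simp
  finally show ?thesis .
qed

lemma sum_exp_partial_le:
  fixes x :: real
  assumes "0 \<le> x"
  shows "(\<Sum>k\<le>n. x ^ k / fact k) \<le> exp x"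
proof -
  have "(\<Sum>k\<in>{..n}. x ^ k /\<^sub>R fact k) \<le> (\<Sum>k. x ^ k /\<^sub>R fact k)"
    using assms by (intro sum_le_suminf summable_exp_generic) auto
  then show ?thesis by (simp add: exp_def divide_inverse mult.commute)
qed

text \<open>The number of points where a uniform permutation agrees with a fixed one has the factorial
  moments of a Poisson variable of mean 1.\<close>

lemma sum_permutes_agree_le:
  fixes \<tau> :: real
  assumes A: "finite A" and q: "q permutes A" and \<tau>: "0 \<le> \<tau>"
  shows "(\<Sum>p\<in>{p. p permutes A}. \<Prod>x\<in>A. 1 + (if p x = q x then \<tau> else 0)) \<le> fact (card A) * exp \<tau>"
proof -
  let ?h = "card A"
  have fin: "finite {p. p permutes A}" by (rule finite_permutations[OF A])
  \<comment> \<open>Expands over the sets of agreement points. Summed over permutations, sets of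
    size \<open>k\<close> contribute at most \<open>(h choose k) * (h - k)! = h! / k!\<close> times
    \<open>\<tau> ^ k\<close>, a term of the exponential series.\<close>
  have expand: "(\<Prod>x\<in>A. 1 + (if p x = q x then \<tau> else 0)) = (\<Sum>S\<in>Pow A. if \<forall>x\<in>S. p x = q x then \<tau> ^ card S else 0)" for p
  proof -
    have "(\<Prod>x\<in>A. 1 + (if p x = q x then \<tau> else 0)) = (\<Prod>x\<in>A. (if p x = q x then \<tau> else 0) + 1)"
      by (simp add: add.commute)
    also have "\<dots> = (\<Sum>S\<in>Pow A. (\<Prod>x\<in>S. if p x = q x then \<tau> else 0) * (\<Prod>x\<in>A - S. 1))"
      by (rule prod_add[OF A])
    also have "\<dots> = (\<Sum>S\<in>Pow A. if \<forall>x\<in>S. p x = q x then \<tau> ^ card S else 0)"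
    proof (rule sum.cong[OF refl])
      fix S assume "S \<in> Pow A"
      then have S: "finite S" using A by (auto intro: finite_subset)
      show "(\<Prod>x\<in>S. if p x = q x then \<tau> else 0) * (\<Prod>x\<in>A - S. 1) = (if \<forall>x\<in>S. p x = q x then \<tau> ^ card S else 0)"
      proof (cases "\<forall>x\<in>S. p x = q x")
        case False
        then have "(\<Prod>x\<in>S. if p x = q x then \<tau> else 0) = 0" using S by (auto intro!: prod_zero)
        then show ?thesis unfolding if_not_P[OF False] by simp
      qed simp
    qed
    finally show ?thesis .
  qed
  have "(\<Sum>p\<in>{p. p permutes A}. \<Prod>x\<in>A. 1 + (if p x = q x then \<tau> else 0))
      = (\<Sum>S\<in>Pow A. \<Sum>p\<in>{p. p permutes A}. if \<forall>x\<in>S. p x = q x then \<tau> ^ card S else 0)"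
    unfolding expand by (rule sum.swap)
  also have "\<dots> = (\<Sum>S\<in>Pow A. real (card {p. p permutes A \<and> (\<forall>x\<in>S. p x = q x)}) * \<tau> ^ card S)"
    using fin by (intro sum.cong refl) (simp add: sum.If_cases Int_def)
  also have "\<dots> \<le> (\<Sum>S\<in>Pow A. fact (?h - card S) * \<tau> ^ card S)"
  proof (intro sum_mono mult_right_mono)
    fix S assume "S \<in> Pow A"
    then have "real (card {p. p permutes A \<and> (\<forall>x\<in>S. p x = q x)}) \<le> real (fact (?h - card S))"
      using card_permutes_agree_le[OF A q] by (intro of_nat_mono) auto
    then show "real (card {p. p permutes A \<and> (\<forall>x\<in>S. p x = q x)}) \<le> fact (?h - card S)" by simp
  qed (use \<tau> in auto)
  also have "\<dots> = (\<Sum>k\<le>?h. real (?h choose k) * (fact (?h - k) * \<tau> ^ k))"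
    by (rule sum_Pow_card[OF A, of "\<lambda>k. fact (?h - k) * \<tau> ^ k"])
  also have "\<dots> = (\<Sum>k\<le>?h. fact ?h * (\<tau> ^ k / fact k))"
    by (intro sum.cong refl) (simp add: binomial_fact)
  also have "\<dots> \<le> fact ?h * exp \<tau>"
    unfolding sum_distrib_left[symmetric] using sum_exp_partial_le[OF \<tau>] by (intro mult_left_mono) auto
  finally show ?thesis .
qed

text \<open>Kept as one permutation per class rather than as class-preserving permutations of
  \<open>A\<close>, so that sums factor over the classes by \<open>prod_sum_PiE\<close>;
  \<open>glue\<close> recovers the permutation of \<open>A\<close>.\<close>

definition class_permutations :: "('a \<Rightarrow> 'c) \<Rightarrow> 'a set \<Rightarrow> ('c \<Rightarrow> 'a \<Rightarrow> 'a) set" where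
  "class_permutations cls A = PiE (cls ` A) (\<lambda>m. {p. p permutes {x \<in> A. cls x = m}})"

definition glue :: "('a \<Rightarrow> 'c) \<Rightarrow> 'a set \<Rightarrow> ('c \<Rightarrow> 'a \<Rightarrow> 'a) \<Rightarrow> 'a \<Rightarrow> 'a" where
  "glue cls A \<omega> x = (if x \<in> A then \<omega> (cls x) x else x)"

lemma class_permutationsD:
  assumes "\<omega> \<in> class_permutations cls A" "m \<in> cls ` A"
  shows "\<omega> m permutes {x \<in> A. cls x = m}"
  using PiE_mem[OF assms[unfolded class_permutations_def]] by simp

lemma glue_class:
  assumes "\<omega> \<in> class_permutations cls A" "x \<in> A"
  shows "glue cls A \<omega> x \<in> A" "cls (glue cls A \<omega> x) = cls x"
proof -
  have "\<omega> (cls x) permutes {y \<in> A. cls y = cls x}" using assms by (intro class_permutationsD) auto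
  from permutes_in_image[OF this, of x] assms(2)
  show "glue cls A \<omega> x \<in> A" "cls (glue cls A \<omega> x) = cls x" by (auto simp: glue_def)
qed

lemma glue_permutes:
  assumes "finite A" "\<omega> \<in> class_permutations cls A"
  shows "glue cls A \<omega> permutes A"
proof (rule bij_imp_permutes)
  have "inj_on (glue cls A \<omega>) A"
  proof (rule inj_onI)
    fix x y assume xy: "x \<in> A" "y \<in> A" "glue cls A \<omega> x = glue cls A \<omega> y"
    then have c: "cls x = cls y" using glue_class(2)[OF assms(2)] by metis
    have "inj (\<omega> (cls x))" using class_permutationsD[OF assms(2), of "cls x"] xy(1) by (auto intro: permutes_inj)
    then show "x = y" using xy c by (simp add: glue_def inj_eq)
  qed
  moreover have "glue cls A \<omega> ` A \<subseteq> A" using glue_class(1)[OF assms(2)] by auto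
  ultimately show "bij_betw (glue cls A \<omega>) A A"
    using assms(1) by (simp add: bij_betw_def endo_inj_surj)
qed (simp add: glue_def)

lemma finite_class_permutations [simp]: "finite A \<Longrightarrow> finite (class_permutations cls A)"
  unfolding class_permutations_def by (intro finite_PiE) (auto intro: finite_permutations)

text \<open>The classes are independent and each contributes a factor of at most
  \<open>exp \<tau>\<close>. The exponent therefore counts classes, not points, which makes large
  buckets as cheap as small ones.\<close>

lemma sum_class_permutations_agree_le:
  fixes \<tau> :: real
  assumes A: "finite A" and q: "q \<in> class_permutations cls A" and \<tau>: "0 \<le> \<tau>"
  shows "(\<Sum>\<omega>\<in>class_permutations cls A. \<Prod>x\<in>A. 1 + (if glue cls A \<omega> x = glue cls A q x then \<tau> else 0))
    \<le> real (card (class_permutations cls A)) * exp (real (card (cls ` A)) * \<tau>)"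
proof -
  let ?B = "\<lambda>m. {x \<in> A. cls x = m}"
  have "(\<Prod>x\<in>A. 1 + (if glue cls A \<omega> x = glue cls A q x then \<tau> else 0))
    = (\<Prod>m\<in>cls ` A. \<Prod>x\<in>?B m. 1 + (if \<omega> m x = q m x then \<tau> else 0))" for \<omega>
  proof -
    have "(\<Prod>x\<in>A. 1 + (if glue cls A \<omega> x = glue cls A q x then \<tau> else 0))
      = (\<Prod>m\<in>cls ` A. \<Prod>x\<in>?B m. 1 + (if glue cls A \<omega> x = glue cls A q x then \<tau> else 0))"
      using A by (intro prod.group[symmetric]) auto
    also have "\<dots> = (\<Prod>m\<in>cls ` A. \<Prod>x\<in>?B m. 1 + (if \<omega> m x = q m x then \<tau> else 0))"
      by (intro prod.cong refl) (auto simp: glue_def)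
    finally show ?thesis .
  qed
  then have "(\<Sum>\<omega>\<in>class_permutations cls A. \<Prod>x\<in>A. 1 + (if glue cls A \<omega> x = glue cls A q x then \<tau> else 0))
    = (\<Prod>m\<in>cls ` A. \<Sum>p\<in>{p. p permutes ?B m}. \<Prod>x\<in>?B m. 1 + (if p x = q m x then \<tau> else 0))"
    unfolding class_permutations_def using A
    by (simp add: prod_sum_PiE finite_permutations)
  also have "\<dots> \<le> (\<Prod>m\<in>cls ` A. fact (card (?B m)) * exp \<tau>)"
  proof (rule prod_mono, intro conjI)
    fix m assume m: "m \<in> cls ` A"
    show "(\<Sum>p\<in>{p. p permutes ?B m}. \<Prod>x\<in>?B m. 1 + (if p x = q m x then \<tau> else 0)) \<le> fact (card (?B m)) * exp \<tau>"
      using A class_permutationsD[OF q m] \<tau> by (intro sum_permutes_agree_le) auto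
  qed (use \<tau> in \<open>auto intro!: sum_nonneg prod_nonneg\<close>)
  also have "\<dots> = real (card (class_permutations cls A)) * exp (real (card (cls ` A)) * \<tau>)"
  proof -
    have "real (card (class_permutations cls A)) = (\<Prod>m\<in>cls ` A. fact (card (?B m)))"
      unfolding class_permutations_def using A by (simp add: card_PiE card_permutations)
    then show ?thesis by (simp add: prod.distrib exp_of_nat_mult)
  qed
  finally show ?thesis .
qed

text \<open>Averaging over the signs first, with the permutations held fixed, leaves a factor
  \<open>1 + t\<^sup>2\<close> for each agreement; the average over permutations is then the
  previous bound with \<open>\<tau> = t\<^sup>2\<close>.\<close>

lemma sum_signed_class_permutations_exp_le:
  fixes t :: real
  assumes A: "finite A" and q: "q \<in> class_permutations cls A" and s': "s' \<in> sign_vectors A"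
    and c: "\<And>x. x \<in> A \<Longrightarrow> \<bar>c x\<bar> \<le> t" and t: "0 \<le> t" "t \<le> 1"
  shows "(\<Sum>\<omega>\<in>class_permutations cls A. \<Sum>s\<in>sign_vectors A.
      exp (\<Sum>x\<in>A. if glue cls A \<omega> x = glue cls A q x then s x * s' x * c x else 0))
    \<le> real (card (class_permutations cls A) * card (sign_vectors A)) * exp (real (card (cls ` A)) * t\<^sup>2)"
proof -
  have s'1: "\<bar>s' x\<bar> = 1" if "x \<in> A" for x
    using s' that unfolding sign_vectors_def by (auto dest!: PiE_mem)
  have "(\<Sum>s\<in>sign_vectors A. exp (\<Sum>x\<in>A. if glue cls A \<omega> x = glue cls A q x then s x * s' x * c x else 0))
      \<le> 2 ^ card A * (\<Prod>x\<in>A. 1 + (if glue cls A \<omega> x = glue cls A q x then t\<^sup>2 else 0))" for \<omega>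
  proof -
    define e where "e x = (if glue cls A \<omega> x = glue cls A q x then s' x * c x else 0)" for x
    have e: "\<bar>e x\<bar> \<le> (if glue cls A \<omega> x = glue cls A q x then t else 0)" if "x \<in> A" for x
      using c[OF that] s'1[OF that] by (auto simp: e_def abs_mult)
    have "(\<Sum>s\<in>sign_vectors A. exp (\<Sum>x\<in>A. if glue cls A \<omega> x = glue cls A q x then s x * s' x * c x else 0))
      = (\<Sum>s\<in>sign_vectors A. exp (\<Sum>x\<in>A. s x * e x))"
      by (intro sum.cong refl arg_cong[of _ _ exp]) (auto simp: e_def)
    also have "\<dots> \<le> 2 ^ card A * (\<Prod>x\<in>A. 1 + (e x)\<^sup>2)"
    proof (rule sum_sign_vectors_exp_le[OF A])
      fix x assume "x \<in> A"
      from e[OF this] t show "\<bar>e x\<bar> \<le> 1" by (auto split: if_splits)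
    qed
    also have "\<dots> \<le> 2 ^ card A * (\<Prod>x\<in>A. 1 + (if glue cls A \<omega> x = glue cls A q x then t\<^sup>2 else 0))"
    proof (intro mult_left_mono prod_mono conjI)
      fix x assume "x \<in> A"
      from e[OF this] t show "1 + (e x)\<^sup>2 \<le> 1 + (if glue cls A \<omega> x = glue cls A q x then t\<^sup>2 else 0)"
        by (auto split: if_splits simp: abs_le_square_iff[symmetric])
    qed auto
    finally show ?thesis .
  qed
  then have "(\<Sum>\<omega>\<in>class_permutations cls A. \<Sum>s\<in>sign_vectors A.
      exp (\<Sum>x\<in>A. if glue cls A \<omega> x = glue cls A q x then s x * s' x * c x else 0))
    \<le> (\<Sum>\<omega>\<in>class_permutations cls A. 2 ^ card A * (\<Prod>x\<in>A. 1 + (if glue cls A \<omega> x = glue cls A q x then t\<^sup>2 else 0)))"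
    by (intro sum_mono)
  also have "\<dots> \<le> 2 ^ card A * (real (card (class_permutations cls A)) * exp (real (card (cls ` A)) * t\<^sup>2))"
    unfolding sum_distrib_left[symmetric]
    by (intro mult_left_mono sum_class_permutations_agree_le[OF A q]) auto
  finally show ?thesis using A by (simp add: card_sign_vectors mult_ac)
qed

section \<open>Perturbation by signed matchings\<close>

text \<open>When \<open>b\<close> is injective on \<open>A\<close> and maps it outside
  \<open>A\<close>, at most one of the two summands is nonzero and every row has at most one nonzero
  entry, namely at the partner.\<close>

definition pairing :: "nat set \<Rightarrow> (nat \<Rightarrow> nat) \<Rightarrow> (nat \<Rightarrow> real) \<Rightarrow> nat \<Rightarrow> nat \<Rightarrow> real" where
  "pairing A b a x y = (if x \<in> A \<and> y = b x then a x else 0) + (if y \<in> A \<and> x = b y then a y else 0)"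

lemma pairing_sym: "pairing A b a x y = pairing A b a y x"
  by (simp add: pairing_def)

lemma pairing_left:
  assumes "b ` A \<inter> A = {}" "x \<in> A"
  shows "pairing A b a x y = (if y = b x then a x else 0)"
  using assms by (auto simp: pairing_def)

lemma pairing_right:
  assumes "inj_on b A" "b ` A \<inter> A = {}" "z \<in> A"
  shows "pairing A b a (b z) y = (if y = z then a z else 0)"
  using assms by (auto simp: pairing_def inj_on_eq_iff)

lemma pairing_outside:
  assumes "x \<notin> A" "x \<notin> b ` A"
  shows "pairing A b a x y = 0"
  using assms by (auto simp: pairing_def)

lemma pairing_diag:
  assumes "b ` A \<inter> A = {}"
  shows "pairing A b a x x = 0"
  using assms by (auto simp: pairing_def)

lemma sum_pairing:
  assumes "b ` A \<inter> A = {}" "inj_on b A" "A \<subseteq> {..<d}" "b ` A \<subseteq> {..<d}"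
  shows "(\<Sum>x<d. \<Sum>y<d. pairing A b a x y * F x y) = (\<Sum>x\<in>A. a x * (F x (b x) + F (b x) x))"
proof -
  have fin: "finite A" using assms(3) finite_subset by blast
  have 1: "(\<Sum>x<d. \<Sum>y<d. (if x \<in> A \<and> y = b x then a x else 0) * G x y) = (\<Sum>x\<in>A. a x * G x (b x))" for G
  proof -
    have "(\<Sum>y<d. (if x \<in> A \<and> y = b x then a x else 0) * G x y) = (if x \<in> A then a x * G x (b x) else 0)" for x
    proof (cases "x \<in> A")
      case True
      then have "b x < d" using assms(4) by auto
      moreover have "(\<Sum>y<d. (if x \<in> A \<and> y = b x then a x else 0) * G x y) = (\<Sum>y<d. if y = b x then a x * G x y else 0)"
        using True by (intro sum.cong) auto
      ultimately show ?thesis using True by simp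
    qed simp
    then have "(\<Sum>x<d. \<Sum>y<d. (if x \<in> A \<and> y = b x then a x else 0) * G x y) = (\<Sum>x<d. if x \<in> A then a x * G x (b x) else 0)"
      by simp
    also have "\<dots> = (\<Sum>x\<in>{..<d} \<inter> A. a x * G x (b x))" by (simp add: sum.inter_restrict)
    also have "{..<d} \<inter> A = A" using assms(3) by auto
    finally show ?thesis .
  qed
  have "(\<Sum>x<d. \<Sum>y<d. pairing A b a x y * F x y)
    = (\<Sum>x<d. \<Sum>y<d. (if x \<in> A \<and> y = b x then a x else 0) * F x y)
      + (\<Sum>x<d. \<Sum>y<d. (if y \<in> A \<and> x = b y then a y else 0) * F x y)"
    by (simp add: pairing_def distrib_right sum.distrib)
  also have "(\<Sum>x<d. \<Sum>y<d. (if y \<in> A \<and> x = b y then a y else 0) * F x y)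
    = (\<Sum>y<d. \<Sum>x<d. (if y \<in> A \<and> x = b y then a y else 0) * F x y)" by (rule sum.swap)
  also have "\<dots> = (\<Sum>x\<in>A. a x * F (b x) x)" using 1[of "\<lambda>y x. F x y"] .
  finally show ?thesis unfolding 1 by (simp add: sum.distrib distrib_left)
qed

lemma pairing_row_sum:
  assumes "b ` A \<inter> A = {}" "inj_on b A" "A \<subseteq> {..<d}" "b ` A \<subseteq> {..<d}"
  shows "x \<in> A \<Longrightarrow> (\<Sum>y<d. \<bar>pairing A b a x y\<bar>) = \<bar>a x\<bar>"
    and "x \<in> A \<Longrightarrow> (\<Sum>y<d. \<bar>pairing A b a (b x) y\<bar>) = \<bar>a x\<bar>"
    and "x \<notin> A \<Longrightarrow> x \<notin> b ` A \<Longrightarrow> (\<Sum>y<d. \<bar>pairing A b a x y\<bar>) = 0"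
proof -
  assume x: "x \<in> A"
  then have "b x < d" "x < d" using assms by auto
  then show "(\<Sum>y<d. \<bar>pairing A b a x y\<bar>) = \<bar>a x\<bar>" "(\<Sum>y<d. \<bar>pairing A b a (b x) y\<bar>) = \<bar>a x\<bar>"
    by (simp_all add: pairing_left[OF assms(1) x] pairing_right[OF assms(2,1) x] if_distrib[of abs] cong: if_cong)
qed (simp add: pairing_outside)

text \<open>Going to the partner and back returns to the same index, so the square is diagonal and
  each singular value is the absolute value of the one entry of its row. In particular the norm does
  not depend on signs or on the choice of partners.\<close>

lemma trace_norm_pairing:
  assumes "b ` A \<inter> A = {}" "inj_on b A" "A \<subseteq> {..<d}" "b ` A \<subseteq> {..<d}"
  shows "trace_norm (rmat d (pairing A b a)) = 2 * (\<Sum>x\<in>A. \<bar>a x\<bar>)"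
proof -
  let ?g = "\<lambda>x. \<Sum>y<d. \<bar>pairing A b a x y\<bar>"
  have "trace_norm (rmat d (pairing A b a)) = (\<Sum>x<d. ?g x)"
  proof (rule trace_norm_rmat)
    fix i j assume ij: "i < d" "j < d"
    show "(\<Sum>t<d. pairing A b a i t * pairing A b a t j) = (if i = j then (?g i)\<^sup>2 else 0)"
    proof -
      consider "i \<in> A" | z where "z \<in> A" "i = b z" | "i \<notin> A" "i \<notin> b ` A" by auto
      then show ?thesis
      proof cases
        case 1
        have "(\<Sum>t<d. pairing A b a i t * pairing A b a t j) = (\<Sum>t<d. if t = b i then a i * pairing A b a (b i) j else 0)"
          by (intro sum.cong) (auto simp: pairing_left[OF assms(1) 1])
        also have "\<dots> = a i * pairing A b a (b i) j" using 1 assms(4) by auto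
        finally show ?thesis unfolding pairing_row_sum(1)[OF assms 1]
          by (auto simp: pairing_right[OF assms(2,1) 1] power2_eq_square)
      next
        case 2
        have "(\<Sum>t<d. pairing A b a i t * pairing A b a t j) = (\<Sum>t<d. if t = z then a z * pairing A b a z j else 0)"
          unfolding 2(2) by (intro sum.cong) (auto simp: pairing_right[OF assms(2,1) 2(1)])
        also have "\<dots> = a z * pairing A b a z j" using 2 assms(3) by auto
        finally show ?thesis unfolding 2(2) pairing_row_sum(2)[OF assms 2(1)]
          by (auto simp: pairing_left[OF assms(1) 2(1)] power2_eq_square)
      next
        case 3
        then show ?thesis by (cases "i = j") (auto simp: pairing_outside)
      qed
    qed
  next
    show "pairing A b a i j = pairing A b a j i" for i j by (rule pairing_sym)
    show "0 \<le> ?g i" for i by (simp add: sum_nonneg)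
  qed
  \<comment> \<open>Only one summand of \<open>pairing\<close> can be nonzero, so absolute values
    pass inside; the factor 1 fits the shape of \<open>sum_pairing\<close>.\<close>
  also have "\<dots> = (\<Sum>x<d. \<Sum>y<d. pairing A b (\<lambda>x. \<bar>a x\<bar>) x y * 1)"
  proof (intro sum.cong refl)
    fix x y
    show "\<bar>pairing A b a x y\<bar> = pairing A b (\<lambda>x. \<bar>a x\<bar>) x y * 1"
      using assms(1) by (auto simp: pairing_def)
  qed
  also have "\<dots> = 2 * (\<Sum>x\<in>A. \<bar>a x\<bar>)"
    unfolding sum_pairing[OF assms] by (simp add: sum_distrib_left mult.commute)
  finally show ?thesis .
qed

text \<open>With one off-diagonal entry per row, diagonal dominance means that the entry is at most
  both eigenvalues it connects; the trace is untouched because the pairing has zero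
  diagonal.\<close>

lemma density_mat_pairing:
  assumes b: "b ` A \<inter> A = {}" "inj_on b A" "A \<subseteq> {..<d}" "b ` A \<subseteq> {..<d}"
    and l: "\<And>i. i < d \<Longrightarrow> 0 \<le> l i" "(\<Sum>i<d. l i) = 1"
    and a: "\<And>x. x \<in> A \<Longrightarrow> \<bar>a x\<bar> \<le> l x \<and> \<bar>a x\<bar> \<le> l (b x)"
  shows "density_mat d (rmat d (\<lambda>i j. (if i = j then l i else 0) + pairing A b a i j))"
proof -
  have "(\<Sum>j<d. \<bar>pairing A b a i j\<bar>) \<le> l i" if "i < d" for i
  proof -
    consider "i \<in> A" | z where "z \<in> A" "i = b z" | "i \<notin> A" "i \<notin> b ` A" by auto
    then show ?thesis using a l(1)[OF that] by cases (auto simp: pairing_row_sum[OF b])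
  qed
  then have "psd_mat d (rmat d (\<lambda>i j. (if i = j then l i else 0) + pairing A b a i j))"
    by (intro psd_rmat_diagonally_dominant pairing_sym)
  then show ?thesis using l(2) by (simp add: density_mat_def mtrace_rmat pairing_diag[OF b(1)])
qed

section \<open>Second moment of a mixture of alternatives\<close>

lemma tpow_weighted_sum:
  fixes f g :: "nat \<Rightarrow> nat \<Rightarrow> real"
  shows "(\<Sum>a<d ^ k. \<Sum>b<d ^ k. tpow d k f a b * tpow d k g a b
      / ((\<Prod>l<k. u (a div d ^ l mod d)) * (\<Prod>l<k. u (b div d ^ l mod d))))
    = (\<Sum>x<d. \<Sum>y<d. f x y * g x y / (u x * u y)) ^ k"
proof -
  have "tpow d k f a b * tpow d k g a b / ((\<Prod>l<k. u (a div d ^ l mod d)) * (\<Prod>l<k. u (b div d ^ l mod d)))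
    = tpow d k (\<lambda>x y. f x y * g x y / (u x * u y)) a b" for a b
    by (simp only: tpow_def prod.distrib prod_dividef)
  then show ?thesis by (simp only: tpow_sum2)
qed

text \<open>The Ingster-Suslina second-moment method. The weight \<open>u x * u y\<close>, with \<open>(u x)\<^sup>2\<close> the spectrum of the
  reference state, is the geometric mean of two eigenvalues; unlike the arithmetic mean it tensorizes.\<close>

lemma mixture_second_moment:
  fixes R :: "'w \<Rightarrow> nat \<Rightarrow> nat \<Rightarrow> real" and S :: "nat \<Rightarrow> nat \<Rightarrow> real"
  assumes M: "psd_mat (d ^ k) M" "psd_mat (d ^ k) (1\<^sub>m (d ^ k) - M)"
    and \<Omega>: "finite \<Omega>" "\<Omega> \<noteq> {}"
    and u: "\<And>x. x < d \<Longrightarrow> 0 \<le> u x" "(\<Sum>x<d. (u x)\<^sup>2) = 1"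
    and zero: "\<And>x y. x < d \<Longrightarrow> y < d \<Longrightarrow> u x * u y = 0 \<Longrightarrow> S x y = 0"
      "\<And>\<omega> x y. \<omega> \<in> \<Omega> \<Longrightarrow> x < d \<Longrightarrow> y < d \<Longrightarrow> u x * u y = 0 \<Longrightarrow> R \<omega> x y = 0"
    and SS: "(\<Sum>x<d. \<Sum>y<d. S x y * S x y / (u x * u y)) = 1"
    and RS: "\<And>\<omega>. \<omega> \<in> \<Omega> \<Longrightarrow> (\<Sum>x<d. \<Sum>y<d. R \<omega> x y * S x y / (u x * u y)) = 1"
    and RR: "\<And>\<omega>'. \<omega>' \<in> \<Omega> \<Longrightarrow>
      (\<Sum>\<omega>\<in>\<Omega>. (\<Sum>x<d. \<Sum>y<d. R \<omega> x y * R \<omega>' x y / (u x * u y)) ^ k) \<le> real (card \<Omega>) * (1 + \<delta>)"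
  shows "((\<Sum>\<omega>\<in>\<Omega>. Re (mtrace (M * tensor_pow d k (rmat d (R \<omega>))))) / real (card \<Omega>)
      - Re (mtrace (M * tensor_pow d k (rmat d S))))\<^sup>2 \<le> \<delta>"
proof -
  let ?N = "d ^ k"
  define m where "m = real (card \<Omega>)"
  have m: "m > 0" using \<Omega> by (simp add: m_def card_gt_0_iff)
  define U where "U a = (\<Prod>l<k. u (a div d ^ l mod d))" for a
  define P where "P \<omega> = tpow d k (R \<omega>)" for \<omega>
  define T where "T = tpow d k S"
  define X where "X a b = (\<Sum>\<omega>\<in>\<Omega>. P \<omega> a b) / m - T a b" for a b
  define W where "W a b = 1 / (U a * U b)" for a b
  have G: "(\<Sum>a<?N. \<Sum>b<?N. tpow d k f a b * tpow d k g a b * W a b) = (\<Sum>x<d. \<Sum>y<d. f x y * g x y / (u x * u y)) ^ k"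
    for f g using tpow_weighted_sum[of d k f g u] by (simp add: U_def W_def)
  have z0: "tpow d k f b a = 0"
    if ab: "a < ?N" "b < ?N" "U a * U b = 0" and f: "\<And>x y. x < d \<Longrightarrow> y < d \<Longrightarrow> u x * u y = 0 \<Longrightarrow> f x y = 0" for f :: "nat \<Rightarrow> nat \<Rightarrow> real" and a b
  proof -
    obtain l where "l < k" "u (a div d ^ l mod d) = 0 \<or> u (b div d ^ l mod d) = 0"
      using ab(3) unfolding U_def by (auto simp: prod_zero_iff)
    then have "f (b div d ^ l mod d) (a div d ^ l mod d) = 0"
      using digit_less[OF ab(1) \<open>l < k\<close>] digit_less[OF ab(2) \<open>l < k\<close>] by (intro f) auto
    then show ?thesis unfolding tpow_def using \<open>l < k\<close> by (intro prod_zero) auto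
  qed
  have "(Re (mtrace (M * rmat ?N X)))\<^sup>2 \<le> (\<Sum>a<?N. \<Sum>b<?N. (X a b)\<^sup>2 / (U a * U b))"
  proof (rule measurement_chi_square[OF M])
    fix a assume "a < ?N"
    then show "0 \<le> U a" unfolding U_def by (intro prod_nonneg u(1) ballI digit_less) auto
  next
    have "(\<Sum>a<?N. (U a)\<^sup>2) = (\<Sum>a<?N. \<Prod>l<k. (u (a div d ^ l mod d))\<^sup>2)"
      by (simp add: U_def prod_power_distrib)
    also have "\<dots> = (\<Prod>l<k. \<Sum>x<d. (u x)\<^sup>2)" by (rule digit_sum_prod)
    finally show "(\<Sum>a<?N. (U a)\<^sup>2) \<le> 1" by (simp add: u(2))
  next
    fix a b assume ab: "a < ?N" "b < ?N" "U a * U b = 0"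
    show "X b a = 0" unfolding X_def P_def T_def using z0[OF ab] zero by simp
  qed
  also have "\<dots> = (\<Sum>\<omega>\<in>\<Omega>. \<Sum>\<omega>'\<in>\<Omega>. (\<Sum>a<?N. \<Sum>b<?N. P \<omega> a b * P \<omega>' a b * W a b)) / m\<^sup>2
      - 2 * (\<Sum>\<omega>\<in>\<Omega>. \<Sum>a<?N. \<Sum>b<?N. P \<omega> a b * T a b * W a b) / m
      + (\<Sum>a<?N. \<Sum>b<?N. T a b * T a b * W a b)"
  proof -
    have "(X a b)\<^sup>2 / (U a * U b) = (\<Sum>\<omega>\<in>\<Omega>. \<Sum>\<omega>'\<in>\<Omega>. P \<omega> a b * P \<omega>' a b * W a b) / m\<^sup>2
      - 2 * (\<Sum>\<omega>\<in>\<Omega>. P \<omega> a b * T a b * W a b) / m + T a b * T a b * W a b" for a b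
    proof -
      define p where "p = (\<Sum>\<omega>\<in>\<Omega>. P \<omega> a b)"
      have "p * p = (\<Sum>\<omega>\<in>\<Omega>. \<Sum>\<omega>'\<in>\<Omega>. P \<omega> a b * P \<omega>' a b)"
        unfolding p_def by (rule sum_product)
      then have 1: "(\<Sum>\<omega>\<in>\<Omega>. \<Sum>\<omega>'\<in>\<Omega>. P \<omega> a b * P \<omega>' a b * W a b) = p * p * W a b"
        by (simp only: sum_distrib_right)
      have 2: "(\<Sum>\<omega>\<in>\<Omega>. P \<omega> a b * T a b * W a b) = p * T a b * W a b"
        unfolding p_def by (simp only: sum_distrib_right)
      have 3: "(X a b)\<^sup>2 / (U a * U b) = (p / m - T a b)\<^sup>2 * W a b" by (simp add: X_def p_def W_def)
      have "(p / m - t)\<^sup>2 * w = p * p * w / m\<^sup>2 - 2 * (p * t * w) / m + t * t * w" for t w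
        using m by (simp add: power2_eq_square field_simps)
      then show ?thesis unfolding 1 2 3 .
    qed
    then have "(\<Sum>a<?N. \<Sum>b<?N. (X a b)\<^sup>2 / (U a * U b))
      = (\<Sum>a<?N. \<Sum>b<?N. \<Sum>\<omega>\<in>\<Omega>. \<Sum>\<omega>'\<in>\<Omega>. P \<omega> a b * P \<omega>' a b * W a b) / m\<^sup>2
      - 2 * (\<Sum>a<?N. \<Sum>b<?N. \<Sum>\<omega>\<in>\<Omega>. P \<omega> a b * T a b * W a b) / m
      + (\<Sum>a<?N. \<Sum>b<?N. T a b * T a b * W a b)"
      by (simp add: sum.distrib sum_subtractf sum_divide_distrib sum_distrib_left)
    moreover have "(\<Sum>a<?N. \<Sum>b<?N. \<Sum>\<omega>\<in>\<Omega>. f \<omega> a b) = (\<Sum>\<omega>\<in>\<Omega>. \<Sum>a<?N. \<Sum>b<?N. f \<omega> a b)"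
      for f :: "'w \<Rightarrow> nat \<Rightarrow> nat \<Rightarrow> real"
      by (subst (2) sum.swap) (subst sum.swap, rule refl)
    ultimately show ?thesis by simp
  qed
  \<comment> \<open>By \<open>RS\<close> and \<open>SS\<close> the mixed term equals
    \<open>- 2\<close> and the last one \<open>1\<close>, which leaves \<open>- 1\<close>.\<close>
  also have "\<dots> = (\<Sum>\<omega>'\<in>\<Omega>. \<Sum>\<omega>\<in>\<Omega>. (\<Sum>x<d. \<Sum>y<d. R \<omega> x y * R \<omega>' x y / (u x * u y)) ^ k) / m\<^sup>2 - 1"
    unfolding P_def T_def G SS using RS m
    by (subst sum.swap) (simp add: m_def)
  also have "\<dots> \<le> (\<Sum>\<omega>'\<in>\<Omega>. m * (1 + \<delta>)) / m\<^sup>2 - 1"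
    unfolding m_def by (intro diff_right_mono divide_right_mono sum_mono RR) auto
  also have "\<dots> = \<delta>" using m by (simp add: m_def power2_eq_square)
  finally have le: "(Re (mtrace (M * rmat ?N X)))\<^sup>2 \<le> \<delta>" .
  have "Re (mtrace (M * rmat ?N X)) = (\<Sum>\<omega>\<in>\<Omega>. Re (mtrace (M * rmat ?N (P \<omega>)))) / m - Re (mtrace (M * rmat ?N T))"
  proof -
    have "Re (mtrace (M * rmat ?N X)) = (\<Sum>a<?N. \<Sum>b<?N. (\<Sum>\<omega>\<in>\<Omega>. Re (M $$ (a, b)) * P \<omega> b a) / m - Re (M $$ (a, b)) * T b a)"
      unfolding Re_mtrace_mult_rmat[OF psd_mat_carrier[OF M(1)]] X_def
      by (simp add: right_diff_distrib sum_distrib_left)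
    also have "\<dots> = (\<Sum>a<?N. \<Sum>b<?N. \<Sum>\<omega>\<in>\<Omega>. Re (M $$ (a, b)) * P \<omega> b a) / m - (\<Sum>a<?N. \<Sum>b<?N. Re (M $$ (a, b)) * T b a)"
      by (simp add: sum_subtractf sum_divide_distrib)
    also have "(\<Sum>a<?N. \<Sum>b<?N. \<Sum>\<omega>\<in>\<Omega>. Re (M $$ (a, b)) * P \<omega> b a) = (\<Sum>\<omega>\<in>\<Omega>. \<Sum>a<?N. \<Sum>b<?N. Re (M $$ (a, b)) * P \<omega> b a)"
      by (subst (2) sum.swap) (subst sum.swap, rule refl)
    finally show ?thesis unfolding Re_mtrace_mult_rmat[OF psd_mat_carrier[OF M(1)]] .
  qed
  then show ?thesis using le by (simp add: tensor_pow_rmat P_def T_def m_def)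
qed

lemma square_diff_ge:
  fixes x y :: real
  assumes "x \<le> 1 / 3" "2 / 3 \<le> y"
  shows "1 / 9 \<le> (x - y)\<^sup>2"
proof -
  have "(1 / 3)\<^sup>2 \<le> (y - x)\<^sup>2" using assms by (intro power_mono) auto
  moreover have "(1 / 3 :: real)\<^sup>2 = 1 / 9" by (simp add: power2_eq_square)
  ultimately show ?thesis by (simp only: power2_commute[of x y])
qed

lemma mult_sqrt_self_div:
  fixes x :: real
  assumes "0 \<le> x"
  shows "x * x / (sqrt x * sqrt x) = x"
  using assms by (cases "x = 0") auto

lemma sum_diagonal_entries:
  fixes F :: "nat \<Rightarrow> nat \<Rightarrow> 'a::comm_monoid_add"
  shows "(\<Sum>x<d. \<Sum>y<d. if x = y then F x y else 0) = (\<Sum>x<d. F x x)"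
  by (intro sum.cong refl) (simp add: sum.delta)

text \<open>A fixed matching \<open>\<beta>\<close> is randomized by class-preserving permutations
  of \<open>A\<close>. Since \<open>x\<close> may receive the partner \<open>\<beta> y\<close> of
  any \<open>y\<close> in its class, the conditions on \<open>g\<close> range over all such pairs.
  \<open>t\<close> bounds \<open>k\<close> times the overlap of one shared pair; signs leave
  \<open>t\<^sup>2\<close> of it and each class shares about one pair, hence the condition on the
  number of classes times \<open>t\<^sup>2\<close>.\<close>

theorem not_certifies_signed_pairings:
  fixes l g :: "nat \<Rightarrow> real" and cls :: "nat \<Rightarrow> 'c"
  assumes l: "\<And>i. i < d \<Longrightarrow> 0 \<le> l i" "(\<Sum>i<d. l i) = 1"
    and A: "A \<subseteq> {..<d}" "\<beta> ` A \<subseteq> {..<d}" "inj_on \<beta> A" "\<beta> ` A \<inter> A = {}"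
    and g: "\<And>x y. x \<in> A \<Longrightarrow> y \<in> A \<Longrightarrow> cls x = cls y \<Longrightarrow> 0 \<le> g x \<and> g x \<le> l x \<and> g x \<le> l (\<beta> y)"
    and t: "\<And>x y. x \<in> A \<Longrightarrow> y \<in> A \<Longrightarrow> cls x = cls y \<Longrightarrow> 2 * real k * (g x)\<^sup>2 \<le> t * (sqrt (l x) * sqrt (l (\<beta> y)))"
      "0 \<le> t" "t \<le> 1" "real (card (cls ` A)) * t\<^sup>2 \<le> 1 / 10"
    and eps: "\<epsilon> \<le> 2 * (\<Sum>x\<in>A. g x)"
  shows "\<not> certifies d (dmat d l) \<epsilon> k"
proof
  assume "certifies d (dmat d l) \<epsilon> k"
  then obtain M where M: "psd_mat (d ^ k) M" "psd_mat (d ^ k) (1\<^sub>m (d ^ k) - M)"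
    and acc: "2 / 3 \<le> Re (mtrace (M * tensor_pow d k (dmat d l)))"
    and rej: "\<And>\<rho>. density_mat d \<rho> \<Longrightarrow> \<epsilon> \<le> trace_norm (\<rho> - dmat d l) \<Longrightarrow>
      Re (mtrace (M * tensor_pow d k \<rho>)) \<le> 1 / 3"
    unfolding certifies_def by blast
  have fin: "finite A" using A(1) finite_subset by blast
  define u where "u x = sqrt (l x)" for x
  define \<Omega> where "\<Omega> = class_permutations cls A \<times> sign_vectors A"
  define b where "b \<omega> x = \<beta> (glue cls A (fst \<omega>) x)" for \<omega> :: "('c \<Rightarrow> nat \<Rightarrow> nat) \<times> (nat \<Rightarrow> real)" and x
  define a where "a \<omega> x = snd \<omega> x * g x" for \<omega> :: "('c \<Rightarrow> nat \<Rightarrow> nat) \<times> (nat \<Rightarrow> real)" and x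
  define R where "R \<omega> i j = (if i = j then l i else 0) + pairing A (b \<omega>) (a \<omega>) i j" for \<omega> i j
  have fin\<Omega>: "finite \<Omega>" using fin by (simp add: \<Omega>_def)
  have "(\<lambda>m\<in>cls ` A. id) \<in> class_permutations cls A"
    unfolding class_permutations_def by (auto simp: permutes_id)
  moreover have "(\<lambda>x\<in>A. 1) \<in> sign_vectors A" by (auto simp: sign_vectors_def)
  ultimately have ne: "\<Omega> \<noteq> {}" unfolding \<Omega>_def by blast
  have glue_in: "glue cls A (fst \<omega>) x \<in> A" "cls (glue cls A (fst \<omega>) x) = cls x" if "\<omega> \<in> \<Omega>" "x \<in> A" for \<omega> x
    using that glue_class[of "fst \<omega>" cls A x] by (auto simp: \<Omega>_def)
  have sgn: "\<bar>snd \<omega> x\<bar> = 1" if "\<omega> \<in> \<Omega>" "x \<in> A" for \<omega> x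
    using that by (auto simp: \<Omega>_def sign_vectors_def dest!: PiE_mem)
  have abs_a: "\<bar>a \<omega> x\<bar> = g x" if "\<omega> \<in> \<Omega>" "x \<in> A" for \<omega> x
    using sgn[OF that] g[OF that(2,2)] by (simp add: a_def abs_mult)
  have b: "b \<omega> ` A \<inter> A = {}" "inj_on (b \<omega>) A" "b \<omega> ` A \<subseteq> {..<d}" if "\<omega> \<in> \<Omega>" for \<omega>
  proof -
    have sub: "b \<omega> ` A \<subseteq> \<beta> ` A" using glue_in(1)[OF that] by (auto simp: b_def)
    then show "b \<omega> ` A \<inter> A = {}" "b \<omega> ` A \<subseteq> {..<d}" using A by blast+
    have "inj_on (glue cls A (fst \<omega>)) A"
      using glue_permutes[OF fin, of "fst \<omega>" cls] that by (auto simp: \<Omega>_def intro: permutes_inj_on)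
    moreover have "glue cls A (fst \<omega>) ` A \<subseteq> A" using glue_in(1)[OF that] by auto
    ultimately have "inj_on (\<beta> \<circ> glue cls A (fst \<omega>)) A"
      using A(3) by (intro comp_inj_on) (auto intro: inj_on_subset)
    then show "inj_on (b \<omega>) A" by (simp add: b_def o_def inj_on_def)
  qed
  have b_lt: "b \<omega> x < d" if "\<omega> \<in> \<Omega>" "x \<in> A" for \<omega> x using b(3)[OF that(1)] that(2) by auto
  have ga: "g x \<le> l x" "g x \<le> l (b \<omega> x)" "0 \<le> g x" if "\<omega> \<in> \<Omega>" "x \<in> A" for \<omega> x
    using g[OF that(2) glue_in(1)[OF that]] glue_in(2)[OF that] by (auto simp: b_def)
  have u0: "0 \<le> u x" if "x < d" for x using l(1)[OF that] by (simp add: u_def)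
  have g_le: "g x \<le> u x * u (b \<omega> x)" if "\<omega> \<in> \<Omega>" "x \<in> A" for \<omega> x
  proof -
    have "g x = sqrt (g x) * sqrt (g x)" using ga[OF that] by simp
    also have "\<dots> \<le> u x * u (b \<omega> x)" unfolding u_def using ga[OF that] by (intro mult_mono) auto
    finally show ?thesis .
  qed
  have le1: "2 * (\<Sum>x\<in>A. g x) \<le> 1" if "\<omega> \<in> \<Omega>" for \<omega>
  proof -
    have "2 * (\<Sum>x\<in>A. g x) \<le> (\<Sum>x\<in>A. l x) + (\<Sum>x\<in>A. l (b \<omega> x))"
      unfolding sum_distrib_left sum.distrib[symmetric]
    proof (rule sum_mono)
      fix x assume "x \<in> A"
      from ga[OF that this] show "2 * g x \<le> l x + l (b \<omega> x)" by linarith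
    qed
    also have "(\<Sum>x\<in>A. l (b \<omega> x)) = (\<Sum>y\<in>b \<omega> ` A. l y)" by (simp add: sum.reindex[OF b(2)[OF that]])
    also have "(\<Sum>x\<in>A. l x) + (\<Sum>y\<in>b \<omega> ` A. l y) = (\<Sum>x\<in>A \<union> b \<omega> ` A. l x)"
      using fin b(1)[OF that] by (intro sum.union_disjoint[symmetric]) auto
    also have "\<dots> \<le> (\<Sum>i<d. l i)" using A(1) b(3)[OF that] l(1) by (intro sum_mono2) auto
    finally show ?thesis using l(2) by simp
  qed
  \<comment> \<open>Weighted inner product of two perturbations; the 2 counts both symmetric
    entries. A shared pair has the same partner in both draws, so the weight can be written with
    \<open>\<omega>'\<close> alone and is constant in the later sum over
    \<open>\<omega>\<close>.\<close>
  define z where "z \<omega> \<omega>' = (\<Sum>x\<in>A. if glue cls A (fst \<omega>) x = glue cls A (fst \<omega>') x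
      then snd \<omega> x * snd \<omega>' x * (2 * (g x)\<^sup>2 / (u x * u (b \<omega>' x))) else 0)" for \<omega> \<omega>'
  have pair_zero: "pairing A (b \<omega>) (a \<omega>) x y = 0" if "\<omega> \<in> \<Omega>" "u x * u y = 0" for \<omega> x y
  proof -
    have "g w = 0" if "w \<in> A" "u w * u (b \<omega> w) = 0" for w
      using g_le[OF \<open>\<omega> \<in> \<Omega>\<close> that(1)] ga(3)[OF \<open>\<omega> \<in> \<Omega>\<close> that(1)] that(2) by simp
    then show ?thesis using that(2) by (auto simp: pairing_def a_def mult.commute)
  qed
  have inner: "(\<Sum>x<d. \<Sum>y<d. R \<omega> x y * R \<omega>' x y / (u x * u y)) = 1 + z \<omega> \<omega>'" if \<omega>: "\<omega> \<in> \<Omega>" "\<omega>' \<in> \<Omega>" for \<omega> \<omega>'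
  proof -
    let ?p = "pairing A (b \<omega>) (a \<omega>)" let ?p' = "pairing A (b \<omega>') (a \<omega>')"
    have "R \<omega> x y * R \<omega>' x y / (u x * u y) = (if x = y then l x * l x / (u x * u y) else 0)
        + ?p x y * (?p' x y / (u x * u y))" for x y
      using pairing_diag[OF b(1)[OF \<omega>(1)]] pairing_diag[OF b(1)[OF \<omega>(2)]] by (auto simp: R_def)
    then have "(\<Sum>x<d. \<Sum>y<d. R \<omega> x y * R \<omega>' x y / (u x * u y))
      = (\<Sum>x<d. \<Sum>y<d. if x = y then l x * l x / (u x * u y) else 0) + (\<Sum>x<d. \<Sum>y<d. ?p x y * (?p' x y / (u x * u y)))"
      by (simp add: sum.distrib)
    also have "(\<Sum>x<d. \<Sum>y<d. if x = y then l x * l x / (u x * u y) else 0) = (\<Sum>x<d. l x)"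
      unfolding sum_diagonal_entries u_def using l(1) by (intro sum.cong refl mult_sqrt_self_div) auto
    also have "(\<Sum>x<d. \<Sum>y<d. ?p x y * (?p' x y / (u x * u y)))
      = (\<Sum>x\<in>A. a \<omega> x * (?p' x (b \<omega> x) / (u x * u (b \<omega> x)) + ?p' (b \<omega> x) x / (u (b \<omega> x) * u x)))"
      by (rule sum_pairing[OF b(1,2)[OF \<omega>(1)] A(1) b(3)[OF \<omega>(1)]])
    also have "\<dots> = z \<omega> \<omega>'"
      unfolding z_def
    proof (rule sum.cong[OF refl])
      fix x assume x: "x \<in> A"
      have "b \<omega> x = b \<omega>' x \<longleftrightarrow> glue cls A (fst \<omega>) x = glue cls A (fst \<omega>') x"
        unfolding b_def using A(3) glue_in(1)[OF \<omega>(1) x] glue_in(1)[OF \<omega>(2) x] by (auto dest: inj_onD)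
      moreover have "?p' x (b \<omega> x) = (if b \<omega> x = b \<omega>' x then a \<omega>' x else 0)"
        by (rule pairing_left[OF b(1)[OF \<omega>(2)] x])
      moreover have "?p' (b \<omega> x) x = ?p' x (b \<omega> x)" by (rule pairing_sym)
      ultimately show "a \<omega> x * (?p' x (b \<omega> x) / (u x * u (b \<omega> x)) + ?p' (b \<omega> x) x / (u (b \<omega> x) * u x))
        = (if glue cls A (fst \<omega>) x = glue cls A (fst \<omega>') x
           then snd \<omega> x * snd \<omega>' x * (2 * (g x)\<^sup>2 / (u x * u (b \<omega>' x))) else 0)"
        by (cases "glue cls A (fst \<omega>) x = glue cls A (fst \<omega>') x") (simp_all add: a_def power2_eq_square mult_ac)
    qed
    finally show ?thesis using l(2) by simp
  qed
  \<comment> \<open>\<open>(1 + z) ^ k \<le> exp (k * z)\<close> needs a nonnegative base. Each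
    coefficient is at most \<open>2 * g x\<close>, because \<open>g x\<close> is at most the
    geometric mean of its two eigenvalues, and these add up to at most 1 by
    \<open>le1\<close>.\<close>
  have z_ge: "- 1 \<le> z \<omega> \<omega>'" if \<omega>: "\<omega> \<in> \<Omega>" "\<omega>' \<in> \<Omega>" for \<omega> \<omega>'
  proof -
    have "- (2 * (\<Sum>x\<in>A. g x)) \<le> z \<omega> \<omega>'"
      unfolding z_def sum_distrib_left sum_negf[symmetric]
    proof (rule sum_mono)
      fix x assume x: "x \<in> A"
      let ?c = "2 * (g x)\<^sup>2 / (u x * u (b \<omega>' x))"
      have "?c \<le> 2 * g x"
      proof (cases "u x * u (b \<omega>' x) = 0")
        case False
        then have "0 < u x * u (b \<omega>' x)" using g_le[OF \<omega>(2) x] ga(3)[OF \<omega>(2) x] by linarith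
        moreover have "2 * (g x)\<^sup>2 \<le> 2 * g x * (u x * u (b \<omega>' x))"
          using mult_left_mono[OF g_le[OF \<omega>(2) x] ga(3)[OF \<omega>(2) x]] by (simp add: power2_eq_square)
        ultimately show ?thesis by (simp add: divide_le_eq)
      qed (use ga(3)[OF \<omega>(2) x] in auto)
      moreover have "0 \<le> ?c" using u0 A(1) x b_lt[OF \<omega>(2) x] by auto
      moreover have "\<bar>snd \<omega> x * snd \<omega>' x * ?c\<bar> = \<bar>?c\<bar>"
        using sgn[OF \<omega>(1) x] sgn[OF \<omega>(2) x] by (simp add: abs_mult)
      ultimately show "- (2 * g x) \<le> (if glue cls A (fst \<omega>) x = glue cls A (fst \<omega>') x
          then snd \<omega> x * snd \<omega>' x * ?c else 0)"
        using ga(3)[OF \<omega>(2) x] by (auto simp del: times_divide_eq_right)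
    qed
    then show ?thesis using le1[OF \<omega>(1)] by simp
  qed
  have mgf: "(\<Sum>\<omega>\<in>\<Omega>. (1 + z \<omega> \<omega>') ^ k) \<le> real (card \<Omega>) * exp (1 / 10)" if \<omega>': "\<omega>' \<in> \<Omega>" for \<omega>'
  proof -
    define c where "c x = real k * (2 * (g x)\<^sup>2 / (u x * u (b \<omega>' x)))" for x
    have c: "\<bar>c x\<bar> \<le> t" if x: "x \<in> A" for x
    proof (cases "u x * u (b \<omega>' x) = 0")
      case False
      then have "0 < u x * u (b \<omega>' x)" using g_le[OF \<omega>' x] ga(3)[OF \<omega>' x] by linarith
      moreover have "2 * real k * (g x)\<^sup>2 \<le> t * (u x * u (b \<omega>' x))"
        using t(1)[OF x glue_in(1)[OF \<omega>' x]] glue_in(2)[OF \<omega>' x] by (simp add: u_def b_def)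
      ultimately show ?thesis by (simp add: c_def divide_le_eq mult_ac abs_of_nonneg)
    qed (use t(2) in \<open>auto simp: c_def\<close>)
    have "(\<Sum>\<omega>\<in>\<Omega>. (1 + z \<omega> \<omega>') ^ k) \<le> (\<Sum>\<omega>\<in>\<Omega>. exp (real k * z \<omega> \<omega>'))"
    proof (rule sum_mono)
      fix \<omega> assume "\<omega> \<in> \<Omega>"
      from z_ge[OF this \<omega>'] have "(1 + z \<omega> \<omega>') ^ k \<le> exp (z \<omega> \<omega>') ^ k"
        by (intro power_mono exp_ge_add_one_self) simp
      then show "(1 + z \<omega> \<omega>') ^ k \<le> exp (real k * z \<omega> \<omega>')" by (simp add: exp_of_nat_mult)
    qed
    also have "\<dots> = (\<Sum>\<pi>\<in>class_permutations cls A. \<Sum>s\<in>sign_vectors A. exp (real k * z (\<pi>, s) \<omega>'))"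
      unfolding \<Omega>_def by (simp add: sum.cartesian_product)
    also have "\<dots> = (\<Sum>\<pi>\<in>class_permutations cls A. \<Sum>s\<in>sign_vectors A.
      exp (\<Sum>x\<in>A. if glue cls A \<pi> x = glue cls A (fst \<omega>') x then s x * snd \<omega>' x * c x else 0))"
      unfolding z_def c_def sum_distrib_left by (intro sum.cong refl arg_cong[of _ _ exp]) auto
    also have "\<dots> \<le> real (card (class_permutations cls A) * card (sign_vectors A)) * exp (real (card (cls ` A)) * t\<^sup>2)"
      using \<omega>' by (intro sum_signed_class_permutations_exp_le[OF fin _ _ c t(2,3)]) (auto simp: \<Omega>_def)
    also have "\<dots> \<le> real (card \<Omega>) * exp (1 / 10)"
      unfolding \<Omega>_def card_cartesian_product using t(4) by (intro mult_left_mono) auto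
    finally show ?thesis .
  qed
  have "((\<Sum>\<omega>\<in>\<Omega>. Re (mtrace (M * tensor_pow d k (rmat d (R \<omega>))))) / real (card \<Omega>)
      - Re (mtrace (M * tensor_pow d k (dmat d l))))\<^sup>2 \<le> exp (1 / 10) - 1"
  proof (rule mixture_second_moment[OF M fin\<Omega> ne, where u = u])
    show "(\<Sum>x<d. (u x)\<^sup>2) = 1" using l by (simp add: u_def)
    fix x y assume "x < d" "y < d" and zero: "u x * u y = 0"
    then show "(if x = y then l x else 0) = 0" by (auto simp: u_def)
    fix \<omega> assume "\<omega> \<in> \<Omega>"
    then show "R \<omega> x y = 0" using zero pair_zero by (auto simp: R_def u_def)
  next
    show "(\<Sum>x<d. \<Sum>y<d. (if x = y then l x else 0) * (if x = y then l x else 0) / (u x * u y)) = 1"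
    proof -
      have "(\<Sum>x<d. \<Sum>y<d. (if x = y then l x else 0) * (if x = y then l x else 0) / (u x * u y))
        = (\<Sum>x<d. \<Sum>y<d. if x = y then l x * l x / (u x * u y) else 0)" by (intro sum.cong refl) auto
      also have "\<dots> = (\<Sum>x<d. l x)"
        unfolding sum_diagonal_entries u_def using l(1) by (intro sum.cong refl mult_sqrt_self_div) auto
      finally show ?thesis using l(2) by simp
    qed
  next
    fix \<omega> assume "\<omega> \<in> \<Omega>"
    have "(\<Sum>x<d. \<Sum>y<d. R \<omega> x y * (if x = y then l x else 0) / (u x * u y))
        = (\<Sum>x<d. \<Sum>y<d. if x = y then l x * l x / (u x * u y) else 0)"
      using pairing_diag[OF b(1)[OF \<open>\<omega> \<in> \<Omega>\<close>]] by (intro sum.cong refl) (auto simp: R_def)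
    also have "\<dots> = (\<Sum>x<d. l x)"
      unfolding sum_diagonal_entries u_def using l(1) by (intro sum.cong refl mult_sqrt_self_div) auto
    finally show "(\<Sum>x<d. \<Sum>y<d. R \<omega> x y * (if x = y then l x else 0) / (u x * u y)) = 1" using l(2) by simp
  next
    fix \<omega>' assume \<omega>': "\<omega>' \<in> \<Omega>"
    have "(\<Sum>\<omega>\<in>\<Omega>. (\<Sum>x<d. \<Sum>y<d. R \<omega> x y * R \<omega>' x y / (u x * u y)) ^ k) = (\<Sum>\<omega>\<in>\<Omega>. (1 + z \<omega> \<omega>') ^ k)"
      using inner \<omega>' by (intro sum.cong) auto
    then show "(\<Sum>\<omega>\<in>\<Omega>. (\<Sum>x<d. \<Sum>y<d. R \<omega> x y * R \<omega>' x y / (u x * u y)) ^ k)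
      \<le> real (card \<Omega>) * (1 + (exp (1 / 10) - 1))"
      using mgf[OF \<omega>'] by simp
  qed (rule u0)
  moreover have "(\<Sum>\<omega>\<in>\<Omega>. Re (mtrace (M * tensor_pow d k (rmat d (R \<omega>))))) / real (card \<Omega>) \<le> 1 / 3"
  proof -
    have "Re (mtrace (M * tensor_pow d k (rmat d (R \<omega>)))) \<le> 1 / 3" if \<omega>: "\<omega> \<in> \<Omega>" for \<omega>
    proof (rule rej)
      show "density_mat d (rmat d (R \<omega>))" unfolding R_def
        using abs_a[OF \<omega>] ga[OF \<omega>] by (intro density_mat_pairing b[OF \<omega>] A(1) l) auto
      have "rmat d (R \<omega>) - dmat d l = rmat d (pairing A (b \<omega>) (a \<omega>))"
        unfolding rmat_minus R_def by (intro rmat_cong) simp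
      then have "trace_norm (rmat d (R \<omega>) - dmat d l) = 2 * (\<Sum>x\<in>A. \<bar>a \<omega> x\<bar>)"
        by (simp only: trace_norm_pairing[OF b(1,2)[OF \<omega>] A(1) b(3)[OF \<omega>]])
      then show "\<epsilon> \<le> trace_norm (rmat d (R \<omega>) - dmat d l)" using eps abs_a[OF \<omega>] by simp
    qed
    then have "(\<Sum>\<omega>\<in>\<Omega>. Re (mtrace (M * tensor_pow d k (rmat d (R \<omega>))))) \<le> (\<Sum>\<omega>\<in>\<Omega>. 1 / 3)"
      by (rule sum_mono)
    moreover have "0 < real (card \<Omega>)" using fin\<Omega> ne by (simp add: card_gt_0_iff)
    ultimately show ?thesis by (simp add: divide_le_eq)
  qed
  note square_diff_ge[OF this acc]
  \<comment> \<open>Origin of the threshold \<open>1 / 10\<close>: \<open>exp (1 / 10) - 1\<close>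
    is at most \<open>11 / 100\<close>, just below \<open>1 / 9\<close>, the least squared gap
    between acceptance and rejection.\<close>
  moreover have "exp (1 / 10 :: real) \<le> 1 + 1 / 10 + (1 / 10)\<^sup>2" by (rule exp_bound) auto
  moreover have "(1 / 10 :: real)\<^sup>2 = 1 / 100" by (simp add: power2_eq_square)
  ultimately show False by linarith
qed

section \<open>Rotation in the plane of two eigenvectors\<close>

lemma tpow_inner_product:
  fixes f g :: "nat \<Rightarrow> nat \<Rightarrow> 'a::comm_semiring_1"
  shows "(\<Sum>a<d ^ k. \<Sum>b<d ^ k. tpow d k f a b * tpow d k g a b) = (\<Sum>x<d. \<Sum>y<d. f x y * g x y) ^ k"
proof -
  have "tpow d k f a b * tpow d k g a b = tpow d k (\<lambda>x y. f x y * g x y) a b" for a b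
    by (simp only: tpow_def prod.distrib)
  then show ?thesis by (simp only: tpow_sum2)
qed

lemma tensor_pow_gram:
  "tensor_pow d k (rmat d (\<lambda>x y. \<Sum>c<d. R x c * R y c))
    = rmat (d ^ k) (\<lambda>a b. \<Sum>c<d ^ k. tpow d k R a c * tpow d k R b c)"
proof -
  have "tpow d k R b c = tpow d k (\<lambda>x y. R y x) c b" for b c by (simp add: tpow_def)
  then have "(\<Sum>c<d ^ k. tpow d k R a c * tpow d k R b c) = tpow d k (\<lambda>x y. \<Sum>c<d. R x c * R y c) a b" for a b
    using tpow_sum1[of d k R a "\<lambda>x y. R y x" b] by simp
  then show ?thesis by (simp add: tensor_pow_rmat)
qed

text \<open>Needed when one eigenvalue dominates: a rotation by an angle of order \<open>\<epsilon>\<close> changes the fidelity only by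
  order \<open>\<epsilon>\<^sup>2\<close>, whereas the chi-square weight of an off-diagonal entry next to a tiny eigenvalue is too
  large.\<close>

theorem certifies_copies_ge_rotation:
  fixes l :: "nat \<Rightarrow> real"
  assumes l: "\<And>i. i < d \<Longrightarrow> 0 \<le> l i" "(\<Sum>i<d. l i) = 1"
    and ab: "a < d" "b < d" "a \<noteq> b"
    and gap: "2 * l b \<le> l a" and eps: "0 < \<epsilon>" "2 * \<epsilon> \<le> l a"
    and cert: "certifies d (dmat d l) \<epsilon> k"
  shows "l a \<le> 108 * real k * \<epsilon>\<^sup>2"
proof -
  define p where "p = l a"
  define r where "r = l b"
  have pr: "0 \<le> r" "2 * r \<le> p" "2 * \<epsilon> \<le> p" "0 < p" using l(1) ab gap eps by (auto simp: p_def r_def)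
  \<comment> \<open>Sine of the rotation angle, chosen so that the difference of the states, whose
    two nonzero singular values are \<open>(p - r) * s\<close>, has trace norm exactly
    \<open>\<epsilon>\<close>.\<close>
  define s where "s = \<epsilon> / (2 * (p - r))"
  have s0: "0 < s" using eps pr by (simp add: s_def)
  have s_le: "s \<le> \<epsilon> / p" unfolding s_def using eps pr by (intro divide_left_mono) auto
  also have "\<dots> \<le> 1 / 2" using pr by (simp add: divide_le_eq)
  finally have s_half: "s \<le> 1 / 2" .
  have s2: "s\<^sup>2 \<le> 1" using s0 s_half power_mono[of s 1 2] by simp
  define c where "c = sqrt (1 - s\<^sup>2)"
  have c2: "c\<^sup>2 = 1 - s\<^sup>2" "c * c = 1 - s * s" using s2 by (simp_all add: c_def power2_eq_square[symmetric])
  have cs: "c * (c * w) + s * (s * w) = w" for w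
  proof -
    have "c * (c * w) + s * (s * w) = (c * c + s * s) * w" by (simp add: algebra_simps)
    then show ?thesis using c2 by simp
  qed
  have c_ge: "1 - s\<^sup>2 \<le> c"
    unfolding c_def
  proof (rule real_le_rsqrt)
    have "(1 - s\<^sup>2) * (1 - s\<^sup>2) \<le> 1 * (1 - s\<^sup>2)" using s2 by (intro mult_right_mono) auto
    then show "(1 - s\<^sup>2)\<^sup>2 \<le> 1 - s\<^sup>2" by (simp add: power2_eq_square)
  qed
  have c_le: "c \<le> 1" by (simp add: c_def)
  have split: "(\<Sum>t<d. F t) = F a + F b + (\<Sum>t\<in>{..<d} - {a, b}. F t)" for F :: "nat \<Rightarrow> real"
    using ab by (simp add: sum.remove[of "{..<d}" a] sum.remove[of "{..<d} - {a}" b] Diff_insert2[symmetric] insert_commute)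
  \<comment> \<open>The rotation itself. \<open>R\<close> is \<open>W\<close> times the square root
    of the diagonal state, so its Gram matrix is the rotated state; \<open>\<Delta>\<close> is the
    difference to the unrotated one.\<close>
  define W where "W x y = (if x = y then (if x = a \<or> x = b then c else 1)
      else if x = a \<and> y = b then - s else if x = b \<and> y = a then s else 0)" for x y
  define R where "R x y = W x y * sqrt (l y)" for x y
  define S where "S x y = (if x = y then sqrt (l x) else 0)" for x y
  define \<Delta> where "\<Delta> x y = (p - r) * s * (if x = a \<and> y = a then - s else if x = b \<and> y = b then s
      else if x = a \<and> y = b \<or> x = b \<and> y = a then c else 0)" for x y
  have RR: "(\<Sum>t<d. R x t * R y t) = (if x = y then l x else 0) + \<Delta> x y" if "x < d" "y < d" for x y
  proof -
    have "(\<Sum>t<d. R x t * R y t) = (\<Sum>t<d. W x t * W y t * l t)"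
      using l(1) by (intro sum.cong refl) (simp add: R_def mult_ac)
    also have "\<dots> = W x a * W y a * p + W x b * W y b * r + (\<Sum>t\<in>{..<d} - {a, b}. W x t * W y t * l t)"
      unfolding split p_def r_def ..
    also have "(\<Sum>t\<in>{..<d} - {a, b}. W x t * W y t * l t) = (\<Sum>t\<in>{..<d} - {a, b}. if t = x then (if x = y then l x else 0) else 0)"
      by (intro sum.cong refl) (auto simp: W_def)
    also have "\<dots> = (if x = y \<and> x \<noteq> a \<and> x \<noteq> b then l x else 0)" using that by simp
    also have "W x a * W y a * p + W x b * W y b * r + \<dots> = (if x = y then l x else 0) + \<Delta> x y"
      using ab(3) by (auto simp: cs W_def \<Delta>_def p_def r_def algebra_simps power2_eq_square)
    finally show ?thesis .
  qed
  have SS: "(\<Sum>t<d. S x t * S y t) = (if x = y then l x else 0)" if "x < d" "y < d" for x y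
  proof -
    have "(\<Sum>t<d. S x t * S y t) = (\<Sum>t<d. if t = x then (if x = y then l x else 0) else 0)"
      using l(1) that by (intro sum.cong refl) (auto simp: S_def)
    then show ?thesis using that by simp
  qed
  have dS: "dmat d l = rmat d (\<lambda>x y. \<Sum>t<d. S x t * S y t)"
    by (intro rmat_cong) (simp add: SS)
  define \<rho> where "\<rho> = rmat d (\<lambda>x y. \<Sum>t<d. R x t * R y t)"
  have \<Delta>_tr: "(\<Sum>x<d. \<Delta> x x) = 0" unfolding split using ab(3) by (simp add: \<Delta>_def)
  have tr: "(\<Sum>x<d. \<Sum>t<d. R x t * R x t) = 1" using l(2) \<Delta>_tr by (simp add: RR sum.distrib)
  have "density_mat d \<rho>"
    unfolding density_mat_def \<rho>_def using psd_rmat_gram tr by (simp add: mtrace_rmat)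
  moreover have "trace_norm (\<rho> - dmat d l) = \<epsilon>"
  proof -
    have "\<rho> - dmat d l = rmat d \<Delta>" unfolding \<rho>_def rmat_minus by (intro rmat_cong) (simp add: RR)
    also have "trace_norm (rmat d \<Delta>) = (\<Sum>x<d. if x = a \<or> x = b then (p - r) * s else 0)"
    proof (rule trace_norm_rmat)
      fix i j assume "i < d" "j < d"
      show "\<Delta> i j = \<Delta> j i"
        by (cases "i = a"; cases "i = b"; cases "j = a"; cases "j = b") (simp_all add: \<Delta>_def)
      have "(\<Sum>t<d. \<Delta> i t * \<Delta> t j) = \<Delta> i a * \<Delta> a j + \<Delta> i b * \<Delta> b j"
        unfolding split by (simp add: \<Delta>_def)
      also have "\<dots> = (if i = j then (if i = a \<or> i = b then (p - r) * s else 0)\<^sup>2 else 0)"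
      proof -
        have "(p - r) * s * s * ((p - r) * s * s) + (p - r) * s * c * ((p - r) * s * c) = ((p - r) * s)\<^sup>2 * (s * s + c * c)"
          by (simp add: power2_eq_square algebra_simps)
        also have "\<dots> = ((p - r) * s)\<^sup>2" using c2 by simp
        finally have sq: "(p - r) * s * s * ((p - r) * s * s) + (p - r) * s * c * ((p - r) * s * c) = ((p - r) * s)\<^sup>2" .
        have sq': "(p - r) * s * c * ((p - r) * s * c) + (p - r) * s * s * ((p - r) * s * s) = ((p - r) * s)\<^sup>2"
          using sq by simp
        have "\<Delta> a a = - ((p - r) * s * s)" "\<Delta> b b = (p - r) * s * s" "\<Delta> a b = (p - r) * s * c" "\<Delta> b a = (p - r) * s * c"
          using ab(3) by (simp_all add: \<Delta>_def)
        moreover have "\<Delta> i a = 0" "\<Delta> i b = 0" if "i \<noteq> a" "i \<noteq> b" using that by (simp_all add: \<Delta>_def)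
        moreover have "\<Delta> a j = 0" "\<Delta> b j = 0" if "j \<noteq> a" "j \<noteq> b" using that by (simp_all add: \<Delta>_def)
        ultimately show ?thesis
          using ab(3) sq sq' by (cases "i = a"; cases "i = b"; cases "j = a"; cases "j = b") simp_all
      qed
      finally show "(\<Sum>t<d. \<Delta> i t * \<Delta> t j) = (if i = j then (if i = a \<or> i = b then (p - r) * s else 0)\<^sup>2 else 0)" .
    next
      show "0 \<le> (if i = a \<or> i = b then (p - r) * s else 0)" for i using s0 pr by auto
    qed
    also have "\<dots> = 2 * ((p - r) * s)" unfolding split using ab(3) by simp
    also have "\<dots> = \<epsilon>"
    proof -
      obtain q where "p - r = q" "q \<noteq> 0" using pr by fastforce
      then show ?thesis by (simp add: s_def)
    qed
    finally show ?thesis .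
  qed
  moreover obtain M where M: "psd_mat (d ^ k) M" "psd_mat (d ^ k) (1\<^sub>m (d ^ k) - M)"
    and acc: "2 / 3 \<le> Re (mtrace (M * tensor_pow d k (dmat d l)))"
    and rej: "\<And>\<rho>. density_mat d \<rho> \<Longrightarrow> \<epsilon> \<le> trace_norm (\<rho> - dmat d l) \<Longrightarrow>
      Re (mtrace (M * tensor_pow d k \<rho>)) \<le> 1 / 3"
    using cert unfolding certifies_def by blast
  ultimately have far: "Re (mtrace (M * tensor_pow d k \<rho>)) \<le> 1 / 3" by simp
  define F where "F = (\<Sum>x<d. \<Sum>y<d. R x y * S x y)"
  have F: "F = 1 - (p + r) * (1 - c)"
  proof -
    have "R x y * S x y = (if x = y then W x x * l x else 0)" if "x < d" for x y
      using l(1)[OF that] by (auto simp: R_def S_def)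
    then have "F = (\<Sum>x<d. W x x * l x)" by (simp add: F_def)
    also have "\<dots> = (\<Sum>x<d. l x - (if x = a \<or> x = b then (1 - c) * l x else 0))"
      by (intro sum.cong refl) (auto simp: W_def algebra_simps)
    also have "\<dots> = 1 - (\<Sum>x<d. if x = a \<or> x = b then (1 - c) * l x else 0)"
      by (simp add: sum_subtractf l(2))
    also have "(\<Sum>x<d. if x = a \<or> x = b then (1 - c) * l x else 0) = (p + r) * (1 - c)"
      unfolding split by (simp add: p_def r_def algebra_simps)
    finally show ?thesis .
  qed
  have nR: "(\<Sum>a<d ^ k. \<Sum>c<d ^ k. (tpow d k R a c)\<^sup>2) = 1"
    unfolding power2_eq_square tpow_inner_product using tr by simp
  have nS: "(\<Sum>a<d ^ k. \<Sum>c<d ^ k. (tpow d k S a c)\<^sup>2) = 1"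
    unfolding power2_eq_square tpow_inner_product using l(2) by (simp add: SS)
  have fid: "(Re (mtrace (M * tensor_pow d k \<rho>)) - Re (mtrace (M * tensor_pow d k (dmat d l))))\<^sup>2 \<le> 4 * (1 - (F ^ k)\<^sup>2)"
    using measurement_fidelity[OF M nR nS]
    unfolding tpow_inner_product F_def[symmetric] tensor_pow_gram[symmetric] dS[symmetric] \<rho>_def .
  have "1 / 9 \<le> (Re (mtrace (M * tensor_pow d k \<rho>)) - Re (mtrace (M * tensor_pow d k (dmat d l))))\<^sup>2"
    by (rule square_diff_ge[OF far acc])
  also note fid
  also have "(F ^ k)\<^sup>2 = (1 + (F - 1)) ^ (2 * k)" by (simp add: power_mult[symmetric] mult.commute)
  \<comment> \<open>Bernoulli makes the bound linear in \<open>k\<close>; it applies because the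
    loss of fidelity per copy is at most 1.\<close>
  also have "4 * (1 - (1 + (F - 1)) ^ (2 * k)) \<le> 4 * (1 - (1 + real (2 * k) * (F - 1)))"
  proof -
    have prle: "p + r \<le> 1"
    proof -
      have "0 \<le> (\<Sum>i\<in>{..<d} - {a, b}. l i)" using l(1) by (intro sum_nonneg) auto
      then have "p + r \<le> (\<Sum>i<d. l i)" unfolding split p_def r_def by simp
      then show ?thesis using l(2) by simp
    qed
    have "0 \<le> c" using s2 by (simp add: c_def)
    then have "(p + r) * (1 - c) \<le> 1 * 1" using prle pr c_le by (intro mult_mono) auto
    then have "- 1 \<le> F - 1" unfolding F by simp
    then show ?thesis using Bernoulli_inequality[of "F - 1" "2 * k"] by simp
  qed
  also have "\<dots> = 8 * real k * ((p + r) * (1 - c))" unfolding F by (simp add: algebra_simps)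
  \<comment> \<open>Here \<open>1 - c \<le> s\<^sup>2 \<le> (\<epsilon> / p)\<^sup>2\<close>, the
    last because the gap gives \<open>p - r \<ge> p / 2\<close>, and
    \<open>p + r \<le> 3 / 2 * p\<close>. The resulting 12 times the 9 from the squared success gap
    is 108.\<close>
  also have "\<dots> \<le> 8 * real k * ((3 / 2 * p) * (\<epsilon> / p)\<^sup>2)"
  proof -
    have "s\<^sup>2 \<le> (\<epsilon> / p)\<^sup>2" using s0 s_le by (intro power_mono) auto
    then have "1 - c \<le> (\<epsilon> / p)\<^sup>2" using c_ge by linarith
    then have "(p + r) * (1 - c) \<le> (3 / 2 * p) * (\<epsilon> / p)\<^sup>2" using pr c_le by (intro mult_mono) auto
    then show ?thesis by (intro mult_left_mono) auto
  qed
  also have "\<dots> = 12 * real k * \<epsilon>\<^sup>2 / p" using pr by (simp add: power2_eq_square field_simps)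
  finally have "p \<le> 108 * real k * \<epsilon>\<^sup>2" using pr by (simp add: field_simps)
  then show ?thesis by (simp add: p_def)
qed

section \<open>Dyadic buckets\<close>

lemma bucket_eqI:
  assumes "(1 / 2) ^ Suc m < x" "x \<le> (1 / 2) ^ m"
  shows "bucket x = m"
proof -
  have pw1: "2 powr (- real j) = (1 / 2 :: real) ^ j" for j
    by (simp add: powr_minus powr_realpow power_one_over inverse_eq_divide del: of_nat_Suc)
  have pw2: "2 powr (- real j - 1) = (1 / 2 :: real) ^ Suc j" for j
  proof -
    have "- real j - 1 = - real (Suc j)" by simp
    then show ?thesis by (simp only: pw1)
  qed
  note pw = pw1 pw2
  show ?thesis
    unfolding bucket_def pw
  proof (rule the_equality)
    fix j assume j: "(1 / 2) ^ Suc j < x \<and> x \<le> (1 / 2) ^ j"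
    have "\<not> i < i'" if "(1 / 2) ^ Suc i < x" "x \<le> (1 / 2) ^ i'" for i i'
    proof
      assume "i < i'"
      then have "(1 / 2 :: real) ^ i' \<le> (1 / 2) ^ Suc i" by (intro power_decreasing) auto
      then show False using that by linarith
    qed
    then show "j = m" using j assms by (metis linorder_neqE_nat)
  qed (use assms in simp)
qed

lemma bucket_bounds:
  assumes "0 < x" "x \<le> 1"
  shows "(1 / 2) ^ Suc (bucket x) < x" "x \<le> (1 / 2) ^ bucket x"
proof -
  obtain n where n: "(1 / 2 :: real) ^ n < x" using real_arch_pow_inv[OF assms(1), of "1 / 2"] by auto
  define m where "m = (LEAST m. (1 / 2) ^ Suc m < x)"
  have "(1 / 2) ^ Suc n < x"
  proof -
    have "(1 / 2 :: real) ^ Suc n \<le> (1 / 2) ^ n" by (intro power_decreasing) auto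
    then show ?thesis using n by linarith
  qed
  then have 1: "(1 / 2) ^ Suc m < x" unfolding m_def by (rule LeastI)
  have 2: "x \<le> (1 / 2) ^ m"
  proof (cases m)
    case (Suc m')
    then have "\<not> (1 / 2) ^ Suc m' < x" using not_less_Least[of m' "\<lambda>m. (1 / 2) ^ Suc m < x"] by (simp add: m_def)
    then show ?thesis using Suc by simp
  qed (use assms in simp)
  show "(1 / 2) ^ Suc (bucket x) < x" "x \<le> (1 / 2) ^ bucket x" using 1 2 bucket_eqI[OF 1 2] by auto
qed

lemma sum_half_powers_le:
  assumes "finite B" "\<And>m. m \<in> B \<Longrightarrow> m0 \<le> m"
  shows "(\<Sum>m\<in>B. (1 / 2 :: real) ^ m) \<le> 2 * (1 / 2) ^ m0"
proof -
  obtain n where n: "B \<subseteq> {m0..<m0 + n}"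
  proof -
    have "B \<subseteq> {m0..<m0 + Suc (Max B)}" using assms by (auto simp: le_imp_less_Suc trans_le_add2)
    then show thesis by (rule that)
  qed
  have "(\<Sum>m\<in>B. (1 / 2 :: real) ^ m) \<le> (\<Sum>m\<in>{m0..<m0 + n}. (1 / 2) ^ m)"
    using n by (intro sum_mono2) auto
  also have "\<dots> = 2 * ((1 / 2) ^ m0 - (1 / 2) ^ (m0 + n))"
    by (induction n) auto
  also have "\<dots> \<le> 2 * (1 / 2) ^ m0" by simp
  finally show ?thesis .
qed

lemma exists_half_matching:
  assumes "finite S"
  shows "\<exists>A f. A \<subseteq> S \<and> card A = card S div 2 \<and> inj_on f A \<and> f ` A \<subseteq> S - A"
proof -
  obtain A where A: "A \<subseteq> S" "card A = card S div 2" "finite A"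
    using obtain_subset_with_card_n[of "card S div 2" S] assms by (metis div_le_dividend finite_subset)
  have "card A \<le> card (S - A)" using A assms by (simp add: card_Diff_subset)
  then obtain f where "inj_on f A" "f ` A \<subseteq> S - A"
    using card_le_inj[of A "S - A"] A assms by auto
  then show ?thesis using A by blast
qed

text \<open>The worst case is \<open>n = 3\<close>, where a matching leaves out one third; this is
  the source of the factors \<open>2 / 3\<close> below.\<close>

lemma two_div2_ge:
  assumes "2 \<le> n"
  shows "2 / 3 * real n \<le> 2 * real (n div 2)"
proof -
  have "2 * n \<le> 3 * (2 * (n div 2))" using assms by presburger
  then have "real (2 * n) \<le> real (3 * (2 * (n div 2)))" by (simp only: of_nat_le_iff)
  then show ?thesis by simp
qed

section \<open>Copy bounds from a single surviving eigenvalue\<close>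

locale diagonal_certification =
  fixes d :: nat and l :: "nat \<Rightarrow> real" and \<epsilon> :: real and k :: nat
  assumes l_nonneg: "\<And>i. i < d \<Longrightarrow> 0 \<le> l i" and l_sum: "(\<Sum>i<d. l i) = 1"
    and eps_pos: "0 < \<epsilon>" and cert: "certifies d (dmat d l) \<epsilon> k"
begin

definition support :: "nat set" where "support = {i. i < d \<and> l i \<noteq> 0}"

definition bucket_set :: "nat \<Rightarrow> nat set" where "bucket_set m = {i \<in> support. bucket (l i) = m}"

definition bucket_size :: "nat \<Rightarrow> nat" where "bucket_size m = card (bucket_set m)"

lemma finite_support [simp]: "finite support" by (simp add: support_def)

lemma finite_bucket_set [simp]: "finite (bucket_set m)" by (simp add: bucket_set_def)

lemma support_less: "i \<in> support \<Longrightarrow> i < d" by (simp add: support_def)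

lemma l_le_1: "i < d \<Longrightarrow> l i \<le> 1"
  using member_le_sum[of i "{..<d}" l] l_nonneg l_sum by auto

lemma l_pos: "i \<in> support \<Longrightarrow> 0 < l i" using l_nonneg[of i] by (simp add: support_def)

lemma l_bounds:
  assumes "i \<in> bucket_set m"
  shows "(1 / 2) ^ Suc m < l i" "l i \<le> (1 / 2) ^ m"
  using assms bucket_bounds[of "l i"] l_pos[of i] l_le_1[OF support_less, of i] by (auto simp: bucket_set_def)

lemma bucket_size_pos: "i \<in> bucket_set m \<Longrightarrow> 0 < bucket_size m" by (auto simp: bucket_size_def card_gt_0_iff)

text \<open>Contrapositive of \<open>not_certifies_signed_pairings\<close> with the buckets in
  \<open>Ms\<close> as classes: \<open>\<delta> m\<close> is the entry placed on the pairs of bucket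
  \<open>m\<close>. The condition on \<open>(\<delta> m)\<^sup>2 * T\<close> keeps the overlap of a
  shared pair small as long as \<open>k\<close> violates the claimed bound.\<close>

lemma bucketwise_lower_bound:
  assumes Ms: "finite Ms" "card Ms \<le> N" "0 < N"
    and T: "0 < T"
    and \<delta>: "\<And>m. m \<in> Ms \<Longrightarrow> 0 \<le> \<delta> m \<and> \<delta> m \<le> (1 / 2) ^ Suc m"
      "\<And>m. m \<in> Ms \<Longrightarrow> (\<delta> m)\<^sup>2 * T \<le> 9 * (1 / 2) ^ Suc m * \<epsilon>\<^sup>2"
    and eps: "\<epsilon> \<le> (\<Sum>m\<in>Ms. 2 * real (bucket_size m div 2) * \<delta> m)"
  shows "T \<le> 108 * real N * real k * \<epsilon>\<^sup>2"
proof (rule ccontr)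
  assume "\<not> T \<le> 108 * real N * real k * \<epsilon>\<^sup>2"
  then have big: "108 * real N * real k * \<epsilon>\<^sup>2 < T" by simp
  \<comment> \<open>The condition on \<open>\<delta>\<close> gives
    \<open>2 * k * (\<delta> m)\<^sup>2 \<le> t * (1 / 2) ^ Suc m\<close>, which fixes the 18. Since
    \<open>108 = 6 * 18\<close>, both \<open>N * t\<close> and \<open>t\<close> are at most
    \<open>1 / 6\<close>, so \<open>N * t\<^sup>2 \<le> 1 / 36\<close> is within the permitted
    \<open>1 / 10\<close>.\<close>
  define t where "t = 18 * real k * \<epsilon>\<^sup>2 / T"
  have t0: "0 \<le> t" using T by (simp add: t_def)
  have Nt: "real N * t \<le> 1 / 6" using big T by (simp add: t_def field_simps)
  have "1 * t \<le> real N * t" using Ms(3) t0 by (intro mult_right_mono) auto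
  then have t1: "t \<le> 1 / 6" using Nt by simp
  have "\<forall>m. \<exists>Af. fst Af \<subseteq> bucket_set m \<and> card (fst Af) = bucket_size m div 2 \<and> inj_on (snd Af) (fst Af) \<and> snd Af ` fst Af \<subseteq> bucket_set m - fst Af"
    using exists_half_matching[OF finite_bucket_set] unfolding bucket_size_def by fastforce
  then obtain Af where Af: "\<And>m. fst (Af m) \<subseteq> bucket_set m \<and> card (fst (Af m)) = bucket_size m div 2 \<and>
      inj_on (snd (Af m)) (fst (Af m)) \<and> snd (Af m) ` fst (Af m) \<subseteq> bucket_set m - fst (Af m)"
    by metis
  define B where "B m = fst (Af m)" for m
  define f where "f m = snd (Af m)" for m
  have B: "B m \<subseteq> bucket_set m" "card (B m) = bucket_size m div 2" "inj_on (f m) (B m)" "f m ` B m \<subseteq> bucket_set m - B m" for m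
    using Af[of m] by (auto simp: B_def f_def)
  define A where "A = (\<Union>m\<in>Ms. B m)"
  define cls where "cls x = bucket (l x)" for x
  define \<beta> where "\<beta> x = f (cls x) x" for x
  have S_cls: "cls x = m" if "x \<in> bucket_set m" for x m using that by (simp add: bucket_set_def cls_def)
  have A_B: "x \<in> B (cls x)" "cls x \<in> Ms" if "x \<in> A" for x
  proof -
    obtain m where m: "m \<in> Ms" "x \<in> B m" using \<open>x \<in> A\<close> by (auto simp: A_def)
    then have "cls x = m" using B(1) S_cls by blast
    then show "x \<in> B (cls x)" "cls x \<in> Ms" using m by auto
  qed
  have \<beta>bucket_set: "\<beta> x \<in> bucket_set (cls x)" "\<beta> x \<notin> B (cls x)" if "x \<in> A" for x
    using B(4)[of "cls x"] A_B[OF that] by (auto simp: \<beta>_def)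
  have xS: "x \<in> bucket_set (cls x)" if "x \<in> A" for x using A_B[OF that] B(1) by blast
  have SI: "bucket_set m \<subseteq> {..<d}" for m by (auto simp: bucket_set_def support_def)
  have "\<not> certifies d (dmat d l) \<epsilon> k"
  proof (rule not_certifies_signed_pairings[where A = A and \<beta> = \<beta> and cls = cls and g = "\<lambda>x. \<delta> (cls x)" and t = t])
    show "A \<subseteq> {..<d}" using xS SI by blast
    show "\<beta> ` A \<subseteq> {..<d}" using \<beta>bucket_set SI by blast
    show "inj_on \<beta> A"
    proof (rule inj_onI)
      fix x y assume xy: "x \<in> A" "y \<in> A" "\<beta> x = \<beta> y"
      then have c: "cls x = cls y" using S_cls[OF \<beta>bucket_set(1)] by metis
      then have "f (cls x) x = f (cls x) y" "y \<in> B (cls x)" using xy(3) A_B(1)[OF xy(2)] by (simp_all add: \<beta>_def)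
      then show "x = y" using inj_onD[OF B(3)] A_B(1)[OF xy(1)] by metis
    qed
    show "\<beta> ` A \<inter> A = {}"
    proof (rule ccontr)
      assume "\<beta> ` A \<inter> A \<noteq> {}"
      then obtain x where x: "x \<in> A" "\<beta> x \<in> A" by blast
      then have "\<beta> x \<in> B (cls x)" using A_B(1)[OF x(2)] S_cls[OF \<beta>bucket_set(1)[OF x(1)]] by simp
      then show False using \<beta>bucket_set(2)[OF x(1)] by simp
    qed
    fix x y assume x: "x \<in> A" and y: "y \<in> A" and xy: "cls x = cls y"
    have lx: "(1 / 2) ^ Suc (cls x) < l x" using l_bounds(1)[OF xS[OF x]] .
    have ly: "(1 / 2) ^ Suc (cls x) < l (\<beta> y)" using l_bounds(1)[OF \<beta>bucket_set(1)[OF y]] xy by simp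
    show "0 \<le> \<delta> (cls x) \<and> \<delta> (cls x) \<le> l x \<and> \<delta> (cls x) \<le> l (\<beta> y)"
      using \<delta>(1)[OF A_B(2)[OF x]] lx ly by linarith
    have "2 * real k * (\<delta> (cls x))\<^sup>2 = 2 * real k * ((\<delta> (cls x))\<^sup>2 * T) / T" using T by simp
    also have "\<dots> \<le> 2 * real k * (9 * (1 / 2) ^ Suc (cls x) * \<epsilon>\<^sup>2) / T"
      using \<delta>(2)[OF A_B(2)[OF x]] T by (intro divide_right_mono mult_left_mono) auto
    also have "\<dots> = t * (1 / 2) ^ Suc (cls x)" by (simp add: t_def)
    also have "(1 / 2 :: real) ^ Suc (cls x) = sqrt ((1 / 2) ^ Suc (cls x)) * sqrt ((1 / 2) ^ Suc (cls x))"
      by (simp only: real_sqrt_mult_self) simp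
    also have "t * \<dots> \<le> t * (sqrt (l x) * sqrt (l (\<beta> y)))"
    proof (intro mult_left_mono mult_mono)
      have "x \<in> support" using xS[OF x] by (simp add: bucket_set_def)
      then show "0 \<le> sqrt (l x)" using l_pos by (simp add: less_imp_le)
    qed (use lx ly t0 in \<open>auto simp del: power_Suc\<close>)
    finally show "2 * real k * (\<delta> (cls x))\<^sup>2 \<le> t * (sqrt (l x) * sqrt (l (\<beta> y)))" .
  next
    have "cls ` A \<subseteq> Ms" using A_B by auto
    then have "card (cls ` A) \<le> N" using card_mono[OF Ms(1)] Ms(2) order_trans by blast
    then have "real (card (cls ` A)) * t\<^sup>2 \<le> real N * t\<^sup>2" by (intro mult_right_mono) auto
    also have "\<dots> = (real N * t) * t" by (simp add: power2_eq_square)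
    also have "\<dots> \<le> (1 / 6) * (1 / 6)" using Nt t1 t0 by (intro mult_mono) auto
    finally show "real (card (cls ` A)) * t\<^sup>2 \<le> 1 / 10" by simp
  next
    have disj: "B m \<inter> B m' = {}" if "m \<noteq> m'" for m m'
      using B(1)[of m] B(1)[of m'] S_cls that by blast
    have finB: "finite (B m)" for m using B(1) finite_subset finite_bucket_set by blast
    have "(\<Sum>x\<in>A. \<delta> (cls x)) = (\<Sum>m\<in>Ms. \<Sum>x\<in>B m. \<delta> (cls x))"
      unfolding A_def using Ms(1) finB disj by (intro sum.UNION_disjoint) auto
    also have "\<dots> = (\<Sum>m\<in>Ms. \<Sum>x\<in>B m. \<delta> m)"
      using B(1) S_cls by (intro sum.cong refl arg_cong[of _ _ \<delta>]) blast
    also have "\<dots> = (\<Sum>m\<in>Ms. real (bucket_size m div 2) * \<delta> m)" using B(2) by simp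
    finally show "\<epsilon> \<le> 2 * (\<Sum>x\<in>A. \<delta> (cls x))" using eps by (simp add: sum_distrib_left mult.assoc)
  qed (use l_nonneg l_sum t0 t1 in auto)
  then show False using cert by simp
qed

definition hat :: "nat \<Rightarrow> real" where "hat i = l i / real (bucket_size (bucket (l i)))"

lemma in_own_bucket_set: "i \<in> support \<Longrightarrow> i \<in> bucket_set (bucket (l i))" by (simp add: bucket_set_def)

text \<open>One bucket carries the whole perturbation, with entries \<open>\<epsilon> / h\<close>
  where \<open>h\<close> is the number of matched indices. As \<open>h\<close> is at least two
  thirds of the bucket size, \<open>large\<close> makes the entry at most \<open>l i0 / 2\<close>,
  which is below every eigenvalue of the bucket.\<close>

lemma lower_bound_large_bucket:
  assumes i0: "i0 \<in> bucket_set m" and bucket_size: "2 \<le> bucket_size m" and large: "3 * \<epsilon> \<le> real (bucket_size m) * l i0" and N: "0 < N"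
  shows "(real (bucket_size m))\<^sup>2 * l i0 \<le> 108 * real N * real k * \<epsilon>\<^sup>2"
proof (rule bucketwise_lower_bound[of "{m}" N _ "\<lambda>_. \<epsilon> / (2 * real (bucket_size m div 2))"])
  define h where "h = 2 * real (bucket_size m div 2)"
  have h: "2 / 3 * real (bucket_size m) \<le> h" "0 < h" using two_div2_ge[OF bucket_size] bucket_size by (auto simp: h_def)
  have l0: "(1 / 2) ^ Suc m < l i0" "l i0 / 2 \<le> (1 / 2) ^ Suc m" "0 < l i0"
    using l_bounds[OF i0] i0 l_pos by (auto simp: bucket_set_def)
  show "0 < (real (bucket_size m))\<^sup>2 * l i0" using bucket_size l0 by simp
  fix m' assume "m' \<in> {m}"
  then have m': "m' = m" by simp
  have "\<epsilon> / h \<le> l i0 / 2"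
  proof -
    have "\<epsilon> * 2 \<le> (2 / 3 * real (bucket_size m)) * l i0" using large by (simp add: mult.commute)
    also have "\<dots> \<le> h * l i0" using h l0 by (intro mult_right_mono) auto
    finally show ?thesis using h(2) by (simp add: field_simps)
  qed
  then show "0 \<le> \<epsilon> / (2 * real (bucket_size m div 2)) \<and> \<epsilon> / (2 * real (bucket_size m div 2)) \<le> (1 / 2) ^ Suc m'"
    using h eps_pos l0 m' unfolding h_def[symmetric] by simp
  have "(2 / 3 * real (bucket_size m))\<^sup>2 \<le> h\<^sup>2" using h by (intro power_mono) auto
  then have "(real (bucket_size m))\<^sup>2 \<le> 9 / 4 * h\<^sup>2" by (simp add: power_mult_distrib power2_eq_square)
  then have "(real (bucket_size m))\<^sup>2 * l i0 \<le> 9 / 4 * h\<^sup>2 * (2 * (1 / 2) ^ Suc m)"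
    using l0 by (intro mult_mono) auto
  also have "\<dots> \<le> 9 * (1 / 2) ^ Suc m * h\<^sup>2" by simp
  finally have "\<epsilon>\<^sup>2 * ((real (bucket_size m))\<^sup>2 * l i0) \<le> \<epsilon>\<^sup>2 * (9 * (1 / 2) ^ Suc m * h\<^sup>2)"
    by (intro mult_left_mono) auto
  then have "(\<epsilon> / h)\<^sup>2 * ((real (bucket_size m))\<^sup>2 * l i0) \<le> 9 * (1 / 2) ^ Suc m * \<epsilon>\<^sup>2"
    using h(2) by (simp add: power_divide divide_le_eq mult_ac)
  then show "(\<epsilon> / (2 * real (bucket_size m div 2)))\<^sup>2 * ((real (bucket_size m))\<^sup>2 * l i0) \<le> 9 * (1 / 2) ^ Suc m' * \<epsilon>\<^sup>2"
    unfolding h_def m' .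
next
  show "\<epsilon> \<le> (\<Sum>m'\<in>{m}. 2 * real (bucket_size m' div 2) * (\<epsilon> / (2 * real (bucket_size m div 2))))" using bucket_size by simp
qed (use N in auto)

text \<open>Any second index \<open>b\<close> will do, including one with eigenvalue 0. If one of
  the two eigenvalues is at least twice the other, the rotation bound applies to the larger, which
  is all the better if that is \<open>l b\<close>; if they are comparable, one signed pair in a
  class of its own suffices.\<close>

lemma lower_bound_singleton:
  assumes i0: "i0 < d" and d: "2 \<le> d" and large: "2 * \<epsilon> \<le> l i0" and N: "0 < N"
  shows "l i0 \<le> 108 * real N * real k * \<epsilon>\<^sup>2"
proof -
  have v: "0 < l i0" using large eps_pos by simp
  define b where "b = (if i0 = 0 then 1 else (0::nat))"
  have b: "b < d" "i0 \<noteq> b" using i0 d by (auto simp: b_def)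
  have N1: "108 * real k * \<epsilon>\<^sup>2 \<le> 108 * real N * real k * \<epsilon>\<^sup>2"
    using N mult_right_mono[of 1 "real N" "108 * real k * \<epsilon>\<^sup>2"] by (simp add: mult_ac)
  consider "2 * l b \<le> l i0" | "2 * l i0 \<le> l b" | "l b < 2 * l i0" "l i0 < 2 * l b" by linarith
  then have "l i0 \<le> 108 * real k * \<epsilon>\<^sup>2"
  proof cases
    case 1
    then show ?thesis
      using certifies_copies_ge_rotation[OF l_nonneg l_sum i0 b 1 eps_pos large cert] by simp
  next
    case 2
    then have "l b \<le> 108 * real k * \<epsilon>\<^sup>2"
      using certifies_copies_ge_rotation[OF l_nonneg l_sum b(1) i0 _ 2 eps_pos _ cert] b(2) large v by simp
    then show ?thesis using 2 v by linarith
  next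
    case 3
    show ?thesis
    proof (rule ccontr)
      assume "\<not> ?thesis"
      then have big: "108 * real k * \<epsilon>\<^sup>2 < l i0" by simp
      define t where "t = real k * \<epsilon>\<^sup>2 / l i0"
      have t: "0 \<le> t" "t \<le> 1 / 108" using v big by (auto simp: t_def divide_le_eq)
      have "\<not> certifies d (dmat d l) \<epsilon> k"
      proof (rule not_certifies_signed_pairings[where A = "{i0}" and \<beta> = "\<lambda>_. b" and cls = id and g = "\<lambda>_. \<epsilon> / 2" and t = t])
        fix x y assume xy: "x \<in> {i0}" "y \<in> {i0}"
        show "0 \<le> \<epsilon> / 2 \<and> \<epsilon> / 2 \<le> l x \<and> \<epsilon> / 2 \<le> l b" using eps_pos large 3 xy by auto
        have "l i0 / 2 = sqrt (l i0 / 2) * sqrt (l i0 / 2)" using v by simp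
        also have "\<dots> \<le> sqrt (l i0) * sqrt (l b)" using v 3 by (intro mult_mono) auto
        finally have "t * (l i0 / 2) \<le> t * (sqrt (l i0) * sqrt (l b))" using t by (intro mult_left_mono) auto
        moreover have "2 * real k * (\<epsilon> / 2)\<^sup>2 = t * (l i0 / 2)" using v by (simp add: t_def power2_eq_square)
        ultimately show "2 * real k * (\<epsilon> / 2)\<^sup>2 \<le> t * (sqrt (l x) * sqrt (l b))" using xy by simp
      next
        have "t\<^sup>2 \<le> (1 / 108)\<^sup>2" using t by (intro power_mono) auto
        then show "real (card (id ` {i0})) * t\<^sup>2 \<le> 1 / 10" by (simp add: power2_eq_square)
      qed (use l_nonneg l_sum b i0 t in auto)
      then show False using cert by simp
    qed
  qed
  then show ?thesis using N1 by linarith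
qed

text \<open>Singleton buckets cannot be paired internally, but their eigenvalues decay geometrically, so
  their total mass is of the order of the largest one.\<close>

lemma mass_decomposition:
  assumes cut: "real d * (1 / 2) ^ N \<le> \<epsilon>" and i0: "i0 \<in> support"
  defines "Ms \<equiv> {m. m < N \<and> 2 \<le> bucket_size m \<and> (\<exists>i\<in>bucket_set m. hat i \<le> hat i0)}"
  shows "(\<Sum>i\<in>{i\<in>support. hat i \<le> hat i0}. l i) \<le> \<epsilon> + 4 * hat i0 + (\<Sum>m\<in>Ms. real (bucket_size m) * (1 / 2) ^ m)"
proof -
  let ?G = "{i\<in>support. hat i \<le> hat i0}"
  let ?b = "\<lambda>i. bucket (l i)"
  define G1 where "G1 = {i\<in>?G. N \<le> ?b i}"
  define G2 where "G2 = {i\<in>?G. ?b i < N \<and> bucket_size (?b i) = 1}"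
  define G3 where "G3 = {i\<in>?G. ?b i < N \<and> 2 \<le> bucket_size (?b i)}"
  have fin: "finite G1" "finite G2" "finite G3" by (auto simp: G1_def G2_def G3_def)
  have "?G = G1 \<union> (G2 \<union> G3)"
  proof -
    have "0 < bucket_size (?b i)" if "i \<in> support" for i using bucket_size_pos[OF in_own_bucket_set[OF that]] .
    then show ?thesis by (fastforce simp: G1_def G2_def G3_def)
  qed
  then have "(\<Sum>i\<in>?G. l i) = (\<Sum>i\<in>G1 \<union> (G2 \<union> G3). l i)" by (rule arg_cong)
  also have "\<dots> = (\<Sum>i\<in>G1. l i) + (\<Sum>i\<in>G2 \<union> G3. l i)"
    using fin by (intro sum.union_disjoint finite_UnI) (auto simp: G1_def G2_def G3_def)
  also have "(\<Sum>i\<in>G2 \<union> G3. l i) = (\<Sum>i\<in>G2. l i) + (\<Sum>i\<in>G3. l i)"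
    using fin by (intro sum.union_disjoint) (auto simp: G2_def G3_def)
  finally have "(\<Sum>i\<in>?G. l i) = (\<Sum>i\<in>G1. l i) + ((\<Sum>i\<in>G2. l i) + (\<Sum>i\<in>G3. l i))" .
  moreover have "(\<Sum>i\<in>G1. l i) \<le> \<epsilon>"
  proof -
    have "(\<Sum>i\<in>G1. l i) \<le> (\<Sum>i\<in>G1. (1 / 2) ^ N)"
    proof (rule sum_mono)
      fix i assume i: "i \<in> G1"
      then have "l i \<le> (1 / 2) ^ ?b i" using l_bounds(2)[OF in_own_bucket_set] by (simp add: G1_def)
      also have "\<dots> \<le> (1 / 2) ^ N" using i by (intro power_decreasing) (auto simp: G1_def)
      finally show "l i \<le> (1 / 2) ^ N" .
    qed
    also have "\<dots> = real (card G1) * (1 / 2) ^ N" by simp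
    also have "\<dots> \<le> real d * (1 / 2) ^ N"
    proof (intro mult_right_mono)
      have "card G1 \<le> card {..<d}" by (intro card_mono) (auto simp: G1_def support_def)
      then show "real (card G1) \<le> real d" by simp
    qed simp
    finally show ?thesis using cut by simp
  qed
  moreover have "(\<Sum>i\<in>G2. l i) \<le> 4 * hat i0"
  proof (cases "G2 = {}")
    case True
    have "0 \<le> hat i0" using l_pos[OF i0] by (simp add: hat_def)
    then show ?thesis using True by simp
  next
    case False
    have inj: "inj_on ?b G2"
    proof (rule inj_onI)
      fix i j assume ij: "i \<in> G2" "j \<in> G2" "?b i = ?b j"
      then have "card (bucket_set (?b i)) = 1" "i \<in> bucket_set (?b i)" "j \<in> bucket_set (?b i)" by (auto simp: G2_def bucket_set_def bucket_size_def)
      then show "i = j" by (auto simp: card_1_singleton_iff)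
    qed
    define m0 where "m0 = Min (?b ` G2)"
    have m0: "m0 \<in> ?b ` G2" "\<And>m. m \<in> ?b ` G2 \<Longrightarrow> m0 \<le> m"
      using False fin(2) by (auto simp: m0_def)
    obtain i where i: "i \<in> G2" "m0 = ?b i" using m0(1) by auto
    have "(\<Sum>i\<in>G2. l i) \<le> (\<Sum>i\<in>G2. (1 / 2) ^ ?b i)"
      using l_bounds(2)[OF in_own_bucket_set] by (intro sum_mono) (auto simp: G2_def)
    also have "\<dots> = (\<Sum>m\<in>?b ` G2. (1 / 2) ^ m)" by (simp add: sum.reindex[OF inj])
    also have "\<dots> \<le> 2 * (1 / 2) ^ m0" using fin(2) m0(2) by (intro sum_half_powers_le) auto
    \<comment> \<open>Brings in the lower end of the bucket of \<open>i\<close>, the top singleton;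
      there \<open>hat i = l i\<close>, so the order by \<open>hat\<close> bounds it by
      \<open>hat i0\<close>.\<close>
    also have "\<dots> = 4 * (1 / 2) ^ Suc m0" by simp
    also have "(1 / 2) ^ Suc m0 \<le> l i" using l_bounds(1)[OF in_own_bucket_set, of i] i by (simp add: G2_def)
    also have "l i = hat i" using i(1) by (simp add: hat_def G2_def)
    also have "\<dots> \<le> hat i0" using i(1) by (simp add: G2_def)
    finally show ?thesis by simp
  qed
  moreover have "(\<Sum>i\<in>G3. l i) \<le> (\<Sum>m\<in>Ms. real (bucket_size m) * (1 / 2) ^ m)"
  proof -
    have finM: "finite Ms" by (simp add: Ms_def)
    \<comment> \<open>A bucket is taken whole as soon as one member has small \<open>hat\<close>: an
      upper bound suffices, and the perturbation will use whole buckets too.\<close>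
    have "(\<Sum>i\<in>G3. l i) \<le> (\<Sum>i\<in>(\<Union>m\<in>Ms. bucket_set m). l i)"
    proof (rule sum_mono2)
      show "G3 \<subseteq> (\<Union>m\<in>Ms. bucket_set m)" using in_own_bucket_set by (fastforce simp: G3_def Ms_def)
      fix i assume "i \<in> (\<Union>m\<in>Ms. bucket_set m) - G3"
      then show "0 \<le> l i" using l_pos by (auto simp: bucket_set_def less_imp_le)
    qed (use finM in auto)
    also have "\<dots> = (\<Sum>m\<in>Ms. \<Sum>i\<in>bucket_set m. l i)"
      using finM by (intro sum.UNION_disjoint) (auto simp: bucket_set_def)
    also have "\<dots> \<le> (\<Sum>m\<in>Ms. \<Sum>i\<in>bucket_set m. (1 / 2) ^ m)" by (intro sum_mono l_bounds(2))
    also have "\<dots> = (\<Sum>m\<in>Ms. real (bucket_size m) * (1 / 2) ^ m)" by (simp add: bucket_size_def)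
    finally show ?thesis .
  qed
  ultimately show ?thesis by linarith
qed

text \<open>The entry mass \<open>\<epsilon>\<close> is spread over all pairable buckets reached by
  the order up to \<open>i0\<close>. Sorting by \<open>hat\<close> makes this affordable: an
  eigenvalue scale \<open>\<mu>\<close> in such a bucket of size \<open>D\<close> satisfies
  \<open>\<mu> < D * hat i0\<close>, so large eigenvalues occur only in large buckets, where small
  entries are enough.\<close>

lemma lower_bound_small_buckets:
  assumes cut: "real d * (1 / 2) ^ N \<le> \<epsilon>" and N: "0 < N" and i0: "i0 \<in> support"
    and mass: "12 * \<epsilon> < (\<Sum>i\<in>{i\<in>support. hat i \<le> hat i0}. l i)"
    and small: "real (bucket_size (bucket (l i0))) * l i0 < 3 * \<epsilon>" "hat i0 < 2 * \<epsilon>"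
  shows "(real (bucket_size (bucket (l i0))))\<^sup>2 * l i0 \<le> 108 * real N * real k * \<epsilon>\<^sup>2"
proof -
  define Ms where "Ms = {m. m < N \<and> 2 \<le> bucket_size m \<and> (\<exists>i\<in>bucket_set m. hat i \<le> hat i0)}"
  define v where "v = hat i0"
  define D0 where "D0 = real (bucket_size (bucket (l i0)))"
  define T where "T = D0\<^sup>2 * l i0"
  have D0: "1 \<le> D0" using bucket_size_pos[OF in_own_bucket_set[OF i0]] by (simp add: D0_def)
  have l0: "0 < l i0" using l_pos[OF i0] .
  have lv: "l i0 = D0 * v" using D0 by (simp add: v_def hat_def D0_def)
  have v0: "0 < v" using l0 lv D0 by (simp add: zero_less_mult_iff)
  \<comment> \<open>The first bound keeps the perturbed state positive. At the second the bucket
    alone has trace mass at least \<open>\<epsilon>\<close>, since two thirds of it are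
    matched.\<close>
  define \<delta> where "\<delta> m = min ((1 / 2) ^ Suc m) (3 * \<epsilon> / (2 * real (bucket_size m)))" for m
  have finM: "finite Ms" by (simp add: Ms_def)
  \<comment> \<open>\<open>12 - 1 - 4 * 2 = 3\<close>: the tail costs \<open>\<epsilon>\<close>, the
    singletons \<open>4 * hat i0 < 8 * \<epsilon>\<close>.\<close>
  have mass': "3 * \<epsilon> \<le> (\<Sum>m\<in>Ms. real (bucket_size m) * (1 / 2) ^ m)"
    using mass mass_decomposition[OF cut i0] small(2) unfolding Ms_def by linarith
  have "T \<le> 108 * real N * real k * \<epsilon>\<^sup>2"
  proof (rule bucketwise_lower_bound[OF finM _ N, of T \<delta>])
    have "card Ms \<le> card {..<N}" by (intro card_mono) (auto simp: Ms_def)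
    then show "card Ms \<le> N" by simp
    show "0 < T" using D0 l0 by (simp add: T_def)
  next
    fix m assume m: "m \<in> Ms"
    then have Dm: "2 \<le> bucket_size m" by (simp add: Ms_def)
    define \<mu> where "\<mu> = (1 / 2 :: real) ^ Suc m"
    have \<mu>0: "0 < \<mu>" by (simp add: \<mu>_def)
    show "0 \<le> \<delta> m \<and> \<delta> m \<le> (1 / 2) ^ Suc m" using eps_pos by (simp add: \<delta>_def)
    obtain i where i: "i \<in> bucket_set m" "hat i \<le> hat i0" using m by (auto simp: Ms_def)
    have bi: "bucket (l i) = m" using i(1) by (simp add: bucket_set_def)
    have "\<mu> < l i" using l_bounds(1)[OF i(1)] by (simp add: \<mu>_def)
    also have "l i = real (bucket_size m) * hat i" using Dm by (simp add: hat_def bi)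
    also have "\<dots> \<le> real (bucket_size m) * v" using i(2) by (intro mult_left_mono) (auto simp: v_def)
    finally have \<mu>_lt: "\<mu> < real (bucket_size m) * v" .
    have \<delta>0: "0 \<le> \<delta> m" using eps_pos by (simp add: \<delta>_def)
    have "(\<delta> m)\<^sup>2 * T \<le> 9 * \<mu> * \<epsilon>\<^sup>2"
    \<comment> \<open>Either \<open>\<delta> m \<le> 3 \<epsilon> / (2 bucket_size m)\<close> suffices, or \<open>\<mu> < D0 v\<close> and \<open>\<delta> m \<le> \<mu>\<close> does.\<close>
    proof (cases "T \<le> (real (bucket_size m))\<^sup>2 * \<mu>")
      case True
      have "(\<delta> m)\<^sup>2 \<le> (3 * \<epsilon> / (2 * real (bucket_size m)))\<^sup>2" using \<delta>0 by (intro power_mono) (auto simp: \<delta>_def)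
      then have "(\<delta> m)\<^sup>2 * T \<le> (3 * \<epsilon> / (2 * real (bucket_size m)))\<^sup>2 * ((real (bucket_size m))\<^sup>2 * \<mu>)"
        using True D0 l0 by (intro mult_mono) (auto simp: T_def)
      also have "\<dots> = 9 / 4 * \<mu> * \<epsilon>\<^sup>2" using Dm by (simp add: power2_eq_square)
      also have "\<dots> \<le> 9 * \<mu> * \<epsilon>\<^sup>2" using \<mu>0 by simp
      finally show ?thesis .
    next
      case False
      \<comment> \<open>Cubes eliminate the size \<open>D\<close> of bucket \<open>m\<close>:
        \<open>\<mu> < D * v\<close> and the failed case \<open>D\<^sup>2 * \<mu> < T\<close>
        combine to \<open>\<mu> ^ 3 \<le> T * v\<^sup>2 = (D0 * v) ^ 3\<close>.\<close>
      have T3: "T = D0 ^ 3 * v" by (simp add: T_def lv power2_eq_square power3_eq_cube)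
      have "\<mu>\<^sup>2 \<le> (real (bucket_size m) * v)\<^sup>2" using \<mu>_lt \<mu>0 by (intro power_mono) auto
      then have "\<mu> * \<mu>\<^sup>2 \<le> \<mu> * (real (bucket_size m) * v)\<^sup>2" using \<mu>0 by (intro mult_left_mono) auto
      then have "\<mu> ^ 3 \<le> (real (bucket_size m))\<^sup>2 * \<mu> * v\<^sup>2"
        by (simp add: power2_eq_square power3_eq_cube mult_ac)
      also have "\<dots> \<le> T * v\<^sup>2" using False by (intro mult_right_mono) auto
      also have "\<dots> = (D0 * v) ^ 3" unfolding T3 by (simp add: power2_eq_square power3_eq_cube mult_ac)
      finally have "\<mu> \<le> D0 * v" using D0 v0 by (auto intro: power_le_imp_le_base[of _ 2] simp: numeral_3_eq_3 numeral_2_eq_2)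
      then have "\<mu> * T \<le> (D0 * v) * T" using D0 l0 by (intro mult_right_mono) (auto simp: T_def)
      also have "\<dots> = (D0 * l i0)\<^sup>2" by (simp add: T_def lv power2_eq_square)
      also have "\<dots> \<le> (3 * \<epsilon>)\<^sup>2" using small(1) D0 l0 by (intro power_mono) (auto simp: D0_def)
      finally have \<mu>T: "\<mu> * T \<le> 9 * \<epsilon>\<^sup>2" by (simp add: power2_eq_square)
      have "(\<delta> m)\<^sup>2 \<le> \<mu>\<^sup>2" using \<delta>0 by (intro power_mono) (auto simp: \<delta>_def \<mu>_def)
      then have "(\<delta> m)\<^sup>2 * T \<le> \<mu>\<^sup>2 * T" using D0 l0 by (intro mult_right_mono) (auto simp: T_def)
      also have "\<dots> = \<mu> * (\<mu> * T)" by (simp add: power2_eq_square)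
      also have "\<dots> \<le> \<mu> * (9 * \<epsilon>\<^sup>2)" using \<mu>T \<mu>0 by (intro mult_left_mono) auto
      finally show ?thesis by (simp add: mult_ac)
    qed
    then show "(\<delta> m)\<^sup>2 * T \<le> 9 * (1 / 2) ^ Suc m * \<epsilon>\<^sup>2" by (simp add: \<mu>_def)
  next
    have term_ge: "min (real (bucket_size m) * (1 / 2) ^ m / 3) \<epsilon> \<le> 2 * real (bucket_size m div 2) * \<delta> m" if "m \<in> Ms" for m
    proof -
      have Dm: "2 \<le> bucket_size m" using that by (simp add: Ms_def)
      have "min (real (bucket_size m) * (1 / 2) ^ m / 3) \<epsilon> = 2 / 3 * real (bucket_size m) * \<delta> m"
      proof -
        have "2 / 3 * real (bucket_size m) * \<delta> m
          = min (2 / 3 * real (bucket_size m) * (1 / 2) ^ Suc m) (2 / 3 * real (bucket_size m) * (3 * \<epsilon> / (2 * real (bucket_size m))))"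
          unfolding \<delta>_def by (rule min_mult_distrib_left[THEN trans]) simp
        also have "\<dots> = min (real (bucket_size m) * (1 / 2) ^ m / 3) \<epsilon>" using Dm by simp
        finally show ?thesis by simp
      qed
      also have "\<dots> \<le> 2 * real (bucket_size m div 2) * \<delta> m"
        using two_div2_ge[OF Dm] eps_pos by (intro mult_right_mono) (auto simp: \<delta>_def)
      finally show ?thesis .
    qed
    have nn: "0 \<le> 2 * real (bucket_size m div 2) * \<delta> m" for m using eps_pos by (simp add: \<delta>_def)
    show "\<epsilon> \<le> (\<Sum>m\<in>Ms. 2 * real (bucket_size m div 2) * \<delta> m)"
    \<comment> \<open>Either one bucket is massive enough to supply \<open>\<epsilon>\<close> by
      itself, or every bucket supplies at least a third of its dyadic mass and these add up by
      \<open>mass'\<close>.\<close>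
    proof (cases "\<exists>m\<in>Ms. \<epsilon> \<le> real (bucket_size m) * (1 / 2) ^ m / 3")
      case True
      then obtain m where m: "m \<in> Ms" "\<epsilon> \<le> real (bucket_size m) * (1 / 2) ^ m / 3" by blast
      then have "\<epsilon> \<le> 2 * real (bucket_size m div 2) * \<delta> m" using term_ge[OF m(1)] by simp
      also have "\<dots> \<le> (\<Sum>m\<in>Ms. 2 * real (bucket_size m div 2) * \<delta> m)"
        using nn finM m(1) by (intro member_le_sum) auto
      finally show ?thesis .
    next
      case False
      have "\<epsilon> \<le> (\<Sum>m\<in>Ms. real (bucket_size m) * (1 / 2) ^ m / 3)"
        using mass' by (simp add: sum_divide_distrib[symmetric])
      also have "\<dots> \<le> (\<Sum>m\<in>Ms. 2 * real (bucket_size m div 2) * \<delta> m)"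
        using term_ge False by (intro sum_mono) fastforce
      finally show ?thesis .
    qed
  qed
  then show ?thesis by (simp add: T_def D0_def)
qed

text \<open>The cases exhaust everything: outside the first two, a singleton has
  \<open>hat i0 = l i0 < 2 * \<epsilon>\<close>, and a bucket of size at least 2 has
  \<open>2 * l i0 < 3 * \<epsilon>\<close>, so in both situations \<open>hat i0\<close> is small
  enough for the spreading argument.\<close>

theorem copies_lower_bound:
  assumes cut: "real d * (1 / 2) ^ N \<le> \<epsilon>" and N: "0 < N" and d: "2 \<le> d" and i0: "i0 \<in> support"
    and mass: "12 * \<epsilon> < (\<Sum>i\<in>{i\<in>support. hat i \<le> hat i0}. l i)"
  shows "(real (bucket_size (bucket (l i0))))\<^sup>2 * l i0 \<le> 108 * real N * real k * \<epsilon>\<^sup>2"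
proof -
  define Db where "Db = bucket_size (bucket (l i0))"
  have Db: "0 < Db" using bucket_size_pos[OF in_own_bucket_set[OF i0]] by (simp add: Db_def)
  have l0: "0 < l i0" using l_pos[OF i0] .
  have hat_le: "hat i0 \<le> l i0" using Db l0 by (simp add: hat_def Db_def[symmetric] divide_le_eq)
  consider "2 \<le> Db" "3 * \<epsilon> \<le> real Db * l i0" | "Db = 1" "2 * \<epsilon> \<le> l i0"
    | "real Db * l i0 < 3 * \<epsilon>" "hat i0 < 2 * \<epsilon>"
  proof (cases "Db = 1")
    case True
    then have "hat i0 = l i0" by (simp add: hat_def Db_def)
    then show thesis using that(2,3) True eps_pos by (cases "2 * \<epsilon> \<le> l i0") auto
  next
    case False
    then have D2: "2 \<le> Db" using Db by simp
    show thesis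
    proof (cases "3 * \<epsilon> \<le> real Db * l i0")
      case False
      have "2 * l i0 \<le> real Db * l i0" using D2 l0 by (intro mult_right_mono) auto
      then have "hat i0 < 2 * \<epsilon>" using False hat_le eps_pos by linarith
      then show thesis using that(3) False by simp
    qed (use that(1) D2 in simp)
  qed
  then show ?thesis
  proof cases
    case 1
    then show ?thesis using lower_bound_large_bucket[OF in_own_bucket_set[OF i0] _ _ N] by (simp add: Db_def)
  next
    case 2
    then show ?thesis using lower_bound_singleton[OF support_less[OF i0] d _ N] by (simp add: Db_def)
  next
    case 3
    then show ?thesis using lower_bound_small_buckets[OF cut N i0 mass] by (simp add: Db_def)
  qed
qed

end

section \<open>Mass removal\<close>

lemma removed_count_less:
  assumes "ls \<noteq> []" "0 \<le> \<epsilon>"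
  shows "removed_count \<epsilon> ls < length ls"
proof -
  have "removed_count \<epsilon> ls < length ls \<and> sum_list (take (removed_count \<epsilon> ls) ls) \<le> 12 * \<epsilon>"
    unfolding removed_count_def
    by (rule GreatestI_nat[where P = "\<lambda>k. k < length ls \<and> sum_list (take k ls) \<le> 12 * \<epsilon>" and k = 0 and b = "length ls"])
      (use assms in auto)
  then show ?thesis ..
qed

text \<open>Including the first survivor overshoots the budget, either by maximality of the removed
  count or because the prefix is then the whole list. This supplies the mass that the copy bounds
  require.\<close>

lemma sum_take_removed_count_gt:
  assumes "ls \<noteq> []" "0 \<le> \<epsilon>" "12 * \<epsilon> < sum_list ls"
  shows "12 * \<epsilon> < sum_list (take (Suc (removed_count \<epsilon> ls)) ls)"
proof (rule ccontr)
  let ?P = "\<lambda>k. k < length ls \<and> sum_list (take k ls) \<le> 12 * \<epsilon>"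
  let ?r = "removed_count \<epsilon> ls"
  assume "\<not> 12 * \<epsilon> < sum_list (take (Suc ?r) ls)"
  then have le: "sum_list (take (Suc ?r) ls) \<le> 12 * \<epsilon>" by simp
  have "Suc ?r < length ls"
  proof (rule ccontr)
    assume "\<not> Suc ?r < length ls"
    then show False using le assms(3) by simp
  qed
  then have "Suc ?r \<le> ?r"
    unfolding removed_count_def[of \<epsilon> ls]
    using le by (intro Greatest_le_nat[where P = ?P and b = "length ls"]) (auto simp: removed_count_def)
  then show False by simp
qed

text \<open>The statement fixes \<open>ls\<close> only up to order, so a multiset identity is the
  right link; it turns sums over \<open>ls\<close> into sums over indices of the diagonal.\<close>

lemma mset_nonzero_spectrum:
  assumes U: "unitary_mat d U" and spec: "nonzero_spectrum (U * dmat d l * mat_adjoint U) ls"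
  shows "mset ls = image_mset l (mset_set {i. i < d \<and> l i \<noteq> 0})"
proof -
  let ?\<sigma> = "U * dmat d l * mat_adjoint U"
  have Uc: "U \<in> carrier_mat d d" "mat_adjoint U \<in> carrier_mat d d" "mat_adjoint U * U = 1\<^sub>m d" "U * mat_adjoint U = 1\<^sub>m d"
    using U by (auto simp: unitary_mat_def)
  have "?\<sigma> \<in> carrier_mat d d" by (rule mult_carrier_mat[OF mult_carrier_mat[OF Uc(1) rmat_carrier] Uc(2)])
  then have "similar_mat ?\<sigma> (dmat d l)" using Uc by (intro similar_matI[OF _ Uc(4,3) refl]) auto
  then have "char_poly ?\<sigma> = char_poly (dmat d l)" by (rule char_poly_similar)
  then have ev: "eigenvalue_list ?\<sigma> (map (\<lambda>i. complex_of_real (l i)) [0..<d])"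
    using eigenvalue_list_dmat[of d l] by (simp add: eigenvalue_list_def)
  obtain es where es: "eigenvalue_list ?\<sigma> es" "mset (map complex_of_real ls) = filter_mset (\<lambda>e. e \<noteq> 0) (mset es)"
    using spec unfolding nonzero_spectrum_def by blast
  have "mset es = image_mset (\<lambda>i. complex_of_real (l i)) (mset_set {..<d})"
    using eigenvalue_list_unique[OF es(1) ev] by (simp add: mset_set_upto_eq_mset_upto[symmetric] atLeast0LessThan)
  then have "mset (map complex_of_real ls) = filter_mset (\<lambda>e. e \<noteq> 0) (image_mset (\<lambda>i. complex_of_real (l i)) (mset_set {..<d}))"
    using es(2) by simp
  also have "\<dots> = image_mset (\<lambda>i. complex_of_real (l i)) (mset_set {i. i < d \<and> l i \<noteq> 0})"
    by (simp add: filter_mset_image_mset filter_mset_mset_set)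
  finally have "image_mset Re (mset (map complex_of_real ls))
    = image_mset Re (image_mset (\<lambda>i. complex_of_real (l i)) (mset_set {i. i < d \<and> l i \<noteq> 0}))" by simp
  then show ?thesis by (simp add: image_mset.compositionality o_def)
qed

context diagonal_certification
begin

text \<open>Each survivor obeys \<open>sqrt x \<le> sqrt K / D\<close>, so a full bucket contributes
  at most \<open>sqrt K\<close>. Of the three factors \<open>N\<close>, one sits in \<open>K\<close>
  and two come from squaring the sum over at most \<open>N\<close> buckets.\<close>

lemma half_norm_le:
  assumes ls: "mset ls = image_mset l (mset_set support)" and sorted: "sorted (map (hat_lambda ls) ls)"
    and d: "2 \<le> d" and eps: "\<epsilon> < 1 / 12" and N: "0 < N" "(real d)\<^sup>2 * (1 / 2) ^ N \<le> \<epsilon>"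
  shows "sigma_star_half_norm \<epsilon> ls \<le> 108 * real k * \<epsilon>\<^sup>2 * real N ^ 3"
proof -
  have sum_ls: "(\<Sum>x\<leftarrow>ls. f x) = (\<Sum>i\<in>support. f (l i))" for f :: "real \<Rightarrow> real"
  proof -
    have "(\<Sum>x\<leftarrow>ls. f x) = sum_mset (image_mset f (mset ls))" by (simp add: sum_mset_sum_list[symmetric])
    then show ?thesis unfolding ls by (simp add: sum_unfold_sum_mset image_mset.compositionality o_def)
  qed
  have set_ls: "set ls = l ` support"
  proof -
    have "set ls = set_mset (mset ls)" by simp
    then show ?thesis unfolding ls by simp
  qed
  have len: "length (filter (\<lambda>y. bucket y = m) ls) = bucket_size m" for m
  proof -
    have "real (length (filter (\<lambda>y. bucket y = m) ls)) = (\<Sum>x\<leftarrow>ls. if bucket x = m then 1 else 0)"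
      by (induction ls) auto
    also have "\<dots> = (\<Sum>i\<in>support. if bucket (l i) = m then 1 else 0)" by (rule sum_ls)
    also have "\<dots> = real (bucket_size m)" by (simp add: bucket_size_def bucket_set_def sum.If_cases Int_def)
    finally show ?thesis by simp
  qed
  have hat_l: "hat_lambda ls (l i) = hat i" for i by (simp add: hat_lambda_def hat_def len)
  have sumI: "(\<Sum>i\<in>support. l i) = 1"
    unfolding l_sum[symmetric] by (rule sum.mono_neutral_left) (auto simp: support_def)
  have ls_ne: "ls \<noteq> []" using sumI sum_ls[of "\<lambda>x. x"] by auto
  define r where "r = removed_count \<epsilon> ls"
  have r: "r < length ls" unfolding r_def using removed_count_less[OF ls_ne] eps_pos by simp
  have mass: "12 * \<epsilon> < sum_list (take (Suc r) ls)"
    unfolding r_def using sum_take_removed_count_gt[OF ls_ne] eps_pos eps sum_ls[of "\<lambda>x. x"] sumI by simp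
  have nn: "0 \<le> y" if y: "y \<in> set (drop n ls)" for y n
  proof -
    have "y \<in> l ` support" using y set_drop_subset[of n ls] set_ls by blast
    then show ?thesis using l_pos by (auto simp: less_imp_le)
  qed
  define K where "K = 108 * real N * real k * \<epsilon>\<^sup>2"
  have rem: "bucket x < N \<and> sqrt x \<le> sqrt K / real (bucket_size (bucket x))" if x: "x \<in> set (drop r ls)" for x
  proof -
    obtain q where q: "q < length ls - r" "x = ls ! (r + q)" using x by (auto simp: in_set_conv_nth)
    obtain i0 where i0: "i0 \<in> support" "x = l i0" using set_drop_subset[of r ls] x set_ls by blast
    have prefix: "hat_lambda ls y \<le> hat_lambda ls x" if y: "y \<in> set (take (Suc r) ls)" for y
    proof -
      obtain p where p: "p < Suc r" "y = ls ! p" using y by (auto simp: in_set_conv_nth)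
      have "map (hat_lambda ls) ls ! p \<le> map (hat_lambda ls) ls ! (r + q)"
        using sorted p q r by (intro sorted_nth_mono) auto
      then show ?thesis using p q r by simp
    qed
    \<comment> \<open>By sortedness the prefix ending with the first survivor lies below
      \<open>x\<close>, so its mass is part of the mass of all indices with
      \<open>hat i \<le> hat i0\<close>; ties only add to it.\<close>
    have "sum_list (take (Suc r) ls) = (\<Sum>y\<leftarrow>take (Suc r) ls. if hat_lambda ls y \<le> hat_lambda ls x then y else 0)"
      using prefix by (intro arg_cong[of _ _ sum_list] map_idI[symmetric]) auto
    also have "\<dots> \<le> (\<Sum>y\<leftarrow>take (Suc r) ls. if hat_lambda ls y \<le> hat_lambda ls x then y else 0)
        + (\<Sum>y\<leftarrow>drop (Suc r) ls. if hat_lambda ls y \<le> hat_lambda ls x then y else 0)"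
      using nn by (auto intro!: sum_list_nonneg)
    also have "\<dots> = (\<Sum>y\<leftarrow>ls. if hat_lambda ls y \<le> hat_lambda ls x then y else 0)"
      by (simp only: sum_list_append[symmetric] map_append[symmetric] append_take_drop_id)
    also have "\<dots> = (\<Sum>i\<in>support. if hat i \<le> hat i0 then l i else 0)"
      unfolding sum_ls by (simp add: hat_l i0)
    also have "\<dots> = (\<Sum>i\<in>{i\<in>support. hat i \<le> hat i0}. l i)" by (simp add: sum.inter_filter)
    finally have massI: "12 * \<epsilon> < (\<Sum>i\<in>{i\<in>support. hat i \<le> hat i0}. l i)" using mass by simp
    have Dx: "1 \<le> real (bucket_size (bucket x))" using bucket_size_pos[OF in_own_bucket_set[OF i0(1)]] i0(2) by simp
    have x0: "0 < x" using l_pos i0 by simp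
    \<comment> \<open>Reason for the square of \<open>d\<close> in \<open>N(2)\<close>: if
      \<open>hat i0\<close> is at most \<open>(1 / 2) ^ N\<close>, every index below it has
      \<open>l i \<le> d * (1 / 2) ^ N\<close>, one factor \<open>d\<close> for the bucket size and
      one for the number of indices, and the mass would be at most
      \<open>\<epsilon>\<close>.\<close>
    have "bucket x < N"
    proof (rule ccontr)
      assume "\<not> bucket x < N"
      then have "(1 / 2 :: real) ^ bucket x \<le> (1 / 2) ^ N" by (intro power_decreasing) auto
      moreover have "x \<le> (1 / 2) ^ bucket x" using l_bounds(2)[OF in_own_bucket_set[OF i0(1)]] i0(2) by simp
      ultimately have "x \<le> (1 / 2) ^ N" by (rule order_trans[rotated])
      moreover have "hat i0 \<le> x" using Dx x0 i0(2) by (simp add: hat_def divide_le_eq)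
      ultimately have h: "hat i0 \<le> (1 / 2) ^ N" by simp
      have Dd: "bucket_size m \<le> d" for m
        using card_mono[of "{..<d}" "bucket_set m"] by (auto simp: bucket_size_def bucket_set_def support_def)
      have "(\<Sum>i\<in>{i\<in>support. hat i \<le> hat i0}. l i) \<le> (\<Sum>i\<in>{i\<in>support. hat i \<le> hat i0}. real d * (1 / 2) ^ N)"
      proof (rule sum_mono)
        fix i assume i: "i \<in> {i\<in>support. hat i \<le> hat i0}"
        have "l i = real (bucket_size (bucket (l i))) * hat i" using bucket_size_pos[OF in_own_bucket_set, of i] i by (simp add: hat_def)
        also have "\<dots> \<le> real d * (1 / 2) ^ N" using i h Dd l_pos[of i] by (intro mult_mono) (auto simp: hat_def)
        finally show "l i \<le> real d * (1 / 2) ^ N" .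
      qed
      also have "\<dots> = real (card {i\<in>support. hat i \<le> hat i0}) * (real d * (1 / 2) ^ N)" by simp
      also have "\<dots> \<le> real d * (real d * (1 / 2) ^ N)"
      proof (intro mult_right_mono)
        have "card {i\<in>support. hat i \<le> hat i0} \<le> card {..<d}" by (intro card_mono) (auto simp: support_def)
        then show "real (card {i\<in>support. hat i \<le> hat i0}) \<le> real d" by simp
      qed auto
      also have "\<dots> \<le> \<epsilon>" using N(2) by (simp add: power2_eq_square mult.assoc)
      finally show False using massI eps_pos by simp
    qed
    moreover have "sqrt x \<le> sqrt K / real (bucket_size (bucket x))"
    proof -
      have "real d * (1 / 2) ^ N \<le> (real d)\<^sup>2 * (1 / 2) ^ N"
        using d by (intro mult_right_mono) (auto simp: power2_eq_square)
      then have cut: "real d * (1 / 2) ^ N \<le> \<epsilon>" using N(2) by (rule order_trans)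
      have "(real (bucket_size (bucket x)))\<^sup>2 * x \<le> K"
        using copies_lower_bound[OF cut N(1) d i0(1) massI] i0(2) by (simp add: K_def)
      then have "sqrt ((real (bucket_size (bucket x)))\<^sup>2 * x) \<le> sqrt K" by simp
      then show ?thesis using Dx by (simp add: real_sqrt_mult le_divide_eq mult.commute)
    qed
    ultimately show ?thesis by simp
  qed
  have K0: "0 \<le> K" by (simp add: K_def)
  let ?w = "\<lambda>x. if bucket x < N then sqrt K / real (bucket_size (bucket x)) else 0"
  have "(\<Sum>x\<leftarrow>drop r ls. sqrt x) \<le> (\<Sum>x\<leftarrow>drop r ls. ?w x)"
    using rem by (intro sum_list_mono) simp
  \<comment> \<open>Adding the removed eigenvalues back completes the buckets, so that the
    \<open>D\<close> terms \<open>sqrt K / D\<close> of each can be summed exactly.\<close>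
  also have "\<dots> \<le> (\<Sum>x\<leftarrow>take r ls. ?w x) + (\<Sum>x\<leftarrow>drop r ls. ?w x)"
    using K0 by (auto intro!: sum_list_nonneg)
  also have "\<dots> = (\<Sum>x\<leftarrow>ls. ?w x)"
    by (simp only: sum_list_append[symmetric] map_append[symmetric] append_take_drop_id)
  also have "\<dots> = (\<Sum>i\<in>support. ?w (l i))" by (rule sum_ls)
  also have "\<dots> = (\<Sum>i\<in>(\<Union>m\<in>{..<N}. bucket_set m). ?w (l i))"
    by (rule sum.mono_neutral_right) (auto simp: bucket_set_def)
  also have "\<dots> = (\<Sum>m<N. \<Sum>i\<in>bucket_set m. ?w (l i))"
    by (intro sum.UNION_disjoint) (auto simp: bucket_set_def)
  also have "\<dots> = (\<Sum>m<N. \<Sum>i\<in>bucket_set m. sqrt K / real (bucket_size m))"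
    by (intro sum.cong refl) (auto simp: bucket_set_def)
  also have "\<dots> \<le> (\<Sum>m<N. sqrt K)"
    using K0 by (intro sum_mono) (simp add: bucket_size_def[symmetric])
  finally have "(\<Sum>x\<leftarrow>drop r ls. sqrt x) \<le> real N * sqrt K" by simp
  moreover have "0 \<le> (\<Sum>x\<leftarrow>drop r ls. sqrt x)"
    using nn by (auto intro!: sum_list_nonneg)
  ultimately have "sigma_star_half_norm \<epsilon> ls \<le> (real N * sqrt K)\<^sup>2"
    unfolding sigma_star_half_norm_def r_def[symmetric] by (intro power_mono)
  also have "\<dots> = 108 * real k * \<epsilon>\<^sup>2 * real N ^ 3"
    using K0 by (simp add: K_def power_mult_distrib power2_eq_square power3_eq_cube)
  finally show ?thesis .
qed

end

text \<open>\<open>N\<close> is \<open>2 * x / ln 2\<close> rounded up, where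
  \<open>x = ln (d / \<epsilon>)\<close>, because \<open>d\<^sup>2 / \<epsilon> \<le> (d /
  \<epsilon>)\<^sup>2 = exp (2 * x)\<close>. With \<open>ln 2 \<ge> 1 / 2\<close> this is at most
  \<open>4 * x + 1\<close>, and \<open>x \<ge> 1\<close> since \<open>d / \<epsilon>\<close> exceeds
  24.\<close>

lemma exists_dyadic_scale:
  assumes \<epsilon>: "0 < \<epsilon>" "\<epsilon> < 1 / 12" and d: "2 \<le> d"
  shows "\<exists>N::nat. 0 < N \<and> (real d)\<^sup>2 * (1 / 2) ^ N \<le> \<epsilon> \<and> real N \<le> 5 * ln (real d / \<epsilon>)"
proof -
  define x where "x = ln (real d / \<epsilon>)"
  have de: "24 < real d / \<epsilon>"
  proof -
    have "24 * \<epsilon> < 2" using \<epsilon> by simp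
    also have "2 \<le> real d" using d by simp
    finally show ?thesis using \<epsilon> by (simp add: less_divide_eq)
  qed
  have x1: "1 \<le> x"
  proof -
    have "exp 1 \<le> (3::real)" by (rule exp_le)
    then have "exp 1 \<le> real d / \<epsilon>" using de by linarith
    then show ?thesis unfolding x_def using de by (subst ln_ge_iff) auto
  qed
  have ln2: "1 / 2 \<le> ln (2::real)"
  proof -
    have "exp (1 / 2) \<le> 1 + 1 / 2 + (1 / 2 :: real)\<^sup>2" by (rule exp_bound) auto
    also have "\<dots> \<le> 2" by (simp add: power2_eq_square)
    finally show ?thesis by (subst ln_ge_iff) auto
  qed
  define N where "N = nat \<lceil>2 * x / ln 2\<rceil>"
  have pos: "0 < 2 * x / ln 2" using x1 by simp
  have N_ge: "2 * x / ln 2 \<le> real N" by (simp add: N_def real_nat_ceiling_ge)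
  have N_le: "real N \<le> 2 * x / ln 2 + 1" using pos by (simp add: N_def)
  have "(real d)\<^sup>2 / \<epsilon> \<le> (real d / \<epsilon>)\<^sup>2"
  proof -
    have "\<epsilon> * (real d * real d) \<le> 1 * (real d * real d)" using \<epsilon> by (intro mult_right_mono) auto
    then show ?thesis using \<epsilon> by (simp add: power2_eq_square field_simps)
  qed
  also have "\<dots> = exp (2 * x)"
    using de by (simp add: x_def exp_double power2_eq_square)
  also have "\<dots> \<le> exp (real N * ln 2)" using N_ge by (simp add: field_simps)
  also have "\<dots> = 2 ^ N" by (simp add: exp_of_nat_mult)
  finally have "(real d)\<^sup>2 * (1 / 2) ^ N \<le> \<epsilon>" using \<epsilon> by (simp add: power_one_over field_simps)
  moreover have "0 < N" using N_ge pos by (metis gr0I not_le of_nat_0)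
  moreover have "real N \<le> 5 * x"
  proof -
    have "2 * x / ln 2 \<le> 2 * x / (1 / 2)" using ln2 x1 by (intro divide_left_mono) auto
    then show ?thesis using N_le x1 by simp
  qed
  ultimately show ?thesis unfolding x_def by blast
qed

theorem theorem5p1:
  "\<exists>c > 0. \<exists>C > 0. \<forall>(\<epsilon>::real) (d::nat) (\<sigma>::complex mat) (ls::real list) (k::nat).
     0 < \<epsilon> \<and> \<epsilon> < 1 / 12 \<and> d \<ge> 2 \<and> density_mat d \<sigma> \<and>
     nonzero_spectrum \<sigma> ls \<and> sorted (map (hat_lambda ls) ls) \<and>
     certifies d \<sigma> \<epsilon> k \<longrightarrow>
     real k \<ge> c * sigma_star_half_norm \<epsilon> ls / (\<epsilon> ^ 2 * ln (real d / \<epsilon>) powr C)"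
proof (intro exI conjI allI impI)
  \<comment> \<open>\<open>13500 = 108 * 5 ^ 3\<close>, with the 5 from
    \<open>N \<le> 5 * ln (d / \<epsilon>)\<close>; the exponent 3 is that of \<open>N\<close> in
    \<open>half_norm_le\<close>.\<close>
  show "(0::real) < 1 / 13500" "(0::real) < 3" by simp_all
  fix \<epsilon> :: real and d :: nat and \<sigma> :: "complex mat" and ls :: "real list" and k :: nat
  assume asm: "0 < \<epsilon> \<and> \<epsilon> < 1 / 12 \<and> d \<ge> 2 \<and> density_mat d \<sigma> \<and>
     nonzero_spectrum \<sigma> ls \<and> sorted (map (hat_lambda ls) ls) \<and> certifies d \<sigma> \<epsilon> k"
  then obtain U l where U: "unitary_mat d U" and l: "\<And>i. i < d \<Longrightarrow> 0 \<le> l i" "(\<Sum>i<d. l i) = 1"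
    and \<sigma>: "\<sigma> = U * dmat d l * mat_adjoint U"
    using density_mat_diagonalization by blast
  interpret diagonal_certification d l \<epsilon> k
    using asm l certifies_unitary[OF U rmat_carrier] unfolding \<sigma> by unfold_locales auto
  obtain N where N: "0 < N" "(real d)\<^sup>2 * (1 / 2) ^ N \<le> \<epsilon>" "real N \<le> 5 * ln (real d / \<epsilon>)"
    using exists_dyadic_scale asm by blast
  have L0: "0 < ln (real d / \<epsilon>)" using N(1,3) by (metis less_le_trans linorder_not_less mult_pos_pos of_nat_0_less_iff zero_less_mult_pos zero_less_numeral)
  have "mset ls = image_mset l (mset_set support)"
    unfolding support_def using mset_nonzero_spectrum[OF U] asm \<sigma> by simp
  then have "sigma_star_half_norm \<epsilon> ls \<le> 108 * real k * \<epsilon>\<^sup>2 * real N ^ 3"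
    using half_norm_le N(1,2) asm by blast
  also have "\<dots> \<le> 108 * real k * \<epsilon>\<^sup>2 * (5 * ln (real d / \<epsilon>)) ^ 3"
    using N(3) by (intro mult_left_mono power_mono) auto
  also have "\<dots> = 13500 * real k * (\<epsilon>\<^sup>2 * ln (real d / \<epsilon>) powr 3)"
    using L0 by (simp add: power_mult_distrib)
  finally show "real k \<ge> 1 / 13500 * sigma_star_half_norm \<epsilon> ls / (\<epsilon> ^ 2 * ln (real d / \<epsilon>) powr 3)"
    using L0 asm by (simp add: divide_le_eq mult_ac)
qed

end
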